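(* For every cocomplete category $\mathcal{C}$ there is an equivalence of categories $$\mathrm{Hom}_{\mathrm{c}}(\mathsf{Top},\mathcal{C}) \simeq \mathsf{CoTop}(\mathcal{C}).$$ Hence, $\mathsf{Top}$ is the universal example of a cocomplete category with a cotopological space object.
   Context: Conventions: categories are locally small unless otherwise stated; limits and colimits are small. $\mathrm{Hom}_{\mathrm{c}}$ denotes the category of cocontinuous functors (preserving small colimits) and natural transformations. "Universal example" means that there is a cotopological space object $E$ in $\mathsf{Top}$ such that the equivalence sends a cocontinuous functor $F:\mathsf{Top}\to\mathcal{C}$ to the image of $E$ under $F$. Directed sets are non-empty preordered sets in which any two elements have an upper bound. $P_{\ge p}:=\{q\in P:q\ge p\}$. A map $h:Q\to P$ of directed sets (not necessarily monotonic) is cofinal if for every $p\in P$ there is $q\in Q$ with $h(Q_{\ge q})\subseteq P_{\ge p}$. A subset $Q\subseteq P$ is cofinal if every $p\in P$ has some $q\in Q$ with $q\ge p$. Products of directed sets carry the componentwise order. For a map $h:Q\to P$, $X^h:X^P\to X^Q$ is defined by $\mathrm{pr}_q\circ X^h=\mathrm{pr}_{h(q)}$. Let $\mathcal{D}$ be complete. A topology (net convergence relation) on $X\in\mathcal{D}$ is a family of monomorphisms $\iota_P:C(P,X)\hookrightarrow X^P\times X$, one for each directed set $P$, such that: (1) (Constant nets) for every $P$ the diagonal $X\to X^P\times X$ factors through $\iota_P$. (2) (Subnets) for every cofinal map $h:Q\to P$ the morphism $(X^h\times\mathrm{id}_X)\circ\iota_P$ factors through $\iota_Q$. (3) (Locality)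 for every directed set $P$ and every family of cofinal maps $h_Q:R_Q\to Q$ (with $R_Q$ directed), one for each cofinal subset $Q\subseteq P$, let $F$ be the fiber product of $\prod_Q C(R_Q,X)$ and $X^P\times X$ over $\prod_Q (X^{R_Q}\times X)$, with respect to $\prod_Q\iota_{R_Q}$ and the morphism with components $X^{R_Q\to Q\subseteq P}\times\mathrm{id}_X$; then the projection $F\to X^P\times X$ factors through $\iota_P$. (4) (Iterations) for every directed set $P$ and every family $(Q_p)_{p\in P}$ of directed sets, let $G=\bigl(\prod_{p\in P}C(Q_p,X)\bigr)\times_{X^P}C(P,X)$, where the first morphism to $X^P$ has components $C(Q_p,X)\to X^{Q_p}\times X\to X$ and the second is $C(P,X)\to X^P\times X\to X^P$; then the morphism $G\to X^{P\times\prod_pQ_p}\times X$ whose $(p,f)$-component is $G\to C(Q_p,X)\to X^{Q_p}\xrightarrow{\mathrm{pr}_{f(p)}}X$ and whose last component is $G\to C(P,X)\to X$ factors through $\iota_{P\times\prod_pQ_p}$. $\mathsf{Top}(\mathcal{D})$ is the category of pairs $(X,C)$ of an object $X\in\mathcal{D}$ with a topology $C$; a morphism $(X,C)\to(Y,D)$ is a morphism $f:X\to Y$ in $\mathcal{D}$ such that for every directed set $P$ the composite $C(P,X)\to X^P\times X\xrightarrow{f^P\times f}Y^P\times Y$ factors through $D(P,Y)\hookrightarrow Y^P\times Y$. For a cocomplete category $\mathcal{C}$, the category of cotopological space objects is $\mathsf{CoTop}(\mathcal{C}):=\mathsf{Top}(\mathcal{C}^{\mathrm{op}})^{\mathrm{op}}$.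 Thus a cotopology on $X\in\mathcal{C}$ consists of epimorphisms $(P\otimes X)\sqcup X\twoheadrightarrow C(P,X)$ for all directed sets $P$ (with $P\otimes X=\coprod_{p\in P}X$) subject to the four dual axioms. A cocontinuous functor $\mathcal{C}\to\mathcal{C}'$ induces a functor $\mathsf{CoTop}(\mathcal{C})\to\mathsf{CoTop}(\mathcal{C}')$. *)

theory Defs
  imports "HOL-Analysis.Abstract_Topology"
begin

unbundle cardinal_syntax

section \<open>Smallness\<close>

text \<open>
  HOL has no distinction between sets and classes, so the universe of small sets is supplied by a
  type \<open>'u\<close> whose cardinality is strongly inaccessible: a set is small if it has fewer elements
  than \<open>'u\<close>. Every small set is in bijection with a subset of \<open>'u\<close>, so that small
  structures may be assumed to have carriers inside \<open>'u\<close>.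
\<close>

definition small :: "'u itself \<Rightarrow> 'a set \<Rightarrow> bool" where
  "small (U :: 'u itself) A \<longleftrightarrow> |A| <o |UNIV :: 'u set|"

definition inaccessible :: "'u itself \<Rightarrow> bool" where
  "inaccessible (U :: 'u itself) \<longleftrightarrow>
     |UNIV :: nat set| <o |UNIV :: 'u set| \<and> regularCard |UNIV :: 'u set| \<and>
     (\<forall>A :: 'u set. small U A \<longrightarrow> small U (Pow A))"


section \<open>Categories, functors, natural transformations\<close>

record ('o, 'm) cat =
  Obj :: "'o set"
  Arr :: "'m set"
  Dom :: "'m \<Rightarrow> 'o"
  Cod :: "'m \<Rightarrow> 'o"
  Id :: "'o \<Rightarrow> 'm"
  Comp :: "'m \<Rightarrow> 'm \<Rightarrow> 'm"  (infixr "\<cdot>\<index>" 70)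

definition homset :: "('o, 'm) cat \<Rightarrow> 'o \<Rightarrow> 'o \<Rightarrow> 'm set" where
  "homset C x y = {f \<in> Arr C. Dom C f = x \<and> Cod C f = y}"

locale category =
  fixes C :: "('o, 'm) cat" (structure)
  assumes dom_cod: "f \<in> Arr C \<Longrightarrow> Dom C f \<in> Obj C \<and> Cod C f \<in> Obj C"
    and id_hom: "x \<in> Obj C \<Longrightarrow> Id C x \<in> homset C x x"
    and comp_hom: "f \<in> homset C x y \<Longrightarrow> g \<in> homset C y z \<Longrightarrow> g \<cdot> f \<in> homset C x z"
    and id_left: "f \<in> homset C x y \<Longrightarrow> Id C y \<cdot> f = f"
    and id_right: "f \<in> homset C x y \<Longrightarrow> f \<cdot> Id C x = f"
    and comp_assoc: "f \<in> homset C w x \<Longrightarrow> g \<in> homset C x y \<Longrightarrow> h \<in> homset C y z \<Longrightarrow>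
      (h \<cdot> g) \<cdot> f = h \<cdot> (g \<cdot> f)"

definition locally_small :: "'u itself \<Rightarrow> ('o, 'm) cat \<Rightarrow> bool" where
  "locally_small U C \<longleftrightarrow> (\<forall>x \<in> Obj C. \<forall>y \<in> Obj C. small U (homset C x y))"

definition opcat :: "('o, 'm) cat \<Rightarrow> ('o, 'm) cat" where
  "opcat C = \<lparr>Obj = Obj C, Arr = Arr C, Dom = Cod C, Cod = Dom C, Id = Id C,
     Comp = (\<lambda>g f. f \<cdot>\<^bsub>C\<^esub> g)\<rparr>"

definition monic :: "('o, 'm) cat \<Rightarrow> 'm \<Rightarrow> bool" where
  "monic C m \<longleftrightarrow> m \<in> Arr C \<and>
     (\<forall>w. \<forall>f \<in> homset C w (Dom C m). \<forall>g \<in> homset C w (Dom C m).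
        m \<cdot>\<^bsub>C\<^esub> f = m \<cdot>\<^bsub>C\<^esub> g \<longrightarrow> f = g)"

definition is_iso :: "('o, 'm) cat \<Rightarrow> 'm \<Rightarrow> bool" where
  "is_iso C f \<longleftrightarrow> f \<in> Arr C \<and>
     (\<exists>g \<in> homset C (Cod C f) (Dom C f).
        g \<cdot>\<^bsub>C\<^esub> f = Id C (Dom C f) \<and> f \<cdot>\<^bsub>C\<^esub> g = Id C (Cod C f))"

definition factors_through :: "('o, 'm) cat \<Rightarrow> 'm \<Rightarrow> 'm \<Rightarrow> bool" where
  "factors_through C f m \<longleftrightarrow> f \<in> Arr C \<and> m \<in> Arr C \<and> Cod C f = Cod C m \<and>
     (\<exists>u \<in> homset C (Dom C f) (Dom C m). m \<cdot>\<^bsub>C\<^esub> u = f)"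

record ('a, 'b, 'c, 'd) ftr =
  fobj :: "'a \<Rightarrow> 'c"
  farr :: "'b \<Rightarrow> 'd"

definition is_functor :: "('a, 'b) cat \<Rightarrow> ('c, 'd) cat \<Rightarrow> ('a, 'b, 'c, 'd) ftr \<Rightarrow> bool" where
  "is_functor A B F \<longleftrightarrow> category A \<and> category B \<and>
     (\<forall>x \<in> Obj A. fobj F x \<in> Obj B) \<and>
     (\<forall>x y. \<forall>f \<in> homset A x y. farr F f \<in> homset B (fobj F x) (fobj F y)) \<and>
     (\<forall>x \<in> Obj A. farr F (Id A x) = Id B (fobj F x)) \<and>
     (\<forall>x y z. \<forall>f \<in> homset A x y. \<forall>g \<in> homset A y z.
        farr F (g \<cdot>\<^bsub>A\<^esub> f) = farr F g \<cdot>\<^bsub>B\<^esub> farr F f)"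

definition id_ftr :: "('a, 'b, 'a, 'b) ftr" where
  "id_ftr = \<lparr>fobj = (\<lambda>x. x), farr = (\<lambda>f. f)\<rparr>"

definition comp_ftr ::
  "('c, 'd, 'e, 'f) ftr \<Rightarrow> ('a, 'b, 'c, 'd) ftr \<Rightarrow> ('a, 'b, 'e, 'f) ftr" where
  "comp_ftr G F = \<lparr>fobj = (\<lambda>x. fobj G (fobj F x)), farr = (\<lambda>f. farr G (farr F f))\<rparr>"

definition is_nat_trans ::
  "('a, 'b) cat \<Rightarrow> ('c, 'd) cat \<Rightarrow> ('a, 'b, 'c, 'd) ftr \<Rightarrow> ('a, 'b, 'c, 'd) ftr \<Rightarrow> ('a \<Rightarrow> 'd) \<Rightarrow> bool"
where
  "is_nat_trans A B F G \<eta> \<longleftrightarrow> is_functor A B F \<and> is_functor A B G \<and>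
     (\<forall>x \<in> Obj A. \<eta> x \<in> homset B (fobj F x) (fobj G x)) \<and>
     (\<forall>x y. \<forall>f \<in> homset A x y. \<eta> y \<cdot>\<^bsub>B\<^esub> farr F f = farr G f \<cdot>\<^bsub>B\<^esub> \<eta> x)"

definition naturally_isomorphic ::
  "('a, 'b) cat \<Rightarrow> ('c, 'd) cat \<Rightarrow> ('a, 'b, 'c, 'd) ftr \<Rightarrow> ('a, 'b, 'c, 'd) ftr \<Rightarrow> bool" where
  "naturally_isomorphic A B F G \<longleftrightarrow>
     (\<exists>\<eta>. is_nat_trans A B F G \<eta> \<and> (\<forall>x \<in> Obj A. is_iso B (\<eta> x)))"

definition is_equivalence :: "('a, 'b) cat \<Rightarrow> ('c, 'd) cat \<Rightarrow> ('a, 'b, 'c, 'd) ftr \<Rightarrow> bool" where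
  "is_equivalence A B F \<longleftrightarrow> is_functor A B F \<and>
     (\<exists>G. is_functor B A G \<and>
        naturally_isomorphic A A id_ftr (comp_ftr G F) \<and>
        naturally_isomorphic B B (comp_ftr F G) id_ftr)"


section \<open>Colimits and cocontinuous functors\<close>

definition is_cocone ::
  "('i, 'j) cat \<Rightarrow> ('o, 'm) cat \<Rightarrow> ('i, 'j, 'o, 'm) ftr \<Rightarrow> 'o \<Rightarrow> ('i \<Rightarrow> 'm) \<Rightarrow> bool" where
  "is_cocone J C G x \<kappa> \<longleftrightarrow> x \<in> Obj C \<and>
     (\<forall>i \<in> Obj J. \<kappa> i \<in> homset C (fobj G i) x) \<and>
     (\<forall>i j. \<forall>a \<in> homset J i j. \<kappa> j \<cdot>\<^bsub>C\<^esub> farr G a = \<kappa> i)"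

definition is_colimit ::
  "('i, 'j) cat \<Rightarrow> ('o, 'm) cat \<Rightarrow> ('i, 'j, 'o, 'm) ftr \<Rightarrow> 'o \<Rightarrow> ('i \<Rightarrow> 'm) \<Rightarrow> bool" where
  "is_colimit J C G x \<kappa> \<longleftrightarrow> is_cocone J C G x \<kappa> \<and>
     (\<forall>y \<mu>. is_cocone J C G y \<mu> \<longrightarrow>
        (\<exists>!u. u \<in> homset C x y \<and> (\<forall>i \<in> Obj J. u \<cdot>\<^bsub>C\<^esub> \<kappa> i = \<mu> i)))"

definition small_category :: "('u, 'u) cat \<Rightarrow> bool" where
  "small_category J \<longleftrightarrow> category J \<and> small TYPE('u) (Obj J) \<and> small TYPE('u) (Arr J)"

definition cocomplete :: "'u itself \<Rightarrow> ('o, 'm) cat \<Rightarrow> bool" where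
  "cocomplete (U :: 'u itself) C \<longleftrightarrow>
     (\<forall>(J :: ('u, 'u) cat) G. small_category J \<and> is_functor J C G \<longrightarrow>
        (\<exists>x \<kappa>. is_colimit J C G x \<kappa>))"

definition cocontinuous ::
  "'u itself \<Rightarrow> ('a, 'b) cat \<Rightarrow> ('c, 'd) cat \<Rightarrow> ('a, 'b, 'c, 'd) ftr \<Rightarrow> bool" where
  "cocontinuous (U :: 'u itself) A B F \<longleftrightarrow> is_functor A B F \<and>
     (\<forall>(J :: ('u, 'u) cat) G x \<kappa>.
        small_category J \<and> is_functor J A G \<and> is_colimit J A G x \<kappa> \<longrightarrow>
        is_colimit J B (comp_ftr F G) (fobj F x) (\<lambda>i. farr F (\<kappa> i)))"

text \<open>
  The category of cocontinuous functors. An arrow is a triple of source, components and target;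
  values outside the objects and arrows of \<open>A\<close> are fixed by extensionality.
\<close>

definition Hom_c :: "'u itself \<Rightarrow> ('a, 'b) cat \<Rightarrow> ('c, 'd) cat \<Rightarrow>
  (('a, 'b, 'c, 'd) ftr, ('a, 'b, 'c, 'd) ftr \<times> ('a \<Rightarrow> 'd) \<times> ('a, 'b, 'c, 'd) ftr) cat" where
  "Hom_c U A B =
     (let Fs = {F. cocontinuous U A B F \<and>
                   fobj F \<in> extensional (Obj A) \<and> farr F \<in> extensional (Arr A)}
      in \<lparr>Obj = Fs,
          Arr = {(F, \<eta>, G) | F \<eta> G. F \<in> Fs \<and> G \<in> Fs \<and>
                   is_nat_trans A B F G \<eta> \<and> \<eta> \<in> extensional (Obj A)},
          Dom = (\<lambda>(F, \<eta>, G). F),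
          Cod = (\<lambda>(F, \<eta>, G). G),
          Id = (\<lambda>F. (F, \<lambda>x \<in> Obj A. Id B (fobj F x), F)),
          Comp = (\<lambda>(G', \<theta>, H) (F, \<eta>, G). (F, \<lambda>x \<in> Obj A. \<theta> x \<cdot>\<^bsub>B\<^esub> \<eta> x, H))\<rparr>)"


section \<open>Products and pullbacks\<close>

definition is_product ::
  "('o, 'm) cat \<Rightarrow> 'i set \<Rightarrow> ('i \<Rightarrow> 'o) \<Rightarrow> 'o \<Rightarrow> ('i \<Rightarrow> 'm) \<Rightarrow> bool" where
  "is_product D I A x \<pi> \<longleftrightarrow> x \<in> Obj D \<and> (\<forall>i \<in> I. \<pi> i \<in> homset D x (A i)) \<and>
     (\<forall>w \<in> Obj D. \<forall>f. (\<forall>i \<in> I. f i \<in> homset D w (A i)) \<longrightarrow>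
        (\<exists>!u. u \<in> homset D w x \<and> (\<forall>i \<in> I. \<pi> i \<cdot>\<^bsub>D\<^esub> u = f i)))"

text \<open>
  Chosen products. The restriction of the family to \<open>I\<close> makes the choice independent of the
  irrelevant values outside \<open>I\<close>.
\<close>

definition prod_cone :: "('o, 'm) cat \<Rightarrow> 'i set \<Rightarrow> ('i \<Rightarrow> 'o) \<Rightarrow> 'o \<times> ('i \<Rightarrow> 'm)" where
  "prod_cone D I A = (SOME c. is_product D I (restrict A I) (fst c) (snd c))"

definition prd :: "('o, 'm) cat \<Rightarrow> 'i set \<Rightarrow> ('i \<Rightarrow> 'o) \<Rightarrow> 'o" where
  "prd D I A = fst (prod_cone D I A)"

definition prj :: "('o, 'm) cat \<Rightarrow> 'i set \<Rightarrow> ('i \<Rightarrow> 'o) \<Rightarrow> 'i \<Rightarrow> 'm" where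
  "prj D I A = snd (prod_cone D I A)"

text \<open>The morphism into the product with components \<open>f i : w \<rightarrow> Cod (f i)\<close>.\<close>

definition tuple :: "('o, 'm) cat \<Rightarrow> 'i set \<Rightarrow> 'o \<Rightarrow> ('i \<Rightarrow> 'm) \<Rightarrow> 'm" where
  "tuple D I w f = (THE u. u \<in> homset D w (prd D I (\<lambda>i. Cod D (f i))) \<and>
     (\<forall>i \<in> I. prj D I (\<lambda>i. Cod D (f i)) i \<cdot>\<^bsub>D\<^esub> u = f i))"

text \<open>The product morphism of a family \<open>f i : Dom (f i) \<rightarrow> Cod (f i)\<close>.\<close>

definition prod_map :: "('o, 'm) cat \<Rightarrow> 'i set \<Rightarrow> ('i \<Rightarrow> 'm) \<Rightarrow> 'm" where
  "prod_map D I f = tuple D I (prd D I (\<lambda>i. Dom D (f i)))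
     (\<lambda>i. f i \<cdot>\<^bsub>D\<^esub> prj D I (\<lambda>i. Dom D (f i)) i)"

definition prd2 :: "('o, 'm) cat \<Rightarrow> 'o \<Rightarrow> 'o \<Rightarrow> 'o" where
  "prd2 D x y = prd D UNIV (case_bool x y)"

definition prj1 :: "('o, 'm) cat \<Rightarrow> 'o \<Rightarrow> 'o \<Rightarrow> 'm" where
  "prj1 D x y = prj D UNIV (case_bool x y) True"

definition prj2 :: "('o, 'm) cat \<Rightarrow> 'o \<Rightarrow> 'o \<Rightarrow> 'm" where
  "prj2 D x y = prj D UNIV (case_bool x y) False"

definition pairing :: "('o, 'm) cat \<Rightarrow> 'm \<Rightarrow> 'm \<Rightarrow> 'm" where
  "pairing D f g = tuple D UNIV (Dom D f) (case_bool f g)"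

definition prod_map2 :: "('o, 'm) cat \<Rightarrow> 'm \<Rightarrow> 'm \<Rightarrow> 'm" where
  "prod_map2 D f g = pairing D (f \<cdot>\<^bsub>D\<^esub> prj1 D (Dom D f) (Dom D g))
     (g \<cdot>\<^bsub>D\<^esub> prj2 D (Dom D f) (Dom D g))"

definition is_pullback :: "('o, 'm) cat \<Rightarrow> 'm \<Rightarrow> 'm \<Rightarrow> 'o \<Rightarrow> 'm \<Rightarrow> 'm \<Rightarrow> bool" where
  "is_pullback D f g z a b \<longleftrightarrow> f \<in> Arr D \<and> g \<in> Arr D \<and> Cod D f = Cod D g \<and>
     a \<in> homset D z (Dom D f) \<and> b \<in> homset D z (Dom D g) \<and> f \<cdot>\<^bsub>D\<^esub> a = g \<cdot>\<^bsub>D\<^esub> b \<and>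
     (\<forall>w. \<forall>a' \<in> homset D w (Dom D f). \<forall>b' \<in> homset D w (Dom D g).
        f \<cdot>\<^bsub>D\<^esub> a' = g \<cdot>\<^bsub>D\<^esub> b' \<longrightarrow>
        (\<exists>!u. u \<in> homset D w z \<and> a \<cdot>\<^bsub>D\<^esub> u = a' \<and> b \<cdot>\<^bsub>D\<^esub> u = b'))"


section \<open>Directed sets\<close>

text \<open>
  A directed set is given by its order relation \<open>P\<close>, where \<open>(p, q) \<in> P\<close> means \<open>p \<le> q\<close>; its
  carrier is \<open>Field P\<close>.
\<close>

definition directed :: "'a rel \<Rightarrow> bool" where
  "directed P \<longleftrightarrow> Preorder P \<and> Field P \<noteq> {} \<and>
     (\<forall>p \<in> Field P. \<forall>q \<in> Field P. \<exists>r. (p, r) \<in> P \<and> (q, r) \<in> P)"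

definition small_directed :: "'u rel \<Rightarrow> bool" where
  "small_directed P \<longleftrightarrow> directed P \<and> small TYPE('u) (Field P)"

definition cofinal_map :: "'b rel \<Rightarrow> 'a rel \<Rightarrow> ('b \<Rightarrow> 'a) \<Rightarrow> bool" where
  "cofinal_map Q P h \<longleftrightarrow> h ` Field Q \<subseteq> Field P \<and>
     (\<forall>p \<in> Field P. \<exists>q \<in> Field Q. \<forall>q'. (q, q') \<in> Q \<longrightarrow> (p, h q') \<in> P)"

definition cofinal_subsets :: "'a rel \<Rightarrow> 'a set set" where
  "cofinal_subsets P = {Q. Q \<subseteq> Field P \<and> (\<forall>p \<in> Field P. \<exists>q \<in> Q. (p, q) \<in> P)}"

text \<open>The directed set \<open>P \<times> (\<Prod>p. Q p)\<close> with the componentwise order.\<close>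

definition iter_index :: "'a rel \<Rightarrow> ('a \<Rightarrow> 'b rel) \<Rightarrow> ('a \<times> ('a \<Rightarrow> 'b)) rel" where
  "iter_index P Q = {((p, f), (p', f')) | p f p' f'. (p, p') \<in> P \<and>
     f \<in> (\<Pi>\<^sub>E i \<in> Field P. Field (Q i)) \<and> f' \<in> (\<Pi>\<^sub>E i \<in> Field P. Field (Q i)) \<and>
     (\<forall>i \<in> Field P. (f i, f' i) \<in> Q i)}"

definition order_iso :: "'a rel \<Rightarrow> 'b rel \<Rightarrow> ('a \<Rightarrow> 'b) \<Rightarrow> bool" where
  "order_iso R S \<phi> \<longleftrightarrow> bij_betw \<phi> (Field R) (Field S) \<and>
     (\<forall>x \<in> Field R. \<forall>y \<in> Field R. (x, y) \<in> R \<longleftrightarrow> (\<phi> x, \<phi> y) \<in> S)"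


section \<open>Internal topologies\<close>

text \<open>The objects \<open>X\<^sup>P\<close> and \<open>X\<^sup>P \<times> X\<close>, their projections, and \<open>X\<^sup>h : X\<^sup>P \<rightarrow> X\<^sup>Q\<close> for \<open>h : Q \<rightarrow> P\<close>.\<close>

definition pow :: "('o, 'm) cat \<Rightarrow> 'o \<Rightarrow> 'i rel \<Rightarrow> 'o" where
  "pow D X P = prd D (Field P) (\<lambda>_. X)"

definition pow_prj :: "('o, 'm) cat \<Rightarrow> 'o \<Rightarrow> 'i rel \<Rightarrow> 'i \<Rightarrow> 'm" where
  "pow_prj D X P = prj D (Field P) (\<lambda>_. X)"

definition nets :: "('o, 'm) cat \<Rightarrow> 'o \<Rightarrow> 'i rel \<Rightarrow> 'o" where
  "nets D X P = prd2 D (pow D X P) X"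

definition net_of :: "('o, 'm) cat \<Rightarrow> 'o \<Rightarrow> 'i rel \<Rightarrow> 'm" where
  "net_of D X P = prj1 D (pow D X P) X"

definition limit_of :: "('o, 'm) cat \<Rightarrow> 'o \<Rightarrow> 'i rel \<Rightarrow> 'm" where
  "limit_of D X P = prj2 D (pow D X P) X"

definition reindex :: "('o, 'm) cat \<Rightarrow> 'o \<Rightarrow> 'j rel \<Rightarrow> 'i rel \<Rightarrow> ('j \<Rightarrow> 'i) \<Rightarrow> 'm" where
  "reindex D X Q P h = tuple D (Field Q) (pow D X P) (\<lambda>q. pow_prj D X P (h q))"

text \<open>The morphism with components \<open>f p : w \<rightarrow> X\<close> and \<open>l : w \<rightarrow> X\<close> into \<open>X\<^sup>P \<times> X\<close>.\<close>

definition net_tuple :: "('o, 'm) cat \<Rightarrow> 'i rel \<Rightarrow> 'o \<Rightarrow> ('i \<Rightarrow> 'm) \<Rightarrow> 'm \<Rightarrow> 'm" where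
  "net_tuple D P w f l = pairing D (tuple D (Field P) w f) l"

text \<open>
  In the following four axioms \<open>\<iota> P : C(P,X) \<rightarrow> X\<^sup>P \<times> X\<close>, so that \<open>C(P,X)\<close> is
  \<open>Dom D (\<iota> P)\<close>. The family \<open>\<iota>\<close> is indexed by the small directed sets with carrier inside
  \<open>'u\<close>. The fiber products are only determined up to isomorphism, and the axioms are
  required for all of them.
\<close>

definition constant_nets :: "('o, 'm) cat \<Rightarrow> 'o \<Rightarrow> ('u rel \<Rightarrow> 'm) \<Rightarrow> bool" where
  "constant_nets D X \<iota> \<longleftrightarrow> (\<forall>P. small_directed P \<longrightarrow>
     factors_through D (net_tuple D P X (\<lambda>_. Id D X) (Id D X)) (\<iota> P))"

definition subnets :: "('o, 'm) cat \<Rightarrow> 'o \<Rightarrow> ('u rel \<Rightarrow> 'm) \<Rightarrow> bool" where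
  "subnets D X \<iota> \<longleftrightarrow> (\<forall>P Q h. small_directed P \<and> small_directed Q \<and> cofinal_map Q P h \<longrightarrow>
     factors_through D (prod_map2 D (reindex D X Q P h) (Id D X) \<cdot>\<^bsub>D\<^esub> \<iota> P) (\<iota> Q))"

definition locality :: "('o, 'm) cat \<Rightarrow> 'o \<Rightarrow> ('u rel \<Rightarrow> 'm) \<Rightarrow> bool" where
  "locality D X \<iota> \<longleftrightarrow> (\<forall>P (R :: 'u set \<Rightarrow> 'u rel) (h :: 'u set \<Rightarrow> 'u \<Rightarrow> 'u).
     small_directed P \<and>
     (\<forall>Q \<in> cofinal_subsets P. small_directed (R Q) \<and> cofinal_map (R Q) (Restr P Q) (h Q)) \<longrightarrow>
     (\<forall>F a b. is_pullback D
         (prod_map D (cofinal_subsets P) (\<lambda>Q. \<iota> (R Q)))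
         (tuple D (cofinal_subsets P) (nets D X P)
            (\<lambda>Q. prod_map2 D (reindex D X (R Q) P (h Q)) (Id D X)))
         F a b \<longrightarrow>
       factors_through D b (\<iota> P)))"

text \<open>
  The product \<open>P \<times> (\<Prod>p. Q p)\<close> does not have its carrier inside \<open>'u\<close>; it is represented by
  any small directed set \<open>S\<close> on \<open>'u\<close> together with an isomorphism \<open>\<phi>\<close> to it.
\<close>

definition iterations :: "('o, 'm) cat \<Rightarrow> 'o \<Rightarrow> ('u rel \<Rightarrow> 'm) \<Rightarrow> bool" where
  "iterations D X \<iota> \<longleftrightarrow> (\<forall>P (Q :: 'u \<Rightarrow> 'u rel) (S :: 'u rel) \<phi>.
     small_directed P \<and> (\<forall>p \<in> Field P. small_directed (Q p)) \<and>
     small_directed S \<and> order_iso S (iter_index P Q) \<phi> \<longrightarrow>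
     (let A = prd D (Field P) (\<lambda>p. Dom D (\<iota> (Q p)));
          pr = prj D (Field P) (\<lambda>p. Dom D (\<iota> (Q p)))
      in \<forall>G a b. is_pullback D
           (tuple D (Field P) A (\<lambda>p. limit_of D X (Q p) \<cdot>\<^bsub>D\<^esub> \<iota> (Q p) \<cdot>\<^bsub>D\<^esub> pr p))
           (net_of D X P \<cdot>\<^bsub>D\<^esub> \<iota> P)
           G a b \<longrightarrow>
         factors_through D
           (net_tuple D S G
              (\<lambda>s. case \<phi> s of (p, f) \<Rightarrow> pow_prj D X (Q p) (f p) \<cdot>\<^bsub>D\<^esub>
                 net_of D X (Q p) \<cdot>\<^bsub>D\<^esub> \<iota> (Q p) \<cdot>\<^bsub>D\<^esub> pr p \<cdot>\<^bsub>D\<^esub> a)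
              (limit_of D X P \<cdot>\<^bsub>D\<^esub> \<iota> P \<cdot>\<^bsub>D\<^esub> b))
           (\<iota> S)))"

definition is_topology :: "('o, 'm) cat \<Rightarrow> 'o \<Rightarrow> ('u rel \<Rightarrow> 'm) \<Rightarrow> bool" where
  "is_topology D X \<iota> \<longleftrightarrow> X \<in> Obj D \<and> \<iota> \<in> extensional {P. small_directed P} \<and>
     (\<forall>P. small_directed P \<longrightarrow> monic D (\<iota> P) \<and> Cod D (\<iota> P) = nets D X P) \<and>
     constant_nets D X \<iota> \<and> subnets D X \<iota> \<and> locality D X \<iota> \<and> iterations D X \<iota>"

text \<open>
  The category of internal topological spaces; meaningful for \<open>D\<close> complete. An arrow is a triple
  of source, underlying morphism and target.
\<close>

definition Top_in :: "('o, 'm) cat \<Rightarrow>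
  ('o \<times> ('u rel \<Rightarrow> 'm), ('o \<times> ('u rel \<Rightarrow> 'm)) \<times> 'm \<times> ('o \<times> ('u rel \<Rightarrow> 'm))) cat" where
  "Top_in D =
     \<lparr>Obj = {(X, \<iota>). is_topology D X \<iota>},
      Arr = {((X, \<iota>), f, (Y, \<kappa>)) | X \<iota> f Y \<kappa>.
               is_topology D X \<iota> \<and> is_topology D Y \<kappa> \<and> f \<in> homset D X Y \<and>
               (\<forall>P. small_directed P \<longrightarrow>
                  factors_through D
                    (prod_map2 D (prod_map D (Field P) (\<lambda>_. f)) f \<cdot>\<^bsub>D\<^esub> \<iota> P) (\<kappa> P))},
      Dom = (\<lambda>(S, f, T). S),
      Cod = (\<lambda>(S, f, T). T),
      Id = (\<lambda>S. (S, Id D (fst S), S)),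
      Comp = (\<lambda>(T', g, W) (S, f, T). (S, g \<cdot>\<^bsub>D\<^esub> f, W))\<rparr>"

definition CoTop :: "('o, 'm) cat \<Rightarrow>
  ('o \<times> ('u rel \<Rightarrow> 'm), ('o \<times> ('u rel \<Rightarrow> 'm)) \<times> 'm \<times> ('o \<times> ('u rel \<Rightarrow> 'm))) cat" where
  "CoTop C = opcat (Top_in (opcat C))"

text \<open>
  The image of an internal space \<open>(X, \<iota>)\<close> under a functor \<open>F\<close>, which is meant to preserve
  limits: \<open>F(\<iota> P)\<close> followed by the comparison morphism from \<open>F(X\<^sup>P \<times> X)\<close> to
  \<open>(F X)\<^sup>P \<times> F X\<close>. A cocontinuous functor from \<open>C\<close> to \<open>C'\<close> acts on cotopological
  spaces by this construction for the opposite categories.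
\<close>

definition space_image :: "('a, 'b) cat \<Rightarrow> ('c, 'd) cat \<Rightarrow> ('a, 'b, 'c, 'd) ftr \<Rightarrow>
  'a \<times> ('u rel \<Rightarrow> 'b) \<Rightarrow> 'c \<times> ('u rel \<Rightarrow> 'd)" where
  "space_image D D' F = (\<lambda>(X, \<iota>). (fobj F X, \<lambda>P \<in> {P. small_directed P}.
     net_tuple D' P (fobj F (nets D X P))
       (\<lambda>p. farr F (pow_prj D X P p \<cdot>\<^bsub>D\<^esub> net_of D X P))
       (farr F (limit_of D X P))
     \<cdot>\<^bsub>D'\<^esub> farr F (\<iota> P)))"

definition cospace_image :: "('a, 'b) cat \<Rightarrow> ('c, 'd) cat \<Rightarrow> ('a, 'b, 'c, 'd) ftr \<Rightarrow>
  'a \<times> ('u rel \<Rightarrow> 'b) \<Rightarrow> 'c \<times> ('u rel \<Rightarrow> 'd)" where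
  "cospace_image C C' F = space_image (opcat C) (opcat C') F"

text \<open>
  Evaluation at a cotopological space object \<open>E\<close> in \<open>C\<close>, a functor from \<open>Hom_c C C'\<close> to
  \<open>CoTop C'\<close>. A transformation \<open>\<eta> : F \<rightarrow> G\<close> goes to its component at the object underlying
  \<open>E\<close>; the triple is reversed because arrows of \<open>CoTop C'\<close> are stored as
  arrows of \<open>Top_in (opcat C')\<close>.
\<close>

definition evaluation :: "('a, 'b) cat \<Rightarrow> ('c, 'd) cat \<Rightarrow> 'a \<times> ('u rel \<Rightarrow> 'b) \<Rightarrow>
  (('a, 'b, 'c, 'd) ftr, ('a, 'b, 'c, 'd) ftr \<times> ('a \<Rightarrow> 'd) \<times> ('a, 'b, 'c, 'd) ftr,
   'c \<times> ('u rel \<Rightarrow> 'd), ('c \<times> ('u rel \<Rightarrow> 'd)) \<times> 'd \<times> ('c \<times> ('u rel \<Rightarrow> 'd))) ftr" where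
  "evaluation C C' E =
     \<lparr>fobj = (\<lambda>F. cospace_image C C' F E),
      farr = (\<lambda>(F, \<eta>, G). (cospace_image C C' G E, \<eta> (fst E), cospace_image C C' F E))\<rparr>"


section \<open>Topological spaces and the universal cotopological space\<close>

definition TOP :: "('u topology, 'u topology \<times> ('u \<Rightarrow> 'u) \<times> 'u topology) cat" where
  "TOP =
     (let Ts = {T :: 'u topology. small TYPE('u) (topspace T)}
      in \<lparr>Obj = Ts,
          Arr = {(S, f, T) | S f T. S \<in> Ts \<and> T \<in> Ts \<and>
                   continuous_map S T f \<and> f \<in> extensional (topspace S)},
          Dom = (\<lambda>(S, f, T). S),
          Cod = (\<lambda>(S, f, T). T),
          Id = (\<lambda>S. (S, \<lambda>x \<in> topspace S. x, S)),
          Comp = (\<lambda>(T', g, W) (S, f, T). (S, compose (topspace S) g f, W))\<rparr>)"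

text \<open>
  The space \<open>P \<union> {\<infinity>}\<close> in which the points of \<open>P\<close> are isolated and the tails of \<open>P\<close> form a
  neighbourhood basis of \<open>\<infinity>\<close>. It classifies convergent nets: a continuous map from it to \<open>X\<close>
  is a net indexed by \<open>P\<close> with a limit point.
\<close>

definition infpt :: "'u rel \<Rightarrow> 'u" where
  "infpt P = (SOME x. x \<notin> Field P)"

definition net_space :: "'u rel \<Rightarrow> 'u topology" where
  "net_space P = topology (\<lambda>U. U \<subseteq> insert (infpt P) (Field P) \<and>
     (infpt P \<in> U \<longrightarrow> (\<exists>p \<in> Field P. \<forall>q. (p, q) \<in> P \<longrightarrow> q \<in> U)))"

definition point_space :: "'u topology" where
  "point_space = discrete_topology {undefined}"

definition point_of :: "'u topology \<Rightarrow> 'u \<Rightarrow> 'u topology \<times> ('u \<Rightarrow> 'u) \<times> 'u topology" where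
  "point_of T x = (point_space, \<lambda>_ \<in> topspace point_space. x, T)"

text \<open>
  The one-point space with the cotopology given by the canonical map from the coproduct
  \<open>(P \<otimes> 1) \<squnion> 1\<close>, a discrete space, to \<open>P \<union> {\<infinity>}\<close>.
\<close>

definition universal_cospace ::
  "'u topology \<times> ('u rel \<Rightarrow> 'u topology \<times> ('u \<Rightarrow> 'u) \<times> 'u topology)" where
  "universal_cospace = (point_space, \<lambda>P \<in> {P. small_directed P}.
     net_tuple (opcat TOP) P (net_space P)
       (\<lambda>p. point_of (net_space P) p) (point_of (net_space P) (infpt P)))"

end

theory Submission
  imports Defs
begin

text \<open>
  Why the theorem holds. Let \<open>F\<close> be a cocontinuous functor from spaces to \<open>C\<close>, and \<open>X\<close> its value at
  the one-point space. Since a space is a colimit of points and other spaces, a morphism from \<open>F T\<close>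
  to an object \<open>y\<close> is a family of morphisms \<open>X \<rightarrow> y\<close>, one for each point of \<open>T\<close>, subject to conditions;
  and these conditions say that the family is a continuous map from \<open>T\<close> to \<open>hom X y\<close> for
  a suitable topology on this set (\<open>extends_topology\<close>). In particular, a morphism from
  \<open>F (P \<union> {\<infinity>})\<close> to \<open>y\<close> is a convergent net in \<open>hom X y\<close>. So \<open>F\<close> amounts to an object \<open>X\<close> with
  topologies on all sets \<open>hom X y\<close>, natural in \<open>y\<close>, whose convergence relations are represented by objects
  \<open>C(P,X)\<close> of \<open>C\<close>.

  A cotopology on \<open>X\<close> is the same thing. By the Yoneda lemma the four axioms hold for the objects
  \<open>C(P,X)\<close> if and only if, for every \<open>y\<close>, they hold for the relation between nets and points of
  \<open>hom X y\<close> that \<open>C(P,X)\<close> represents (\<open>topology_iff_net_convergence\<close>). For relations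
  on a set the axioms are those of Kelley's theorem, which characterizes the convergence relations of topologies
  (\<open>net_limit_net_convergence\<close>, \<open>net_convergence_topology\<close>).

  To turn this into an equivalence of categories, evaluation at the universal example is shown to be
  fully faithful and essentially surjective (\<open>ev_fully_faithful\<close>, \<open>classified_evaluation\<close>). Both rest on one
  description of spaces: \<open>T\<close> carries the final topology with respect to its convergent nets (\<open>final_net_maps\<close>), a small
  number of nets suffices (\<open>final_maps_small\<close>), and therefore \<open>T\<close> is a small colimit of points
  and spaces \<open>P \<union> {\<infinity>}\<close> (\<open>final_bip_colimit\<close>). Hence a transformation between cocontinuous functors is
  determined by its component at the point, which only has to respect convergence of nets
  (\<open>nat_trans_exists\<close>). Conversely, given a cotopological space \<open>X\<close>, the same colimit formed in \<open>C\<close> from copies of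
  \<open>X\<close> and objects \<open>C(P,X)\<close> represents the functor sending \<open>y\<close> to the set of continuous maps from \<open>T\<close> to
  \<open>hom X y\<close> (\<open>space_represented\<close>). As a left adjoint of \<open>y \<mapsto> hom X y\<close> it is cocontinuous in \<open>T\<close>
  (\<open>classified_cocontinuous\<close>), and its value at the universal example is \<open>X\<close>.
\<close>

section \<open>Small sets\<close>

lemma small_image: "small U A \<Longrightarrow> small U (f ` A)"
  unfolding small_def using card_of_image ordLeq_ordLess_trans by blast

lemma small_subset: "small U A \<Longrightarrow> B \<subseteq> A \<Longrightarrow> small U B"
  unfolding small_def using card_of_mono1 ordLeq_ordLess_trans by blast

lemma small_ex_inj:
  fixes A :: "'a set"
  assumes "small TYPE('u) A"
  obtains e :: "'a \<Rightarrow> 'u" where "inj_on e A"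
proof -
  have "|A| \<le>o |UNIV :: 'u set|"
    using assms unfolding small_def using ordLess_imp_ordLeq by blast
  then show ?thesis
    using that by (metis card_of_ordLeq)
qed

lemma small_bij: "bij_betw f A B \<Longrightarrow> small U A \<longleftrightarrow> small U B"
  by (metis bij_betw_def bij_betw_inv_into small_image)

lemma small_inj_image: "inj_on f A \<Longrightarrow> small U (f ` A) \<longleftrightarrow> small U A"
  by (metis inj_on_imp_bij_betw small_bij)

text \<open>
  Only the cardinality of \<open>'u\<close> matters, so the parameter is a mere type token. It is kept as a
  parameter to let the locales below, whose other parameters need not mention \<open>'u\<close>, fix the universe.
\<close>

locale universe =
  fixes \<UU> :: "'u itself"
  assumes inacc_univ: "inaccessible \<UU>"
begin

lemma inacc: "inaccessible TYPE('u)"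
  using inacc_univ by (simp add: inaccessible_def small_def)

lemma inf_univ: "infinite (UNIV :: 'u set)"
proof
  assume "finite (UNIV :: 'u set)"
  moreover have "|UNIV :: nat set| \<le>o |UNIV :: 'u set|"
    using inacc ordLess_imp_ordLeq unfolding inaccessible_def by blast
  ultimately show False
    using card_of_ordLeq_finite by blast
qed

lemma small_finite: "finite A \<Longrightarrow> small TYPE('u) A"
  unfolding small_def using inf_univ
  by (intro finite_ordLess_infinite card_of_Well_order) (simp_all add: Field_card_of)

lemma small_Plus: "small TYPE('u) A \<Longrightarrow> small TYPE('u) B \<Longrightarrow> small TYPE('u) (A <+> B)"
  unfolding small_def using card_of_Plus_ordLess_infinite inf_univ by blast

lemma small_Un: "small TYPE('u) A \<Longrightarrow> small TYPE('u) B \<Longrightarrow> small TYPE('u) (A \<union> B)"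
  unfolding small_def using card_of_Un_ordLess_infinite inf_univ by blast

lemma small_insert: "small TYPE('u) A \<Longrightarrow> small TYPE('u) (insert x A)"
  using small_Un[OF small_finite[of "{x}"], of A] by simp

lemma small_UN:
  fixes I :: "'i set" and A :: "'i \<Rightarrow> 'a set"
  assumes I: "small TYPE('u) I" and A: "\<And>i. i \<in> I \<Longrightarrow> small TYPE('u) (A i)"
  shows "small TYPE('u) (\<Union>i\<in>I. A i)"
proof -
  let ?r = "|UNIV :: 'u set|"
  have "Cinfinite ?r"
    using inf_univ using card_of_Card_order[of "UNIV :: 'u set"] by (simp add: cinfinite_def Field_card_of)
  moreover have "regularCard ?r" using inacc unfolding inaccessible_def by blast
  ultimately show ?thesis
    using card_of_UNION_ordLess_infinite_Field_regularCard[of ?r I A] assms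
    unfolding small_def cinfinite_def by auto
qed

lemma small_Sigma:
  assumes I: "small TYPE('u) I" and A: "\<And>i. i \<in> I \<Longrightarrow> small TYPE('u) (A i)"
  shows "small TYPE('u) (Sigma I A)"
proof -
  have "Sigma I A = (\<Union>i\<in>I. Pair i ` A i)" by auto
  then show ?thesis using small_UN[OF I, of "\<lambda>i. Pair i ` A i"] A small_image by metis
qed

lemma small_Times: "small TYPE('u) A \<Longrightarrow> small TYPE('u) B \<Longrightarrow> small TYPE('u) (A \<times> B)"
  by (rule small_Sigma)

lemma small_Pow:
  fixes A :: "'a set"
  assumes "small TYPE('u) A"
  shows "small TYPE('u) (Pow A)"
proof -
  obtain e :: "'a \<Rightarrow> 'u" where e: "inj_on e A" using small_ex_inj[OF assms] .
  have "small TYPE('u) (Pow (e ` A))"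
    using inacc small_image[OF assms] unfolding inaccessible_def by blast
  moreover have "inj_on (image e) (Pow A)"
    using e by (simp add: inj_on_image_Pow)
  moreover have "image e ` Pow A \<subseteq> Pow (e ` A)" by auto
  ultimately show ?thesis using small_inj_image[of "image e" "Pow A"] small_subset by metis
qed

text \<open>
  A function in the product is determined by its graph, a subset of the small set \<open>Sigma I A\<close>.
\<close>

lemma small_PiE:
  assumes I: "small TYPE('u) I" and A: "\<And>i. i \<in> I \<Longrightarrow> small TYPE('u) (A i)"
  shows "small TYPE('u) (PiE I A)"
proof -
  let ?g = "\<lambda>f. {(i, f i) | i. i \<in> I}"
  have "small TYPE('u) (?g ` PiE I A)"
  proof (rule small_subset)
    show "small TYPE('u) (Pow (Sigma I A))" using small_Pow small_Sigma assms by blast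
    show "?g ` PiE I A \<subseteq> Pow (Sigma I A)" by auto
  qed
  moreover have "inj_on ?g (PiE I A)"
  proof (rule inj_onI)
    fix f g assume f: "f \<in> PiE I A" and g: "g \<in> PiE I A" and eq: "?g f = ?g g"
    show "f = g"
    proof (rule PiE_ext[OF f g])
      fix i assume "i \<in> I"
      then have "(i, f i) \<in> ?g g" using eq by blast
      then show "f i = g i" by blast
    qed
  qed
  ultimately show ?thesis  by (simp only: small_inj_image)
qed

lemma small_not_UNIV: "small TYPE('u) (A :: 'u set) \<Longrightarrow> A \<noteq> UNIV"
  unfolding small_def using ordLess_irreflexive by blast

end

section \<open>Categories\<close>

lemma homsetD: "f \<in> homset C x y \<Longrightarrow> f \<in> Arr C \<and> Dom C f = x \<and> Cod C f = y"
  by (simp add: homset_def)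

context category begin

lemma hom_obj: "f \<in> homset C x y \<Longrightarrow> x \<in> Obj C \<and> y \<in> Obj C"
  using dom_cod by (auto simp: homset_def)

lemma is_isoI:
  assumes "f \<in> homset C x y" "g \<in> homset C y x" "g \<cdot> f = Id C x" "f \<cdot> g = Id C y"
  shows "is_iso C f"
  using assms by (auto simp: is_iso_def homset_def)

lemma is_isoE:
  assumes "is_iso C f" "f \<in> homset C x y"
  obtains g where "g \<in> homset C y x" "g \<cdot> f = Id C x" "f \<cdot> g = Id C y"
  using assms by (auto simp: is_iso_def homset_def)

lemma opcat_category: "category (opcat C)"
proof (unfold_locales, goal_cases)
  case (1 f) then show ?case using dom_cod by (simp add: opcat_def)
next
  case (2 x) then show ?case using id_hom[of x] by (simp add: opcat_def homset_def)
next
  case (3 f x y g z) then show ?case using comp_hom[of g z y f x] by (simp add: opcat_def homset_def)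
next
  case (4 f x y) then show ?case using id_right[of f y x] by (simp add: opcat_def homset_def)
next
  case (5 f x y) then show ?case using id_left[of f y x] by (simp add: opcat_def homset_def)
next
  case (6 f w x g y h z) then show ?case
    using comp_assoc[of h z y g x f w] by (simp add: opcat_def homset_def)
qed

end

lemma opcat_simps [simp]:
  "Obj (opcat C) = Obj C" "Arr (opcat C) = Arr C" "Dom (opcat C) = Cod C" "Cod (opcat C) = Dom C"
  "Id (opcat C) = Id C" "g \<cdot>\<^bsub>opcat C\<^esub> f = f \<cdot>\<^bsub>C\<^esub> g"
  "homset (opcat C) x y = homset C y x"
  by (auto simp: opcat_def homset_def)

lemma functorD:
  assumes "is_functor A B F"
  shows "category A" "category B" "x \<in> Obj A \<Longrightarrow> fobj F x \<in> Obj B"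
    "f \<in> homset A x y \<Longrightarrow> farr F f \<in> homset B (fobj F x) (fobj F y)"
    "x \<in> Obj A \<Longrightarrow> farr F (Id A x) = Id B (fobj F x)"
    "f \<in> homset A x y \<Longrightarrow> g \<in> homset A y z \<Longrightarrow>
       farr F (g \<cdot>\<^bsub>A\<^esub> f) = farr F g \<cdot>\<^bsub>B\<^esub> farr F f"
  using assms unfolding is_functor_def by blast+

lemma comp_ftr_functor:
  assumes "is_functor A B F" "is_functor B C G"
  shows "is_functor A C (comp_ftr G F)"
  using assms unfolding is_functor_def comp_ftr_def by (simp, blast)

subsection \<open>Fully faithful, essentially surjective functors\<close>

text \<open>
  The inverse functor \<open>G\<close> is obtained by choosing, for every object \<open>b\<close>, an object \<open>g b\<close> and an
  isomorphism \<open>e b : F (g b) \<rightarrow> b\<close>; an arrow \<open>v\<close> is conjugated with these isomorphisms to the arrow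
  \<open>w v\<close> between values of \<open>F\<close>, which has a unique preimage under \<open>F\<close>.
  Every equation between arrows of \<open>A\<close> is proved after applying \<open>F\<close> and cancelling some \<open>e b\<close>.
\<close>

lemma equivalence_if_ff_es:
  assumes F: "is_functor A B F"
    and ff: "\<And>a a'. a \<in> Obj A \<Longrightarrow> a' \<in> Obj A \<Longrightarrow>
      bij_betw (farr F) (homset A a a') (homset B (fobj F a) (fobj F a'))"
    and es: "\<And>b. b \<in> Obj B \<Longrightarrow> \<exists>a \<in> Obj A. \<exists>f \<in> homset B (fobj F a) b. is_iso B f"
  shows "is_equivalence A B F"
proof -
  interpret A: category A using functorD[OF F] by blast
  interpret B: category B using functorD[OF F] by blast
  obtain g e where g: "\<And>b. b \<in> Obj B \<Longrightarrow> g b \<in> Obj A"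
    and e: "\<And>b. b \<in> Obj B \<Longrightarrow> e b \<in> homset B (fobj F (g b)) b"
    and e_iso: "\<And>b. b \<in> Obj B \<Longrightarrow> is_iso B (e b)"
    using es by metis
  have "\<forall>b. \<exists>i. b \<in> Obj B \<longrightarrow> i \<in> homset B b (fobj F (g b)) \<and>
      i \<cdot>\<^bsub>B\<^esub> e b = Id B (fobj F (g b)) \<and> e b \<cdot>\<^bsub>B\<^esub> i = Id B b"
  proof
    fix b show "\<exists>i. b \<in> Obj B \<longrightarrow> i \<in> homset B b (fobj F (g b)) \<and>
      i \<cdot>\<^bsub>B\<^esub> e b = Id B (fobj F (g b)) \<and> e b \<cdot>\<^bsub>B\<^esub> i = Id B b"
    proof (cases "b \<in> Obj B")
      case True then show ?thesis using B.is_isoE[OF e_iso[OF True] e[OF True]] by metis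
    qed simp
  qed
  from choice[OF this] obtain i where i_all: "\<forall>b. b \<in> Obj B \<longrightarrow>
      i b \<in> homset B b (fobj F (g b)) \<and>
      i b \<cdot>\<^bsub>B\<^esub> e b = Id B (fobj F (g b)) \<and> e b \<cdot>\<^bsub>B\<^esub> i b = Id B b" ..
  then have i: "\<And>b. b \<in> Obj B \<Longrightarrow> i b \<in> homset B b (fobj F (g b))"
    and ie: "\<And>b. b \<in> Obj B \<Longrightarrow> i b \<cdot>\<^bsub>B\<^esub> e b = Id B (fobj F (g b))"
    and ei: "\<And>b. b \<in> Obj B \<Longrightarrow> e b \<cdot>\<^bsub>B\<^esub> i b = Id B b"
    by auto
  define h where "h a a' v = inv_into (homset A a a') (farr F) v" for a a' v
  have h: "h a a' v \<in> homset A a a'" "farr F (h a a' v) = v"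
    if "a \<in> Obj A" "a' \<in> Obj A" "v \<in> homset B (fobj F a) (fobj F a')" for a a' v
    using ff[OF that(1,2)] that(3) unfolding h_def bij_betw_def
    by (simp_all add: inv_into_into f_inv_into_f)
  have inj: "u = v" if "u \<in> homset A a a'" "v \<in> homset A a a'" "farr F u = farr F v" for u v a a'
    using ff[of a a'] that A.hom_obj[OF that(1)] unfolding bij_betw_def inj_on_def by blast
  define w where "w v = i (Cod B v) \<cdot>\<^bsub>B\<^esub> v \<cdot>\<^bsub>B\<^esub> e (Dom B v)" for v
  have w: "w v \<in> homset B (fobj F (g x)) (fobj F (g y))" if "v \<in> homset B x y" for v x y
    using that B.hom_obj[OF that] i e B.comp_hom homsetD[OF that] unfolding w_def by metis
  define G where "G = \<lparr>fobj = g, farr = \<lambda>v. h (g (Dom B v)) (g (Cod B v)) (w v)\<rparr>"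
  have Gh: "farr G v \<in> homset A (g x) (g y)" "farr F (farr G v) = w v"
    if "v \<in> homset B x y" for v x y
    using h[OF _ _ w[OF that]] B.hom_obj[OF that] g homsetD[OF that] unfolding G_def by auto
  have we: "e y \<cdot>\<^bsub>B\<^esub> w v = v \<cdot>\<^bsub>B\<^esub> e x" if v: "v \<in> homset B x y" for v x y
  proof -
    have o: "x \<in> Obj B" "y \<in> Obj B" using B.hom_obj[OF v] by auto
    have "v \<cdot>\<^bsub>B\<^esub> e x \<in> homset B (fobj F (g x)) y"
      using e[OF o(1)] v B.comp_hom by blast
    then have "e y \<cdot>\<^bsub>B\<^esub> w v = (e y \<cdot>\<^bsub>B\<^esub> i y) \<cdot>\<^bsub>B\<^esub> (v \<cdot>\<^bsub>B\<^esub> e x)"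
      using B.comp_assoc[OF _ i[OF o(2)] e[OF o(2)]] homsetD[OF v] unfolding w_def by metis
    also have "\<dots> = v \<cdot>\<^bsub>B\<^esub> e x"
      using ei[OF o(2)] B.id_left[OF \<open>v \<cdot>\<^bsub>B\<^esub> e x \<in> _\<close>] by simp
    finally show ?thesis .
  qed
  have e_cancel: "u = v" if "b \<in> Obj B" "u \<in> homset B x (fobj F (g b))"
    "v \<in> homset B x (fobj F (g b))" "e b \<cdot>\<^bsub>B\<^esub> u = e b \<cdot>\<^bsub>B\<^esub> v" for b u v x
  proof -
    have "u = (i b \<cdot>\<^bsub>B\<^esub> e b) \<cdot>\<^bsub>B\<^esub> u" using ie[OF that(1)] B.id_left[OF that(2)] by simp
    also have "\<dots> = (i b \<cdot>\<^bsub>B\<^esub> e b) \<cdot>\<^bsub>B\<^esub> v"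
      using that B.comp_assoc[OF _ e[OF that(1)] i[OF that(1)]] by metis
    finally show ?thesis using ie[OF that(1)] B.id_left[OF that(3)] by simp
  qed
  have G: "is_functor B A G"
    unfolding is_functor_def
  proof (intro conjI ballI allI)
    fix x y v assume "v \<in> homset B x y"
    then show "farr G v \<in> homset A (fobj G x) (fobj G y)" using Gh(1) by (simp add: G_def)
  next
    fix x assume x: "x \<in> Obj B"
    have id: "Id B x \<in> homset B x x" using B.id_hom x by blast
    have "w (Id B x) = Id B (fobj F (g x))"
    proof (rule e_cancel[OF x w[OF id]])
      show "Id B (fobj F (g x)) \<in> homset B (fobj F (g x)) (fobj F (g x))"
        using B.id_hom functorD(3)[OF F] g x by blast
      show "e x \<cdot>\<^bsub>B\<^esub> w (Id B x) = e x \<cdot>\<^bsub>B\<^esub> Id B (fobj F (g x))"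
        using we[OF id] B.id_left[OF e[OF x]] B.id_right[OF e[OF x]] by simp
    qed
    then have "farr F (farr G (Id B x)) = farr F (Id A (g x))"
      using Gh(2)[OF id] functorD(5)[OF F g[OF x]] by simp
    then show "farr G (Id B x) = Id A (fobj G x)"
      using inj[OF Gh(1)[OF id] A.id_hom[OF g[OF x]]] by (simp add: G_def)
  next
    fix x y z u v assume u: "u \<in> homset B x y" and v: "v \<in> homset B y z"
    have vu: "v \<cdot>\<^bsub>B\<^esub> u \<in> homset B x z" using B.comp_hom[OF u v] .
    have o: "x \<in> Obj B" "y \<in> Obj B" "z \<in> Obj B" using B.hom_obj[OF u] B.hom_obj[OF v] by auto
    have "w (v \<cdot>\<^bsub>B\<^esub> u) = w v \<cdot>\<^bsub>B\<^esub> w u"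
    proof (rule e_cancel[OF o(3) w[OF vu]])
      show "w v \<cdot>\<^bsub>B\<^esub> w u \<in> homset B (fobj F (g x)) (fobj F (g z))"
        using B.comp_hom[OF w[OF u] w[OF v]] .
      have "e z \<cdot>\<^bsub>B\<^esub> (w v \<cdot>\<^bsub>B\<^esub> w u) = (v \<cdot>\<^bsub>B\<^esub> e y) \<cdot>\<^bsub>B\<^esub> w u"
        using we[OF v] B.comp_assoc[OF w[OF u] w[OF v] e[OF o(3)]] by simp
      also have "\<dots> = v \<cdot>\<^bsub>B\<^esub> (u \<cdot>\<^bsub>B\<^esub> e x)"
        using we[OF u] B.comp_assoc[OF w[OF u] e[OF o(2)] v] by simp
      also have "\<dots> = e z \<cdot>\<^bsub>B\<^esub> w (v \<cdot>\<^bsub>B\<^esub> u)"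
        using we[OF vu] B.comp_assoc[OF e[OF o(1)] u v] by simp
      finally show "e z \<cdot>\<^bsub>B\<^esub> w (v \<cdot>\<^bsub>B\<^esub> u) = e z \<cdot>\<^bsub>B\<^esub> (w v \<cdot>\<^bsub>B\<^esub> w u)" by simp
    qed
    moreover have "farr F (farr G v \<cdot>\<^bsub>A\<^esub> farr G u) = w v \<cdot>\<^bsub>B\<^esub> w u"
      using functorD(6)[OF F Gh(1)[OF u] Gh(1)[OF v]] Gh(2)[OF u] Gh(2)[OF v] by simp
    ultimately show "farr G (v \<cdot>\<^bsub>B\<^esub> u) = farr G v \<cdot>\<^bsub>A\<^esub> farr G u"
      using inj[OF Gh(1)[OF vu] A.comp_hom[OF Gh(1)[OF u] Gh(1)[OF v]]] Gh(2)[OF vu] by simp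
  qed (use A.category_axioms B.category_axioms g in \<open>auto simp: G_def\<close>)
  have FG: "naturally_isomorphic B B (comp_ftr F G) id_ftr"
    unfolding naturally_isomorphic_def is_nat_trans_def
    using comp_ftr_functor[OF G F] we Gh(2) e e_iso B.category_axioms
    by (intro exI[of _ e])
      (auto simp: comp_ftr_def id_ftr_def G_def is_functor_def)
  define n where "n a = h a (g (fobj F a)) (i (fobj F a))" for a
  define n' where "n' a = h (g (fobj F a)) a (e (fobj F a))" for a
  have n: "n a \<in> homset A a (g (fobj F a))" "farr F (n a) = i (fobj F a)" if "a \<in> Obj A" for a
    using h[OF that g i] functorD(3)[OF F that] unfolding n_def by auto
  have n': "n' a \<in> homset A (g (fobj F a)) a" "farr F (n' a) = e (fobj F a)" if "a \<in> Obj A" for a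
    using h[OF g that e] functorD(3)[OF F that] unfolding n'_def by auto
  have n_iso: "is_iso A (n a)" if a: "a \<in> Obj A" for a
  proof (rule A.is_isoI[OF n(1)[OF a] n'(1)[OF a]])
    have Fa: "fobj F a \<in> Obj B" using functorD(3)[OF F a] .
    have "farr F (n' a \<cdot>\<^bsub>A\<^esub> n a) = farr F (Id A a)"
      using functorD(6)[OF F n(1)[OF a] n'(1)[OF a]] n(2)[OF a] n'(2)[OF a] ei[OF Fa]
        functorD(5)[OF F a] by simp
    then show "n' a \<cdot>\<^bsub>A\<^esub> n a = Id A a"
      using inj[OF A.comp_hom[OF n(1)[OF a] n'(1)[OF a]] A.id_hom[OF a]] by blast
    have "farr F (n a \<cdot>\<^bsub>A\<^esub> n' a) = farr F (Id A (g (fobj F a)))"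
      using functorD(6)[OF F n'(1)[OF a] n(1)[OF a]] n(2)[OF a] n'(2)[OF a] ie[OF Fa]
        functorD(5)[OF F g[OF Fa]] by simp
    then show "n a \<cdot>\<^bsub>A\<^esub> n' a = Id A (g (fobj F a))"
      using inj[OF A.comp_hom[OF n'(1)[OF a] n(1)[OF a]] A.id_hom[OF g[OF Fa]]] by blast
  qed
  have n_nat: "n y \<cdot>\<^bsub>A\<^esub> f = farr G (farr F f) \<cdot>\<^bsub>A\<^esub> n x" if f: "f \<in> homset A x y" for f x y
  proof -
    have o: "x \<in> Obj A" "y \<in> Obj A" using A.hom_obj[OF f] by auto
    have Ff: "farr F f \<in> homset B (fobj F x) (fobj F y)" using functorD(4)[OF F f] .
    have Fo: "fobj F x \<in> Obj B" "fobj F y \<in> Obj B" using B.hom_obj[OF Ff] by auto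
    have wF: "w (farr F f) \<in> homset B (fobj F (g (fobj F x))) (fobj F (g (fobj F y)))"
      using w[OF Ff] .
    have "i (fobj F y) \<cdot>\<^bsub>B\<^esub> farr F f = w (farr F f) \<cdot>\<^bsub>B\<^esub> i (fobj F x)"
    proof (rule e_cancel[OF Fo(2) B.comp_hom[OF Ff i[OF Fo(2)]] B.comp_hom[OF i[OF Fo(1)] wF]])
      have "e (fobj F y) \<cdot>\<^bsub>B\<^esub> (i (fobj F y) \<cdot>\<^bsub>B\<^esub> farr F f) = farr F f"
        using B.comp_assoc[OF Ff i[OF Fo(2)] e[OF Fo(2)]] ei[OF Fo(2)] B.id_left[OF Ff] by simp
      moreover have "e (fobj F y) \<cdot>\<^bsub>B\<^esub> (w (farr F f) \<cdot>\<^bsub>B\<^esub> i (fobj F x)) = farr F f"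
        using B.comp_assoc[OF i[OF Fo(1)] wF e[OF Fo(2)]] we[OF Ff]
          B.comp_assoc[OF i[OF Fo(1)] e[OF Fo(1)] Ff] ei[OF Fo(1)] B.id_right[OF Ff] by simp
      ultimately show "e (fobj F y) \<cdot>\<^bsub>B\<^esub> (i (fobj F y) \<cdot>\<^bsub>B\<^esub> farr F f)
          = e (fobj F y) \<cdot>\<^bsub>B\<^esub> (w (farr F f) \<cdot>\<^bsub>B\<^esub> i (fobj F x))" by simp
    qed
    then have "farr F (n y \<cdot>\<^bsub>A\<^esub> f) = farr F (farr G (farr F f) \<cdot>\<^bsub>A\<^esub> n x)"
      using functorD(6)[OF F f n(1)[OF o(2)]] functorD(6)[OF F n(1)[OF o(1)] Gh(1)[OF Ff]]
        n(2)[OF o(1)] n(2)[OF o(2)] Gh(2)[OF Ff] by simp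
    then show ?thesis
      using inj[OF A.comp_hom[OF f n(1)[OF o(2)]] A.comp_hom[OF n(1)[OF o(1)] Gh(1)[OF Ff]]] by blast
  qed
  have GF: "naturally_isomorphic A A id_ftr (comp_ftr G F)"
    unfolding naturally_isomorphic_def is_nat_trans_def
    using comp_ftr_functor[OF F G] n_nat n(1) n_iso A.category_axioms
    by (intro exI[of _ n])
      (auto simp: comp_ftr_def id_ftr_def G_def is_functor_def)
  show ?thesis unfolding is_equivalence_def using F G GF FG by blast
qed

section \<open>Directed sets\<close>

lemma small_directedD:
  "small_directed (P :: 'u rel) \<Longrightarrow> small TYPE('u) (Field P)"
  "small_directed P \<Longrightarrow> directed P"
  by (auto simp: small_directed_def)

lemma directed_refl: "directed P \<Longrightarrow> p \<in> Field P \<Longrightarrow> (p, p) \<in> P"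
  unfolding directed_def preorder_on_def refl_on_def by blast

lemma directed_trans: "directed P \<Longrightarrow> (p, q) \<in> P \<Longrightarrow> (q, r) \<in> P \<Longrightarrow> (p, r) \<in> P"
  unfolding directed_def preorder_on_def trans_def by blast

lemma directed_ub: "directed P \<Longrightarrow> p \<in> Field P \<Longrightarrow> q \<in> Field P \<Longrightarrow> \<exists>r. (p, r) \<in> P \<and> (q, r) \<in> P"
  unfolding directed_def by blast

lemma directed_nonempty: "directed P \<Longrightarrow> \<exists>p. p \<in> Field P"
  unfolding directed_def by blast

lemma directedI:
  assumes "\<And>p. p \<in> Field P \<Longrightarrow> (p, p) \<in> P"
    and "\<And>p q r. (p, q) \<in> P \<Longrightarrow> (q, r) \<in> P \<Longrightarrow> (p, r) \<in> P"
    and "\<And>p q. p \<in> Field P \<Longrightarrow> q \<in> Field P \<Longrightarrow> \<exists>r. (p, r) \<in> P \<and> (q, r) \<in> P"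
    and "x \<in> Field P"
  shows "directed P"
  using assms unfolding directed_def preorder_on_def refl_on_def
  by (auto intro: FieldI1 FieldI2 transI)

text \<open>
  A net that is not eventually in a set stays outside it along a cofinal set of indices
  (\<open>not_tail_in_cofinal\<close>); restriction to these indices gives a subnet.
\<close>

lemma directed_Restr:
  assumes P: "directed P" and Q: "Q \<in> cofinal_subsets P"
  shows "directed (Restr P Q)" "Field (Restr P Q) = Q" "cofinal_map (Restr P Q) P (\<lambda>q. q)"
proof -
  have Q': "Q \<subseteq> Field P" "\<And>p. p \<in> Field P \<Longrightarrow> \<exists>q\<in>Q. (p, q) \<in> P"
    using Q by (auto simp: cofinal_subsets_def)
  show F: "Field (Restr P Q) = Q"
    using Q'(1) directed_refl[OF P] unfolding Field_def by blast
  obtain p where "p \<in> Field P" using directed_nonempty[OF P] ..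
  then obtain q0 where q0: "q0 \<in> Q" using Q'(2) by blast
  show "directed (Restr P Q)"
  proof (rule directedI[of _ q0])
    fix p q assume pq: "p \<in> Field (Restr P Q)" "q \<in> Field (Restr P Q)"
    then obtain r where r: "(p, r) \<in> P" "(q, r) \<in> P"
      using directed_ub[OF P, of p q] Q'(1) unfolding F by blast
    then obtain s where "s \<in> Q" "(r, s) \<in> P" using Q'(2)[of r] by (auto simp: Field_def)
    then show "\<exists>r. (p, r) \<in> Restr P Q \<and> (q, r) \<in> Restr P Q"
      using pq r directed_trans[OF P] unfolding F by blast
  qed (use F q0 Q'(1) directed_refl[OF P] directed_trans[OF P] in auto)
  show "cofinal_map (Restr P Q) P (\<lambda>q. q)"
    unfolding cofinal_map_def F
  proof (intro conjI ballI)
    show "(\<lambda>q. q) ` Q \<subseteq> Field P" using Q'(1) by simp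
    fix p assume "p \<in> Field P"
    then obtain q where "q \<in> Q" "(p, q) \<in> P" using Q'(2) by blast
    then show "\<exists>q\<in>Q. \<forall>q'. (q, q') \<in> Restr P Q \<longrightarrow> (p, q') \<in> P"
      using directed_trans[OF P] by blast
  qed
qed

lemma small_directed_Restr:
  fixes P :: "'u rel"
  assumes P: "small_directed P" and Q: "Q \<in> cofinal_subsets P"
  shows "small_directed (Restr P Q)"
proof -
  have "Q \<subseteq> Field P" using Q by (simp add: cofinal_subsets_def)
  then have "small TYPE('u) Q" using small_subset[OF small_directedD(1)[OF P]] by blast
  then show ?thesis
    using directed_Restr[OF small_directedD(2)[OF P] Q] by (simp add: small_directed_def)
qed

lemma Field_iter_index:
  assumes P: "directed P" and Q: "\<And>p. p \<in> Field P \<Longrightarrow> directed (Q p)"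
  shows "Field (iter_index P Q) = Field P \<times> (\<Pi>\<^sub>E i \<in> Field P. Field (Q i))"
proof -
  have 1: "((p, f), (p, f)) \<in> iter_index P Q" if "p \<in> Field P" "f \<in> (\<Pi>\<^sub>E i \<in> Field P. Field (Q i))" for p f
    using that directed_refl[OF P that(1)] directed_refl[OF Q] unfolding iter_index_def by blast
  have 2: "x \<in> Field P \<times> (\<Pi>\<^sub>E i \<in> Field P. Field (Q i))"
      "y \<in> Field P \<times> (\<Pi>\<^sub>E i \<in> Field P. Field (Q i))"
    if "(x, y) \<in> iter_index P Q" for x y
    using that unfolding iter_index_def by (auto intro: FieldI1 FieldI2)
  show ?thesis
  proof (intro equalityI subsetI)
    fix x assume "x \<in> Field (iter_index P Q)"
    then obtain y where "(x, y) \<in> iter_index P Q \<or> (y, x) \<in> iter_index P Q"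
      unfolding Field_iff[of x "iter_index P Q"] by blast
    then show "x \<in> Field P \<times> (\<Pi>\<^sub>E i \<in> Field P. Field (Q i))" using 2 by blast
  next
    fix x assume "x \<in> Field P \<times> (\<Pi>\<^sub>E i \<in> Field P. Field (Q i))"
    then show "x \<in> Field (iter_index P Q)" using 1 by (cases x) (blast intro: FieldI1)
  qed
qed

text \<open>
  Upper bounds in the index set of an iterated limit are found componentwise, which needs the axiom
  of choice for the family of directed sets.
\<close>

lemma directed_iter_index:
  assumes P: "directed P" and Q: "\<And>p. p \<in> Field P \<Longrightarrow> directed (Q p)"
  shows "directed (iter_index P Q)"
proof -
  have F: "Field (iter_index P Q) = Field P \<times> (\<Pi>\<^sub>E i \<in> Field P. Field (Q i))"
    by (rule Field_iter_index[OF P Q])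
  obtain p where p: "p \<in> Field P" using directed_nonempty[OF P] ..
  have "\<forall>i \<in> Field P. \<exists>q. q \<in> Field (Q i)" using directed_nonempty[OF Q] by blast
  then obtain f where f: "\<forall>i \<in> Field P. f i \<in> Field (Q i)" by metis
  show ?thesis
  proof (rule directedI[of _ "(p, restrict f (Field P))"])
    show "(p, restrict f (Field P)) \<in> Field (iter_index P Q)" using p f by (auto simp: F)
  next
    fix x assume "x \<in> Field (iter_index P Q)"
    then have "x \<in> Field P \<times> (\<Pi>\<^sub>E i \<in> Field P. Field (Q i))" unfolding F .
    then show "(x, x) \<in> iter_index P Q"
      using directed_refl[OF P] directed_refl[OF Q] unfolding iter_index_def by blast
  next
    fix x y z assume xy: "(x, y) \<in> iter_index P Q" and yz: "(y, z) \<in> iter_index P Q"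
    obtain p f p' f' p'' f'' where [simp]: "x = (p, f)" "y = (p', f')" "z = (p'', f'')"
      by (metis prod.collapse)
    have "(p, p'') \<in> P" "\<forall>i \<in> Field P. (f i, f'' i) \<in> Q i"
      using xy yz directed_trans[OF P] directed_trans[OF Q] unfolding iter_index_def by auto
    then show "(x, z) \<in> iter_index P Q" using xy yz unfolding iter_index_def by auto
  next
    fix x y assume "x \<in> Field (iter_index P Q)" "y \<in> Field (iter_index P Q)"
    then obtain p f q g where x: "x = (p, f)" "p \<in> Field P" "f \<in> (\<Pi>\<^sub>E i \<in> Field P. Field (Q i))"
      and y: "y = (q, g)" "q \<in> Field P" "g \<in> (\<Pi>\<^sub>E i \<in> Field P. Field (Q i))"
      unfolding F by blast
    obtain r where r: "(p, r) \<in> P" "(q, r) \<in> P" using directed_ub[OF P x(2) y(2)] by blast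
    have "\<forall>i \<in> Field P. \<exists>s. (f i, s) \<in> Q i \<and> (g i, s) \<in> Q i"
      using directed_ub[OF Q] x(3) y(3) by blast
    then obtain s where s: "\<forall>i \<in> Field P. (f i, s i) \<in> Q i \<and> (g i, s i) \<in> Q i" by metis
    then have "restrict s (Field P) \<in> (\<Pi>\<^sub>E i \<in> Field P. Field (Q i))" by (auto intro: FieldI2)
    then have "(x, (r, restrict s (Field P))) \<in> iter_index P Q"
      "(y, (r, restrict s (Field P))) \<in> iter_index P Q"
      using r s x y unfolding iter_index_def by auto
    then show "\<exists>r. (x, r) \<in> iter_index P Q \<and> (y, r) \<in> iter_index P Q" by blast
  qed
qed

text \<open>
  The axioms quantify over directed sets with carrier inside \<open>'u\<close>, while the directed sets that occur
  in proofs (products, neighbourhood filters) live on other types. They are moved along an injection.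
\<close>

lemma directed_transfer:
  assumes I: "directed I" and e: "inj_on e (Field I)"
  defines "S \<equiv> (\<lambda>(x, y). (e x, e y)) ` I"
  shows "directed S" "Field S = e ` Field I" "order_iso S I (inv_into (Field I) e)"
proof -
  show F: "Field S = e ` Field I"
    unfolding S_def Field_def by force
  have iff: "(e x, e y) \<in> S \<longleftrightarrow> (x, y) \<in> I" if "x \<in> Field I" "y \<in> Field I" for x y
  proof
    assume "(e x, e y) \<in> S"
    then obtain x' y' where "(x', y') \<in> I" "e x' = e x" "e y' = e y" unfolding S_def by force
    then show "(x, y) \<in> I" using e that FieldI1[of x' y' I] FieldI2[of x' y' I]
      by (auto simp: inj_on_def)
  qed (auto simp: S_def)
  show "order_iso S I (inv_into (Field I) e)"
    unfolding order_iso_def F using iff e by (auto simp: bij_betw_inv_into inj_on_imp_bij_betw)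
  obtain x where x: "x \<in> Field I" using directed_nonempty[OF I] ..
  have el: "\<exists>u v. (u, v) \<in> I \<and> a = e u \<and> b = e v \<and> u \<in> Field I \<and> v \<in> Field I" if "(a, b) \<in> S" for a b
    using that unfolding S_def by (auto intro: FieldI1 FieldI2)
  show "directed S"
  proof (rule directedI[of _ "e x"])
    show "e x \<in> Field S" using x F by blast
  next
    fix p assume "p \<in> Field S"
    then obtain u where u: "u \<in> Field I" "p = e u" using F by auto
    show "(p, p) \<in> S" using directed_refl[OF I u(1)] u(2) unfolding S_def by force
  next
    fix p q r assume "(p, q) \<in> S" "(q, r) \<in> S"
    then obtain u v v' w where *: "(u, v) \<in> I" "(v', w) \<in> I" "p = e u" "q = e v" "q = e v'" "r = e w"
      "v \<in> Field I" "v' \<in> Field I" "u \<in> Field I" "w \<in> Field I" using el by metis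
    then have "v = v'" using e by (auto simp: inj_on_def)
    then have "(u, w) \<in> I" using *(1,2) directed_trans[OF I] by blast
    then show "(p, r) \<in> S" using *(3,6) unfolding S_def by force
  next
    fix p q assume "p \<in> Field S" "q \<in> Field S"
    then obtain u v where uv: "u \<in> Field I" "v \<in> Field I" "p = e u" "q = e v" using F by auto
    obtain r where r: "(u, r) \<in> I" "(v, r) \<in> I" using directed_ub[OF I uv(1,2)] by blast
    then show "\<exists>r. (p, r) \<in> S \<and> (q, r) \<in> S"
      using uv unfolding S_def by (intro exI[of _ "e r"]) force
  qed
qed

context universe begin

lemma small_directed_code:
  assumes "directed I" "small TYPE('u) (Field I)"
  shows "\<exists>(S :: 'u rel) \<phi>. small_directed S \<and> order_iso S I \<phi>"
proof -
  obtain e :: "_ \<Rightarrow> 'u" where e: "inj_on e (Field I)" using small_ex_inj[OF assms(2)] .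
  show ?thesis
    using directed_transfer[OF assms(1) e] small_image[OF assms(2)]
    unfolding small_directed_def by metis
qed

lemma iter_index_code:
  fixes P :: "'u rel" and Q :: "'u \<Rightarrow> 'u rel"
  assumes P: "small_directed P" and Q: "\<forall>p \<in> Field P. small_directed (Q p)"
  shows "\<exists>(S :: 'u rel) \<phi>. small_directed S \<and> order_iso S (iter_index P Q) \<phi>"
proof (rule small_directed_code)
  have d: "directed P" "\<And>p. p \<in> Field P \<Longrightarrow> directed (Q p)"
    using P Q by (auto simp: small_directed_def)
  show "directed (iter_index P Q)" using directed_iter_index[of P Q] d by blast
  have "small TYPE('u) (\<Pi>\<^sub>E i \<in> Field P. Field (Q i))"
    using small_PiE[OF small_directedD(1)[OF P], of "\<lambda>i. Field (Q i)"] small_directedD(1) Q by blast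
  then show "small TYPE('u) (Field (iter_index P Q))"
    using Field_iter_index[of P Q] d small_Times[OF small_directedD(1)[OF P]] by metis
qed

lemma small_directed_singleton: "small_directed {(x :: 'u, x)}"
  unfolding small_directed_def
  by (auto intro!: directedI[of _ x] small_finite simp: Field_def)

end

section \<open>Topologies as net convergence relations\<close>

definition tail_in :: "'i rel \<Rightarrow> ('i \<Rightarrow> 'h) \<Rightarrow> 'h set \<Rightarrow> bool" where
  "tail_in P f U \<longleftrightarrow> (\<exists>p \<in> Field P. \<forall>q. (p, q) \<in> P \<longrightarrow> f q \<in> U)"

definition net_limit :: "'h topology \<Rightarrow> 'i rel \<Rightarrow> ('i \<Rightarrow> 'h) \<Rightarrow> 'h \<Rightarrow> bool" where
  "net_limit T P f l \<longleftrightarrow> f ` Field P \<subseteq> topspace T \<and> l \<in> topspace T \<and>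
     (\<forall>U. openin T U \<longrightarrow> l \<in> U \<longrightarrow> tail_in P f U)"

lemma tail_in_mono: "tail_in P f U \<Longrightarrow> U \<subseteq> V \<Longrightarrow> tail_in P f V"
  unfolding tail_in_def by blast

lemma tail_in_Int:
  assumes P: "directed P" and "tail_in P f U" "tail_in P f V"
  shows "tail_in P f (U \<inter> V)"
proof -
  obtain p q where p: "p \<in> Field P" "\<forall>r. (p, r) \<in> P \<longrightarrow> f r \<in> U"
    and q: "q \<in> Field P" "\<forall>r. (q, r) \<in> P \<longrightarrow> f r \<in> V" using assms(2,3) unfolding tail_in_def by blast
  obtain r where "(p, r) \<in> P" "(q, r) \<in> P" using directed_ub[OF P p(1) q(1)] by blast
  then show ?thesis
    using p q directed_trans[OF P] unfolding tail_in_def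
    by (intro bexI[of _ r]) (auto intro: FieldI2)
qed

lemma tail_in_all: "directed P \<Longrightarrow> f ` Field P \<subseteq> U \<Longrightarrow> tail_in P f U"
  using directed_nonempty[of P] unfolding tail_in_def by (auto dest: FieldI2)

lemma tail_in_nonempty:
  assumes "directed P" "tail_in P f U"
  shows "\<exists>p \<in> Field P. f p \<in> U"
  using assms directed_refl unfolding tail_in_def by metis

lemma not_tail_in_cofinal:
  assumes "\<not> tail_in P f U"
  shows "{p \<in> Field P. f p \<notin> U} \<in> cofinal_subsets P"
  using assms unfolding tail_in_def cofinal_subsets_def by (auto dest: FieldI2)

lemma tail_in_cofinal_map:
  assumes P: "directed P" and h: "cofinal_map Q P h" and t: "tail_in P f U"
  shows "tail_in Q (\<lambda>q. f (h q)) U"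
proof -
  obtain p where p: "p \<in> Field P" "\<forall>r. (p, r) \<in> P \<longrightarrow> f r \<in> U" using t unfolding tail_in_def by blast
  then obtain q where "q \<in> Field Q" "\<forall>q'. (q, q') \<in> Q \<longrightarrow> (p, h q') \<in> P"
    using h unfolding cofinal_map_def by blast
  then show ?thesis using p(2) unfolding tail_in_def by blast
qed

text \<open>
  The heart of the theorem on iterated limits. From an index \<open>p0\<close> on, every inner net is eventually
  in \<open>U\<close>; let \<open>f0 p\<close> be an index from which this holds for the inner net at \<open>p\<close>. Then the diagonal
  net is in \<open>U\<close> from the index \<open>(p0, f0)\<close> on.
\<close>

lemma tail_in_iteration:
  assumes P: "directed P" and Q: "\<And>p. p \<in> Field P \<Longrightarrow> directed (Q p)"
    and S: "order_iso S (iter_index P Q) \<phi>"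
    and t: "tail_in P (\<lambda>p. p) {p \<in> Field P. tail_in (Q p) (g p) U}"
  shows "tail_in S (\<lambda>s. case \<phi> s of (p, f) \<Rightarrow> g p (f p)) U"
proof -
  have F: "Field (iter_index P Q) = Field P \<times> (\<Pi>\<^sub>E i \<in> Field P. Field (Q i))"
    by (rule Field_iter_index[OF P Q])
  obtain p0 where p0: "p0 \<in> Field P" "\<And>p. (p0, p) \<in> P \<Longrightarrow> tail_in (Q p) (g p) U"
    using t unfolding tail_in_def[of P] by blast
  have "\<forall>p \<in> Field P. \<exists>q \<in> Field (Q p). (p0, p) \<in> P \<longrightarrow> (\<forall>r. (q, r) \<in> Q p \<longrightarrow> g p r \<in> U)"
    using p0(2) directed_nonempty[OF Q] unfolding tail_in_def by metis
  then obtain f0 where f0: "\<forall>p \<in> Field P. f0 p \<in> Field (Q p) \<and>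
      ((p0, p) \<in> P \<longrightarrow> (\<forall>r. (f0 p, r) \<in> Q p \<longrightarrow> g p r \<in> U))" by metis
  let ?x = "(p0, restrict f0 (Field P))"
  have x: "?x \<in> Field (iter_index P Q)" using p0(1) f0 by (auto simp: F)
  have bij: "bij_betw \<phi> (Field S) (Field (iter_index P Q))" using S unfolding order_iso_def by blast
  then obtain s where s: "s \<in> Field S" "\<phi> s = ?x" using x unfolding bij_betw_def by (metis imageE)
  have "(case \<phi> s' of (p, f) \<Rightarrow> g p (f p)) \<in> U" if s': "(s, s') \<in> S" for s'
  proof -
    obtain p f where pf: "\<phi> s' = (p, f)" by force
    have "s' \<in> Field S" using s' by (rule FieldI2)
    then have "(\<phi> s, \<phi> s') \<in> iter_index P Q" using S s(1) s' unfolding order_iso_def by blast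
    then have pp: "(p0, p) \<in> P" "\<forall>i \<in> Field P. (restrict f0 (Field P) i, f i) \<in> Q i"
      unfolding s(2) pf iter_index_def by auto
    then have "p \<in> Field P" by (auto intro: FieldI2)
    then show ?thesis using pp f0 by (simp add: pf)
  qed
  then show ?thesis using s(1) unfolding tail_in_def by blast
qed

text \<open>
  The four axioms of an internal topology read in the category of sets, for nets with values in \<open>H\<close>.
  Nets are total functions of which only the values on the carrier of the directed set matter, whence
  the second clause. This is the form that the axioms take on generalized elements.
\<close>

definition net_convergence :: "'h set \<Rightarrow> ('u rel \<Rightarrow> ('u \<Rightarrow> 'h) \<Rightarrow> 'h \<Rightarrow> bool) \<Rightarrow> bool" where
  "net_convergence H conv \<longleftrightarrow>
     (\<forall>P f l. small_directed P \<longrightarrow> conv P f l \<longrightarrow> f ` Field P \<subseteq> H \<and> l \<in> H) \<and>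
     (\<forall>P f g l. small_directed P \<longrightarrow> conv P f l \<longrightarrow> (\<forall>p \<in> Field P. f p = g p) \<longrightarrow> conv P g l) \<and>
     (\<forall>P l. small_directed P \<longrightarrow> l \<in> H \<longrightarrow> conv P (\<lambda>_. l) l) \<and>
     (\<forall>P Q h f l. small_directed P \<longrightarrow> small_directed Q \<longrightarrow> cofinal_map Q P h \<longrightarrow> conv P f l \<longrightarrow>
        conv Q (\<lambda>q. f (h q)) l) \<and>
     (\<forall>P R h f l. small_directed P \<longrightarrow> f ` Field P \<subseteq> H \<longrightarrow> l \<in> H \<longrightarrow>
        (\<forall>Q \<in> cofinal_subsets P. small_directed (R Q) \<and> cofinal_map (R Q) (Restr P Q) (h Q) \<and>
           conv (R Q) (\<lambda>r. f (h Q r)) l) \<longrightarrow> conv P f l) \<and>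
     (\<forall>P Q S \<phi> g l m. small_directed P \<longrightarrow> (\<forall>p \<in> Field P. small_directed (Q p)) \<longrightarrow>
        small_directed S \<longrightarrow> order_iso S (iter_index P Q) \<phi> \<longrightarrow>
        (\<forall>p \<in> Field P. conv (Q p) (g p) (l p)) \<longrightarrow> conv P l m \<longrightarrow>
        conv S (\<lambda>s. case \<phi> s of (p, f) \<Rightarrow> g p (f p)) m)"

text \<open>
  The easy half of the correspondence between topologies and convergence. For locality, a net that
  does not converge to \<open>l\<close> stays outside some neighbourhood of \<open>l\<close> along a cofinal subset of
  indices, and no net factoring through that subset can converge to \<open>l\<close>.
\<close>

theorem net_limit_net_convergence:
  "net_convergence (topspace T) (net_limit T :: 'u rel \<Rightarrow> ('u \<Rightarrow> 'h) \<Rightarrow> 'h \<Rightarrow> bool)"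
  unfolding net_convergence_def
proof (intro conjI allI impI)
  fix P :: "'u rel" and f g l assume "net_limit T P f l" "\<forall>p\<in>Field P. f p = g p"
  then show "net_limit T P g l"
    unfolding net_limit_def tail_in_def by (auto simp: image_subset_iff dest: FieldI2)
      (metis FieldI2)
next
  fix P :: "'u rel" and l assume "small_directed P" "l \<in> topspace T"
  then show "net_limit T P (\<lambda>_. l) l"
    unfolding net_limit_def by (auto intro: tail_in_all small_directedD(2))
next
  fix P Q :: "'u rel" and h f l
  assume P: "small_directed P" and h: "cofinal_map Q P h" and f: "net_limit T P f l"
  show "net_limit T Q (\<lambda>q. f (h q)) l"
    unfolding net_limit_def
  proof (intro conjI allI impI)
    show "(\<lambda>q. f (h q)) ` Field Q \<subseteq> topspace T"
      using f h unfolding net_limit_def cofinal_map_def by blast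
    show "l \<in> topspace T" using f by (simp add: net_limit_def)
    fix U assume "openin T U" "l \<in> U"
    then have "tail_in P f U" using f by (simp add: net_limit_def)
    then show "tail_in Q (\<lambda>q. f (h q)) U" by (rule tail_in_cofinal_map[OF small_directedD(2)[OF P] h])
  qed
next
  fix P and R :: "'u set \<Rightarrow> 'u rel" and h f l
  assume P: "small_directed P" and f: "f ` Field P \<subseteq> topspace T" and l: "l \<in> topspace T"
    and R: "\<forall>Q\<in>cofinal_subsets P. small_directed (R Q) \<and> cofinal_map (R Q) (Restr P Q) (h Q) \<and>
       net_limit T (R Q) (\<lambda>r. f (h Q r)) l"
  show "net_limit T P f l"
    unfolding net_limit_def
  proof (intro conjI allI impI f l)
    fix U assume U: "openin T U" "l \<in> U"
    show "tail_in P f U"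
    proof (rule ccontr)
      assume "\<not> tail_in P f U"
      from not_tail_in_cofinal[OF this]
      have Q: "{p \<in> Field P. f p \<notin> U} \<in> cofinal_subsets P" (is "?Q \<in> _") .
      note R = R[rule_format, OF Q]
      have "tail_in (R ?Q) (\<lambda>r. f (h ?Q r)) U" using R U unfolding net_limit_def by blast
      then obtain r where r: "r \<in> Field (R ?Q)" "f (h ?Q r) \<in> U"
        using tail_in_nonempty[OF small_directedD(2)] R by blast
      have "h ?Q r \<in> Field (Restr P ?Q)" using R r(1) unfolding cofinal_map_def by blast
      then show False using r(2) directed_Restr(2)[OF small_directedD(2)[OF P] Q] by blast
    qed
  qed
next
  fix P S :: "'u rel" and Q :: "'u \<Rightarrow> 'u rel" and \<phi> g l m
  assume P: "small_directed P" and Q: "\<forall>p\<in>Field P. small_directed (Q p)"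
    and S: "order_iso S (iter_index P Q) \<phi>" and g: "\<forall>p\<in>Field P. net_limit T (Q p) (g p) (l p)"
    and l: "net_limit T P l m"
  have d: "directed P" "\<And>p. p \<in> Field P \<Longrightarrow> directed (Q p)"
    using P Q by (auto simp: small_directed_def)
  show "net_limit T S (\<lambda>s. case \<phi> s of (p, f) \<Rightarrow> g p (f p)) m"
    unfolding net_limit_def
  proof (intro conjI allI impI)
    show "(\<lambda>s. case \<phi> s of (p, f) \<Rightarrow> g p (f p)) ` Field S \<subseteq> topspace T"
    proof (rule image_subsetI)
      fix s assume s: "s \<in> Field S"
      obtain p f where pf: "\<phi> s = (p, f)" by force
      have "(p, f) \<in> Field (iter_index P Q)"
        using S s pf unfolding order_iso_def bij_betw_def by force
      then have "p \<in> Field P" "f p \<in> Field (Q p)" using Field_iter_index[of P Q] d by auto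
      then show "(case \<phi> s of (p, f) \<Rightarrow> g p (f p)) \<in> topspace T"
        using g unfolding net_limit_def by (auto simp: pf)
    qed
    show "m \<in> topspace T" using l by (simp add: net_limit_def)
    fix U assume U: "openin T U" "m \<in> U"
    have "tail_in P l U" using l U by (simp add: net_limit_def)
    moreover have "tail_in (Q p) (g p) U" if "p \<in> Field P" "l p \<in> U" for p
      using g that U(1) by (auto simp: net_limit_def)
    ultimately have "tail_in P (\<lambda>p. p) {p \<in> Field P. tail_in (Q p) (g p) U}"
      unfolding tail_in_def[of P] by (auto dest: FieldI2)
    then show "tail_in S (\<lambda>s. case \<phi> s of (p, f) \<Rightarrow> g p (f p)) U"
      by (intro tail_in_iteration[OF d(1) _ S] d(2))
  qed
qed (auto simp: net_limit_def)

context universe begin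

text \<open>
  Kelley's theorem: every net convergence relation is the convergence of a topology.
  A set is declared open if every net converging to one of its points is eventually in it. With
  \<open>cl A\<close> the set of limits of nets in \<open>A\<close>, the iteration axiom says that \<open>cl\<close> is
  idempotent, so that \<open>cl A\<close> is closed and hence is the topological closure of \<open>A\<close>.

  If a net \<open>f\<close> converges to \<open>l\<close> topologically, but not in the given relation, then by locality
  there is a cofinal set \<open>Q\<close> of indices such that no subnet of \<open>f\<close> factoring through \<open>Q\<close> is
  related to \<open>l\<close>. But \<open>l\<close> is in the closure of each tail of \<open>f\<close> along \<open>Q\<close>, so each tail contains a
  net related to \<open>l\<close>; the iteration axiom, applied to these nets and the constant net \<open>l\<close>, yields a
  subnet of the forbidden kind.
\<close>

theorem net_convergence_topology:
  fixes conv :: "'u rel \<Rightarrow> ('u \<Rightarrow> 'h) \<Rightarrow> 'h \<Rightarrow> bool"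
  assumes "net_convergence H conv"
  obtains T where "topspace T = H" "\<And>P f l. small_directed P \<Longrightarrow> conv P f l \<longleftrightarrow> net_limit T P f l"
proof -
  note ax = assms[unfolded net_convergence_def]
  note ax1 = ax[THEN conjunct1] and ax2 = ax[THEN conjunct2, THEN conjunct1]
    and ax3 = ax[THEN conjunct2, THEN conjunct2, THEN conjunct1]
    and ax4 = ax[THEN conjunct2, THEN conjunct2, THEN conjunct2, THEN conjunct1]
    and ax5 = ax[THEN conjunct2, THEN conjunct2, THEN conjunct2, THEN conjunct2, THEN conjunct1]
    and ax6 = ax[THEN conjunct2, THEN conjunct2, THEN conjunct2, THEN conjunct2, THEN conjunct2]
  have in_H: "f ` Field P \<subseteq> H" "l \<in> H" if "small_directed P" "conv P f l" for P f l
    using ax1 that by blast+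
  have cong: "conv P g l" if "small_directed P" "conv P f l" "\<And>p. p \<in> Field P \<Longrightarrow> f p = g p" for P f g l
    using ax2 that by blast
  have const: "conv P (\<lambda>_. l) l" if "small_directed P" "l \<in> H" for P l
    using ax3 that by blast
  have sub: "conv Q (\<lambda>q. f (h q)) l"
    if "small_directed P" "small_directed Q" "cofinal_map Q P h" "conv P f l" for P Q h f l
    using ax4 that by blast
  have loc: "conv P f l"
    if "small_directed P" "f ` Field P \<subseteq> H" "l \<in> H"
      "\<forall>Q \<in> cofinal_subsets P. small_directed (R Q) \<and> cofinal_map (R Q) (Restr P Q) (h Q) \<and>
           conv (R Q) (\<lambda>r. f (h Q r)) l" for P f l and R :: "'u set \<Rightarrow> 'u rel" and h
    using ax5 that by blast
  have iter: "conv S (\<lambda>s. case \<phi> s of (p, f) \<Rightarrow> g p (f p)) m"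
    if "small_directed P" "\<forall>p \<in> Field P. small_directed (Q p)" "small_directed S"
      "order_iso S (iter_index P Q) \<phi>" "\<forall>p \<in> Field P. conv (Q p) (g p) (l p)" "conv P l m"
    for P Q S \<phi> g l m
    using ax6 that by blast
  define op where "op U \<longleftrightarrow> U \<subseteq> H \<and> (\<forall>P f l. small_directed P \<longrightarrow> conv P f l \<longrightarrow> l \<in> U \<longrightarrow> tail_in P f U)"
    for U
  have "istopology op"
    unfolding istopology_def
  proof (intro conjI allI impI)
    fix U V assume U: "op U" and V: "op V"
    then show "op (U \<inter> V)" unfolding op_def using tail_in_Int[OF small_directedD(2)] by blast
  next
    fix K assume K: "\<forall>U\<in>K. op U"
    show "op (\<Union>K)"
      unfolding op_def
    proof (intro conjI allI impI)
      show "\<Union>K \<subseteq> H" using K unfolding op_def by blast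
      fix P f l assume "small_directed P" "conv P f l" "l \<in> \<Union>K"
      then obtain U where "U \<in> K" "tail_in P f U" using K unfolding op_def by blast
      then show "tail_in P f (\<Union>K)" using tail_in_mono Union_upper by metis
    qed
  qed
  then have open_iff: "openin (topology op) = op" by (rule topology_inverse')
  have "tail_in P f H" if "small_directed P" "conv P f l" for P f l
    using tail_in_all[OF small_directedD(2)[OF that(1)] in_H(1)[OF that]] .
  then have "op H" unfolding op_def by blast
  then have top: "topspace (topology op) = H"
    unfolding topspace_def open_iff by (auto simp: op_def)
  \<comment> \<open>The closed sets of the topology are the sets \<open>A\<close> with \<open>cl A \<subseteq> A\<close>.\<close>
  define cl where "cl A = {l. \<exists>P f. small_directed P \<and> conv P f l \<and> f ` Field P \<subseteq> A}" for A
  have cl_incl: "A \<subseteq> cl A" if "A \<subseteq> H" for A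
  proof
    fix l assume "l \<in> A"
    then show "l \<in> cl A"
      using that const[OF small_directed_singleton[of undefined], of l] small_directed_singleton[of undefined]
      unfolding cl_def by (intro CollectI exI[of _ "{(undefined, undefined)}"] exI[of _ "\<lambda>_. l"]) auto
  qed
  have cl_cl: "cl (cl A) \<subseteq> cl A" for A
  proof
    fix m assume "m \<in> cl (cl A)"
    then obtain P l where P: "small_directed P" "conv P l m" "l ` Field P \<subseteq> cl A"
      unfolding cl_def by blast
    then have "\<forall>p \<in> Field P. \<exists>Q g. small_directed Q \<and> conv Q g (l p) \<and> g ` Field Q \<subseteq> A"
      unfolding cl_def by blast
    then obtain Q g where Q: "\<forall>p \<in> Field P. small_directed (Q p)"
      and g: "\<forall>p \<in> Field P. conv (Q p) (g p) (l p)" "\<forall>p \<in> Field P. g p ` Field (Q p) \<subseteq> A"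
      by metis
    obtain S :: "'u rel" and \<phi> where S: "small_directed S" "order_iso S (iter_index P Q) \<phi>"
      using iter_index_code[OF P(1) Q] by blast
    have "(case \<phi> s of (p, f) \<Rightarrow> g p (f p)) \<in> A" if s: "s \<in> Field S" for s
    proof -
      obtain p f where pf: "\<phi> s = (p, f)" by force
      have "(p, f) \<in> Field (iter_index P Q)"
        using S(2) s pf unfolding order_iso_def bij_betw_def by force
      then have "p \<in> Field P" "f p \<in> Field (Q p)"
        using Field_iter_index[of P Q] P(1) Q small_directedD(2) by (metis mem_Sigma_iff PiE_mem)+
      then show ?thesis using g(2) by (auto simp: pf)
    qed
    then show "m \<in> cl A"
      using iter[OF P(1) Q S g(1) P(2)] S(1) unfolding cl_def by blast
  qed
  have cl_closed: "op (H - cl A)" for A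
    unfolding op_def
  proof (intro conjI allI impI)
    fix P f l assume P: "small_directed P" and f: "conv P f l" and l: "l \<in> H - cl A"
    show "tail_in P f (H - cl A)"
    proof (rule ccontr)
      assume "\<not> tail_in P f (H - cl A)"
      from not_tail_in_cofinal[OF this]
      have Q: "{p \<in> Field P. f p \<notin> H - cl A} \<in> cofinal_subsets P" (is "?Q \<in> _") .
      note r = directed_Restr[OF small_directedD(2)[OF P] Q]
      have "conv (Restr P ?Q) f l"
        using sub[OF P small_directed_Restr[OF P Q] r(3) f] .
      moreover have "f ` Field (Restr P ?Q) \<subseteq> cl A" unfolding r(2) using in_H(1)[OF P f] by auto
      ultimately have "l \<in> cl (cl A)" unfolding cl_def[of "cl A"] using small_directed_Restr[OF P Q] by blast
      then show False using cl_cl l by blast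
    qed
  qed auto
  have "conv P f l" if P: "small_directed P" and f: "net_limit (topology op) P f l" for P f l
  proof (rule ccontr)
    assume not: "\<not> conv P f l"
    have fH: "f ` Field P \<subseteq> H" "l \<in> H" using f by (auto simp: net_limit_def top)
    have "\<exists>Q \<in> cofinal_subsets P. \<forall>R h. small_directed R \<longrightarrow> cofinal_map R (Restr P Q) h \<longrightarrow>
        \<not> conv R (\<lambda>r. f (h r)) l"
    proof (rule ccontr)
      assume "\<not> ?thesis"
      then have "\<forall>Q \<in> cofinal_subsets P. \<exists>R h. small_directed R \<and> cofinal_map R (Restr P Q) h \<and>
        conv R (\<lambda>r. f (h r)) l" by blast
      then obtain R h where "\<forall>Q \<in> cofinal_subsets P. small_directed (R Q) \<and>
          cofinal_map (R Q) (Restr P Q) (h Q) \<and> conv (R Q) (\<lambda>r. f (h Q r)) l" by metis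
      from loc[OF P fH this] not show False by blast
    qed
    then obtain Q where Q: "Q \<in> cofinal_subsets P"
      and none: "\<And>R h. small_directed R \<Longrightarrow> cofinal_map R (Restr P Q) h \<Longrightarrow> \<not> conv R (\<lambda>r. f (h r)) l"
      by blast
    let ?P = "Restr P Q"
    note r = directed_Restr[OF small_directedD(2)[OF P] Q]
    have sP: "small_directed ?P" using small_directed_Restr[OF P Q] .
    have QP: "Q \<subseteq> Field P" using Q by (simp add: cofinal_subsets_def)
    \<comment> \<open>\<open>A q\<close> consists of the values of the net from \<open>q\<close> on along \<open>Q\<close>.\<close>
    define A where "A q = f ` {q' \<in> Q. (q, q') \<in> P}" for q
    have l_cl: "l \<in> cl (A q)" if q: "q \<in> Q" for q
    proof (rule ccontr)
      assume "l \<notin> cl (A q)"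
      then have "tail_in P f (H - cl (A q))"
        using f cl_closed[of "A q"] fH(2) by (simp add: net_limit_def open_iff)
      then have "tail_in ?P f (H - cl (A q))"
        using tail_in_cofinal_map[OF small_directedD(2)[OF P] r(3)] by blast
      then obtain p0 where p0: "p0 \<in> Q" "\<And>q'. (p0, q') \<in> ?P \<Longrightarrow> f q' \<notin> cl (A q)"
        unfolding tail_in_def r(2) by blast
      obtain q' where q': "(q, q') \<in> ?P" "(p0, q') \<in> ?P"
        using directed_ub[OF r(1), of q p0] q p0(1) unfolding r(2) by blast
      then have "f q' \<in> A q" unfolding A_def by blast
      moreover have "A q \<subseteq> H" unfolding A_def using fH(1) QP by blast
      ultimately show False using p0(2)[OF q'(2)] cl_incl by blast
    qed
    then have "\<forall>q \<in> Q. \<exists>R g. small_directed R \<and> conv R g l \<and> g ` Field R \<subseteq> A q"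
      unfolding cl_def by blast
    then obtain R g where R: "\<forall>q \<in> Q. small_directed (R q)" and g: "\<forall>q \<in> Q. conv (R q) (g q) l"
      "\<forall>q \<in> Q. g q ` Field (R q) \<subseteq> A q" by metis
    have "\<forall>q \<in> Q. \<forall>x \<in> Field (R q). \<exists>q'. q' \<in> Q \<and> (q, q') \<in> P \<and> g q x = f q'"
      using g(2) unfolding A_def by blast
    then obtain k where k: "\<forall>q \<in> Q. \<forall>x \<in> Field (R q). k q x \<in> Q \<and> (q, k q x) \<in> P \<and> g q x = f (k q x)"
      by metis
    have R': "\<forall>q \<in> Field ?P. small_directed (R q)" and g': "\<forall>q \<in> Field ?P. conv (R q) (g q) l"
      using R g(1) unfolding r(2) by auto
    obtain S :: "'u rel" and \<phi> where S: "small_directed S" "order_iso S (iter_index ?P R) \<phi>"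
      using iter_index_code[OF sP R'] by blast
    have FI: "Field (iter_index ?P R) = Q \<times> (\<Pi>\<^sub>E i \<in> Q. Field (R i))"
      using Field_iter_index[OF r(1), of R] small_directedD(2) R' unfolding r(2) by blast
    have bij: "bij_betw \<phi> (Field S) (Field (iter_index ?P R))" using S(2) unfolding order_iso_def by blast
    have el: "\<exists>q x. \<phi> s = (q, x) \<and> q \<in> Q \<and> x q \<in> Field (R q)" if "s \<in> Field S" for s
    proof -
      have "\<phi> s \<in> Q \<times> (\<Pi>\<^sub>E i \<in> Q. Field (R i))" using bij that FI unfolding bij_betw_def by blast
      then show ?thesis by auto
    qed
    \<comment> \<open>The diagonal of the nets \<open>g q\<close> is a subnet of \<open>f\<close>: its value at \<open>(q, x)\<close> is a value of \<open>f\<close> at the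
      index \<open>k q (x q)\<close>, which lies in \<open>Q\<close> above \<open>q\<close>.\<close>
    define h where "h s = (case \<phi> s of (q, x) \<Rightarrow> k q (x q))" for s
    have "conv S (\<lambda>s. case \<phi> s of (q, x) \<Rightarrow> g q (x q)) l"
      using iter[OF sP R' S g' const[OF sP fH(2)]] .
    moreover have "(case \<phi> s of (q, x) \<Rightarrow> g q (x q)) = f (h s)" if "s \<in> Field S" for s
      using el[OF that] k unfolding h_def by auto
    ultimately have "conv S (\<lambda>s. f (h s)) l" by (rule cong[OF S(1)])
    moreover have "cofinal_map S ?P h"
      unfolding cofinal_map_def r(2)
    proof (intro conjI ballI)
      show "h ` Field S \<subseteq> Q" using el k unfolding h_def by force
      fix q assume q: "q \<in> Q"
      have "\<forall>i \<in> Q. \<exists>a. a \<in> Field (R i)"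
      proof
        fix i assume "i \<in> Q"
        then show "\<exists>a. a \<in> Field (R i)"
          using directed_nonempty[OF small_directedD(2)[OF R[rule_format]]] by blast
      qed
      then obtain x where x: "\<forall>i \<in> Q. x i \<in> Field (R i)" by metis
      have "(q, restrict x Q) \<in> Field (iter_index ?P R)" using q x FI by auto
      then obtain s where s: "s \<in> Field S" "\<phi> s = (q, restrict x Q)"
        using bij unfolding bij_betw_def by (metis imageE)
      have "(q, h s') \<in> ?P" if s': "(s, s') \<in> S" for s'
      proof -
        have s'F: "s' \<in> Field S" using s' by (rule FieldI2)
        then obtain q' y where y: "\<phi> s' = (q', y)" "q' \<in> Q" "y q' \<in> Field (R q')" using el by blast
        have "(\<phi> s, \<phi> s') \<in> iter_index ?P R" using S(2) s(1) s' s'F unfolding order_iso_def by blast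
        then have "(q, q') \<in> ?P" unfolding s(2) y(1) iter_index_def by auto
        moreover have "(q', k q' (y q')) \<in> ?P" using k y by blast
        ultimately show ?thesis unfolding h_def y(1) using directed_trans[OF r(1)] by auto
      qed
      then show "\<exists>s\<in>Field S. \<forall>s'. (s, s') \<in> S \<longrightarrow> (q, h s') \<in> ?P" using s(1) by blast
    qed
    ultimately show False using none[OF S(1)] by blast
  qed
  moreover have "net_limit (topology op) P f l" if "small_directed P" "conv P f l" for P f l
    using that in_H unfolding net_limit_def top open_iff op_def by blast
  ultimately show ?thesis using that[OF top] by blast
qed

end

section \<open>Colimits of small diagrams of arbitrary type\<close>

text \<open>
  Cocompleteness and cocontinuity speak about diagrams whose objects and arrows are elements of \<open>'u\<close>.
  A small diagram of another type is renamed along injections \<open>e\<close> on objects and \<open>d\<close> on arrows;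
  cocones and colimits correspond to each other.
\<close>

definition recode :: "('i, 'j) cat \<Rightarrow> ('i \<Rightarrow> 'k) \<Rightarrow> ('j \<Rightarrow> 'l) \<Rightarrow> ('k, 'l) cat" where
  "recode J e d = (let e' = inv_into (Obj J) e; d' = inv_into (Arr J) d in
     \<lparr>Obj = e ` Obj J, Arr = d ` Arr J, Dom = (\<lambda>a. e (Dom J (d' a))), Cod = (\<lambda>a. e (Cod J (d' a))),
      Id = (\<lambda>i. d (Id J (e' i))), Comp = (\<lambda>b a. d (d' b \<cdot>\<^bsub>J\<^esub> d' a))\<rparr>)"

definition recode_ftr :: "('i, 'j) cat \<Rightarrow> ('i \<Rightarrow> 'k) \<Rightarrow> ('j \<Rightarrow> 'l) \<Rightarrow> ('i, 'j, 'o, 'm) ftr \<Rightarrow>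
    ('k, 'l, 'o, 'm) ftr" where
  "recode_ftr J e d G = \<lparr>fobj = (\<lambda>i. fobj G (inv_into (Obj J) e i)),
     farr = (\<lambda>a. farr G (inv_into (Arr J) d a))\<rparr>"

lemma recode_comp_ftr: "comp_ftr F (recode_ftr J e d G) = recode_ftr J e d (comp_ftr F G)"
  by (simp add: comp_ftr_def recode_ftr_def)

locale recoding = J: category J for J :: "('i, 'j) cat" +
  fixes e :: "'i \<Rightarrow> 'k" and d :: "'j \<Rightarrow> 'l"
  assumes e: "inj_on e (Obj J)" and d: "inj_on d (Arr J)"
begin

abbreviation "J' \<equiv> recode J e d"
abbreviation "e' \<equiv> inv_into (Obj J) e"
abbreviation "d' \<equiv> inv_into (Arr J) d"

lemma recode_hom: "homset J' (e x) (e y) = d ` homset J x y" if "x \<in> Obj J" "y \<in> Obj J"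
proof -
  have "e (Dom J f) = e x \<longleftrightarrow> Dom J f = x" "e (Cod J f) = e y \<longleftrightarrow> Cod J f = y"
    if "f \<in> Arr J" for f
    using e J.dom_cod[OF that] \<open>x \<in> Obj J\<close> \<open>y \<in> Obj J\<close> by (auto simp: inj_on_def)
  then show ?thesis
    using d by (auto simp: homset_def recode_def Let_def image_iff)
qed

lemma recode_homE:
  assumes "f \<in> homset J' x y"
  obtains x0 y0 f0 where "x0 \<in> Obj J" "y0 \<in> Obj J" "x = e x0" "y = e y0" "f = d f0"
    "f0 \<in> homset J x0 y0"
proof -
  obtain f0 where f0: "f0 \<in> Arr J" "f = d f0"
    using assms by (auto simp: homset_def recode_def Let_def)
  then show ?thesis
    using assms d J.dom_cod[OF f0(1)] by (intro that) (auto simp: homset_def recode_def Let_def)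
qed

lemma recode_simps:
  "Obj J' = e ` Obj J" "Arr J' = d ` Arr J"
  "x \<in> Obj J \<Longrightarrow> Id J' (e x) = d (Id J x)"
  "f \<in> Arr J \<Longrightarrow> g \<in> Arr J \<Longrightarrow> d g \<cdot>\<^bsub>J'\<^esub> d f = d (g \<cdot>\<^bsub>J\<^esub> f)"
  using e d by (auto simp: recode_def Let_def)

lemma recode_category: "category J'"
proof (unfold_locales, goal_cases)
  case (1 f) then show ?case using d J.dom_cod by (auto simp: recode_def Let_def)
next
  case (2 x)
  then obtain x0 where "x0 \<in> Obj J" "x = e x0" by (auto simp: recode_simps)
  then show ?case using J.id_hom recode_hom recode_simps(3) by auto
next
  case (3 f x y g z)
  then show ?case using J.comp_hom J.hom_obj recode_hom
    by (smt (verit, ccfv_threshold) e homsetD imageI inj_onD recode_homE recode_simps(4))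
next
  case (4 f x y)
  then show ?case
    by (elim recode_homE) (use J.id_hom J.id_left in \<open>auto simp: recode_simps homset_def\<close>)
next
  case (5 f x y)
  then show ?case
    by (elim recode_homE) (use J.id_hom J.id_right in \<open>auto simp: recode_simps homset_def\<close>)
next
  case (6 f w x g y h z)
  obtain w0 x0 f0 where f: "w0 \<in> Obj J" "x0 \<in> Obj J" "w = e w0" "x = e x0" "f = d f0"
    "f0 \<in> homset J w0 x0" using recode_homE[OF 6(1)] .
  obtain x1 y0 g0 where g: "x1 \<in> Obj J" "y0 \<in> Obj J" "x = e x1" "y = e y0" "g = d g0"
    "g0 \<in> homset J x1 y0" using recode_homE[OF 6(2)] .
  obtain y1 z0 h0 where h: "y1 \<in> Obj J" "z0 \<in> Obj J" "y = e y1" "z = e z0" "h = d h0"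
    "h0 \<in> homset J y1 z0" using recode_homE[OF 6(3)] .
  have [simp]: "x1 = x0" "y1 = y0" using f g h e by (auto simp: inj_on_def)
  have gf: "g0 \<cdot>\<^bsub>J\<^esub> f0 \<in> homset J w0 y0" and hg: "h0 \<cdot>\<^bsub>J\<^esub> g0 \<in> homset J x0 z0"
    using J.comp_hom f(6) g(6) h(6) by auto
  show ?case
    using J.comp_assoc[of f0 w0 x0 g0 y0 h0 z0] f g h homsetD[OF f(6)] homsetD[OF g(6)]
      homsetD[OF h(6)] homsetD[OF gf] homsetD[OF hg] by (simp add: recode_simps)
qed

context
  fixes C :: "('o, 'm) cat" and G :: "('i, 'j, 'o, 'm) ftr"
  assumes G: "is_functor J C G"
begin

lemma recode_functor: "is_functor J' C (recode_ftr J e d G)"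
  unfolding is_functor_def
proof (intro conjI ballI allI, goal_cases)
  case 1 show ?case by (rule recode_category)
next
  case 2 show ?case using functorD[OF G] by blast
next
  case (3 x) then show ?case using functorD(3)[OF G] e by (auto simp: recode_simps recode_ftr_def)
next
  case (4 x y f)
  then show ?case
    by (elim recode_homE) (use functorD(4)[OF G] e d in \<open>auto simp: recode_ftr_def homset_def\<close>)
next
  case (5 x)
  then obtain x0 where x0: "x0 \<in> Obj J" "x = e x0" by (auto simp: recode_simps)
  then show ?case
    using functorD(5)[OF G x0(1)] e d homsetD[OF J.id_hom[OF x0(1)]]
    by (auto simp: recode_ftr_def recode_simps)
next
  case (6 x y z f g)
  obtain x0 y0 f0 where f: "x0 \<in> Obj J" "y0 \<in> Obj J" "x = e x0" "y = e y0" "f = d f0"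
    "f0 \<in> homset J x0 y0" using recode_homE[OF 6(1)] .
  obtain y1 z0 g0 where g: "y1 \<in> Obj J" "z0 \<in> Obj J" "y = e y1" "z = e z0" "g = d g0"
    "g0 \<in> homset J y1 z0" using recode_homE[OF 6(2)] .
  have [simp]: "y1 = y0" using f g e by (auto simp: inj_on_def)
  have gf: "g0 \<cdot>\<^bsub>J\<^esub> f0 \<in> homset J x0 z0" using J.comp_hom f g by auto
  show ?case
    using functorD(6)[OF G f(6), of g0 z0] f g homsetD[OF f(6)] homsetD[OF g(6)] homsetD[OF gf] d
    by (simp add: recode_simps recode_ftr_def)
qed

lemma recode_cocone:
  "is_cocone J' C (recode_ftr J e d G) x (\<lambda>i. \<kappa> (e' i)) \<longleftrightarrow> is_cocone J C G x \<kappa>"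
proof -
  have "(\<forall>i j. \<forall>a \<in> homset J' i j. \<kappa> (e' j) \<cdot>\<^bsub>C\<^esub> farr G (d' a) = \<kappa> (e' i)) \<longleftrightarrow>
     (\<forall>i j. \<forall>a \<in> homset J i j. \<kappa> j \<cdot>\<^bsub>C\<^esub> farr G a = \<kappa> i)" (is "?L = ?R")
  proof
    assume ?L show ?R
    proof (intro allI ballI)
      fix i j a assume a: "a \<in> homset J i j"
      then have o: "i \<in> Obj J" "j \<in> Obj J" using J.hom_obj by auto
      then have "d a \<in> homset J' (e i) (e j)" using a recode_hom by auto
      then show "\<kappa> j \<cdot>\<^bsub>C\<^esub> farr G a = \<kappa> i" using \<open>?L\<close> o e d homsetD[OF a] by force
    qed
  next
    assume R: ?R show ?L
      by (intro allI ballI, elim recode_homE) (use R e d in \<open>auto simp: homset_def\<close>)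
  qed
  then show ?thesis
    using e by (simp add: is_cocone_def recode_ftr_def recode_simps)
qed

lemma recode_cocone':
  "is_cocone J' C (recode_ftr J e d G) x \<kappa> \<longleftrightarrow> is_cocone J C G x (\<lambda>i. \<kappa> (e i))"
proof -
  have "is_cocone J' C (recode_ftr J e d G) x \<kappa> \<longleftrightarrow>
    is_cocone J' C (recode_ftr J e d G) x (\<lambda>i. \<kappa> (e (e' i)))"
  proof -
    have "e (e' i) = i" if "i \<in> Obj J'" for i using that by (simp add: recode_simps f_inv_into_f)
    moreover have "i \<in> Obj J' \<and> j \<in> Obj J'" if "a \<in> homset J' i j" for i j a
      using that category.hom_obj[OF recode_category] by fast
    ultimately show ?thesis unfolding is_cocone_def by (intro conj_cong ball_cong refl iff_allI) metis+
  qed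
  also have "\<dots> \<longleftrightarrow> is_cocone J C G x (\<lambda>i. \<kappa> (e i))"
    using recode_cocone[of x "\<lambda>i. \<kappa> (e i)"] by simp
  finally show ?thesis .
qed

lemma recode_colimit:
  "is_colimit J' C (recode_ftr J e d G) x \<kappa> \<longleftrightarrow> is_colimit J C G x (\<lambda>i. \<kappa> (e i))"
proof -
  have "(\<forall>y \<mu>. is_cocone J' C (recode_ftr J e d G) y \<mu> \<longrightarrow>
        (\<exists>!u. u \<in> homset C x y \<and> (\<forall>i \<in> Obj J'. u \<cdot>\<^bsub>C\<^esub> \<kappa> i = \<mu> i))) \<longleftrightarrow>
     (\<forall>y \<mu>. is_cocone J C G y \<mu> \<longrightarrow>
        (\<exists>!u. u \<in> homset C x y \<and> (\<forall>i \<in> Obj J. u \<cdot>\<^bsub>C\<^esub> \<kappa> (e i) = \<mu> i)))" (is "?L = ?R")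
  proof
    assume L: ?L show ?R
    proof (intro allI impI)
      fix y \<mu> assume "is_cocone J C G y \<mu>"
      then have "is_cocone J' C (recode_ftr J e d G) y (\<lambda>i. \<mu> (e' i))" using recode_cocone by blast
      from L[rule_format, OF this]
      show "\<exists>!u. u \<in> homset C x y \<and> (\<forall>i \<in> Obj J. u \<cdot>\<^bsub>C\<^esub> \<kappa> (e i) = \<mu> i)"
        using e by (simp add: recode_simps)
    qed
  next
    assume R: ?R show ?L
    proof (intro allI impI)
      fix y \<mu> assume "is_cocone J' C (recode_ftr J e d G) y \<mu>"
      then have "is_cocone J C G y (\<lambda>i. \<mu> (e i))" using recode_cocone' by blast
      from R[rule_format, OF this]
      show "\<exists>!u. u \<in> homset C x y \<and> (\<forall>i \<in> Obj J'. u \<cdot>\<^bsub>C\<^esub> \<kappa> i = \<mu> i)"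
        using e by (simp add: recode_simps)
    qed
  qed
  then show ?thesis unfolding is_colimit_def recode_cocone' by simp
qed

end

end

lemma recoding_exists:
  assumes "category J" "small TYPE('u) (Obj J)" "small TYPE('u) (Arr J)"
  obtains e :: "'i \<Rightarrow> 'u" and d :: "'j \<Rightarrow> 'u" where "recoding (J :: ('i, 'j) cat) e d"
    "small_category (recode J e d)"
proof -
  obtain e :: "'i \<Rightarrow> 'u" where e: "inj_on e (Obj J)" using small_ex_inj[OF assms(2)] .
  obtain d :: "'j \<Rightarrow> 'u" where d: "inj_on d (Arr J)" using small_ex_inj[OF assms(3)] .
  interpret category J by fact
  interpret recoding J e d by unfold_locales fact+
  have "recoding J e d" by unfold_locales
  moreover have "small_category (recode J e d)"
    using recode_category assms(2,3)
    by (simp add: small_category_def recode_simps small_image)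
  ultimately show ?thesis using that by blast
qed

lemma cocomplete_colimit:
  fixes J :: "('i, 'j) cat"
  assumes "cocomplete TYPE('u) C" "small TYPE('u) (Obj J)" "small TYPE('u) (Arr J)" "is_functor J C G"
  shows "\<exists>x \<kappa>. is_colimit J C G x \<kappa>"
proof -
  have J: "category J" using functorD[OF assms(4)] by blast
  obtain e :: "'i \<Rightarrow> 'u" and d :: "'j \<Rightarrow> 'u" where r: "recoding J e d" "small_category (recode J e d)"
    using recoding_exists[OF J assms(2,3)] .
  interpret recoding J e d by fact
  obtain x \<kappa> where "is_colimit (recode J e d) C (recode_ftr J e d G) x \<kappa>"
    using assms(1) r(2) recode_functor[OF assms(4)] unfolding cocomplete_def by blast
  then show ?thesis using recode_colimit[OF assms(4)] by blast
qed

lemma cocontinuous_colimit: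
  fixes J :: "('i, 'j) cat"
  assumes F: "cocontinuous TYPE('u) A B F"
    and "small TYPE('u) (Obj J)" "small TYPE('u) (Arr J)" "is_functor J A G"
    and x: "is_colimit J A G x \<kappa>"
  shows "is_colimit J B (comp_ftr F G) (fobj F x) (\<lambda>i. farr F (\<kappa> i))"
proof -
  have J: "category J" using functorD[OF assms(4)] by blast
  have FAB: "is_functor A B F" using F unfolding cocontinuous_def by blast
  obtain e :: "'i \<Rightarrow> 'u" and d :: "'j \<Rightarrow> 'u" where r: "recoding J e d" "small_category (recode J e d)"
    using recoding_exists[OF J assms(2,3)] .
  interpret recoding J e d by fact
  have ee: "e' (e i) = i" if "i \<in> Obj J" for i using that e by simp
  have cong: "is_colimit J D H y \<nu> = is_colimit J D H y \<nu>'"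
    if "\<And>i. i \<in> Obj J \<Longrightarrow> \<nu> i = \<nu>' i" for D :: "('x, 'y) cat" and H y \<nu> \<nu>'
  proof -
    have "(\<forall>i j. \<forall>a \<in> homset J i j. \<nu> j \<cdot>\<^bsub>D\<^esub> farr H a = \<nu> i) \<longleftrightarrow>
      (\<forall>i j. \<forall>a \<in> homset J i j. \<nu>' j \<cdot>\<^bsub>D\<^esub> farr H a = \<nu>' i)"
      using that J.hom_obj by (intro iff_allI ball_cong) auto
    then have "is_cocone J D H y \<nu> = is_cocone J D H y \<nu>'"
      using that unfolding is_cocone_def by simp
    then show ?thesis using that unfolding is_colimit_def by simp
  qed
  have "is_colimit J' A (recode_ftr J e d G) x (\<lambda>i. \<kappa> (e' i))"
    unfolding recode_colimit[OF assms(4)] using x cong[of "\<lambda>i. \<kappa> (e' (e i))" \<kappa> A] ee by simp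
  then have "is_colimit J' B (recode_ftr J e d (comp_ftr F G)) (fobj F x) (\<lambda>i. farr F (\<kappa> (e' i)))"
    using F r(2) recode_functor[OF assms(4)] unfolding cocontinuous_def recode_comp_ftr[symmetric]
    by blast
  then show ?thesis
    using recode_colimit[OF comp_ftr_functor[OF assms(4) FAB]]
      cong[of "\<lambda>i. farr F (\<kappa> (e' (e i)))" "\<lambda>i. farr F (\<kappa> i)" B] ee by simp
qed

section \<open>Colimits of bipartite diagrams\<close>

text \<open>
  All colimits used below, apart from those in the definitions of cocompleteness and cocontinuity, are
  colimits of a family of sources \<open>A\<close> and a family of sinks \<open>B\<close> with a set \<open>E\<close> of edges from sources
  to sinks. In such a category one of two composable arrows is an identity, so that the value of the
  composition on two edges is arbitrary.
\<close>

definition bip_cat :: "'a set \<Rightarrow> 'b set \<Rightarrow> 'e set \<Rightarrow> ('e \<Rightarrow> 'a) \<Rightarrow> ('e \<Rightarrow> 'b) \<Rightarrow>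
    ('a + 'b, ('a + 'b) + 'e) cat" where
  "bip_cat A B E s t =
     \<lparr>Obj = A <+> B, Arr = (A <+> B) <+> E, Dom = case_sum (\<lambda>i. i) (\<lambda>k. Inl (s k)),
      Cod = case_sum (\<lambda>i. i) (\<lambda>k. Inr (t k)), Id = Inl,
      Comp = (\<lambda>g f. case g of Inl i \<Rightarrow> f | Inr k \<Rightarrow> g)\<rparr>"

definition bip_ftr :: "('o, 'm) cat \<Rightarrow> ('a \<Rightarrow> 'o) \<Rightarrow> ('b \<Rightarrow> 'o) \<Rightarrow> ('e \<Rightarrow> 'm) \<Rightarrow>
    ('a + 'b, ('a + 'b) + 'e, 'o, 'm) ftr" where
  "bip_ftr C GA GB ge = \<lparr>fobj = case_sum GA GB,
     farr = case_sum (\<lambda>i. Id C (case_sum GA GB i)) ge\<rparr>"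

definition bip_cocone where
  "bip_cocone C A B E s t GA GB ge x \<alpha> \<beta> \<longleftrightarrow> x \<in> Obj C \<and>
     (\<forall>a \<in> A. \<alpha> a \<in> homset C (GA a) x) \<and> (\<forall>b \<in> B. \<beta> b \<in> homset C (GB b) x) \<and>
     (\<forall>k \<in> E. \<beta> (t k) \<cdot>\<^bsub>C\<^esub> ge k = \<alpha> (s k))"

definition bip_colimit where
  "bip_colimit C A B E s t GA GB ge x \<alpha> \<beta> \<longleftrightarrow> bip_cocone C A B E s t GA GB ge x \<alpha> \<beta> \<and>
     (\<forall>y \<alpha>' \<beta>'. bip_cocone C A B E s t GA GB ge y \<alpha>' \<beta>' \<longrightarrow>
        (\<exists>!u. u \<in> homset C x y \<and> (\<forall>a \<in> A. u \<cdot>\<^bsub>C\<^esub> \<alpha> a = \<alpha>' a) \<and>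
              (\<forall>b \<in> B. u \<cdot>\<^bsub>C\<^esub> \<beta> b = \<beta>' b)))"

locale bip_diagram = category C for C :: "('o, 'm) cat" (structure) +
  fixes A :: "'a set" and B :: "'b set" and E :: "'e set" and s t GA GB ge
  assumes s: "k \<in> E \<Longrightarrow> s k \<in> A" and t: "k \<in> E \<Longrightarrow> t k \<in> B"
    and GA: "a \<in> A \<Longrightarrow> GA a \<in> Obj C" and GB: "b \<in> B \<Longrightarrow> GB b \<in> Obj C"
    and ge: "k \<in> E \<Longrightarrow> ge k \<in> homset C (GA (s k)) (GB (t k))"
begin

abbreviation "J \<equiv> bip_cat A B E s t"
abbreviation "G \<equiv> bip_ftr C GA GB ge"

lemma bip_category: "category J"
  by unfold_locales (use s t in \<open>auto simp: bip_cat_def homset_def\<close>)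

lemma bip_functor: "is_functor J C G"
  unfolding is_functor_def
proof (intro conjI ballI allI, goal_cases)
  case 1 show ?case by (rule bip_category)
next
  case 2 show ?case by (rule category_axioms)
next
  case (3 x) then show ?case using GA GB by (auto simp: bip_cat_def bip_ftr_def)
next
  case (4 x y f) then show ?case using GA GB ge id_hom
    by (auto simp: bip_cat_def bip_ftr_def homset_def)
next
  case (5 x) then show ?case by (auto simp: bip_cat_def bip_ftr_def)
next
  case (6 x y z f g)
  have "Id C (GA a) \<cdot> Id C (GA a) = Id C (GA a)" if "a \<in> A" for a
    using id_hom[OF GA[OF that]] id_left by blast
  moreover have "Id C (GB b) \<cdot> Id C (GB b) = Id C (GB b)" if "b \<in> B" for b
    using id_hom[OF GB[OF that]] id_left by blast
  moreover have "Id C (GB (t k)) \<cdot> ge k = ge k" "ge k \<cdot> Id C (GA (s k)) = ge k" if "k \<in> E" for k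
    using ge[OF that] id_left id_right by blast+
  ultimately show ?case using 6
    by (auto simp: bip_cat_def bip_ftr_def homset_def)
qed

lemma bip_cocone_iff:
  "is_cocone J C G x (case_sum \<alpha> \<beta>) \<longleftrightarrow> bip_cocone C A B E s t GA GB ge x \<alpha> \<beta>"
proof
  assume L: "is_cocone J C G x (case_sum \<alpha> \<beta>)"
  have "\<beta> (t k) \<cdot> ge k = \<alpha> (s k)" if k: "k \<in> E" for k
  proof -
    have "Inr k \<in> homset J (Inl (s k)) (Inr (t k))" using k by (auto simp: homset_def bip_cat_def)
    then show ?thesis using L unfolding is_cocone_def bip_ftr_def by fastforce
  qed
  moreover have "\<alpha> a \<in> homset C (GA a) x" if "a \<in> A" for a
    using L that unfolding is_cocone_def by (simp add: bip_ftr_def bip_cat_def Plus_def ball_Un)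
  moreover have "\<beta> b \<in> homset C (GB b) x" if "b \<in> B" for b
    using L that unfolding is_cocone_def by (simp add: bip_ftr_def bip_cat_def Plus_def ball_Un)
  ultimately show "bip_cocone C A B E s t GA GB ge x \<alpha> \<beta>"
    using L unfolding bip_cocone_def is_cocone_def by blast
next
  assume R: "bip_cocone C A B E s t GA GB ge x \<alpha> \<beta>"
  have h: "case_sum \<alpha> \<beta> i \<in> homset C (fobj G i) x" if "i \<in> Obj J" for i
    using R that unfolding bip_cocone_def bip_cat_def bip_ftr_def by auto
  moreover have "case_sum \<alpha> \<beta> j \<cdot> farr G a = case_sum \<alpha> \<beta> i" if a: "a \<in> homset J i j" for a i j
  proof (cases a)
    case (Inl l)
    then have l: "i = l" "j = l" "l \<in> Obj J" using a by (auto simp: homset_def bip_cat_def)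
    then show ?thesis using id_right[OF h[OF l(3)]] Inl by (simp add: bip_ftr_def)
  next
    case (Inr k)
    then show ?thesis using a R by (auto simp: homset_def bip_cat_def bip_cocone_def bip_ftr_def)
  qed
  ultimately show "is_cocone J C G x (case_sum \<alpha> \<beta>)"
    using R unfolding is_cocone_def bip_cocone_def by blast
qed

lemma case_sum_comps: "case_sum (\<lambda>a. \<kappa> (Inl a)) (\<lambda>b. \<kappa> (Inr b)) = \<kappa>"
  by (auto split: sum.splits)

lemma bip_colimit_iff:
  "is_colimit J C G x (case_sum \<alpha> \<beta>) \<longleftrightarrow> bip_colimit C A B E s t GA GB ge x \<alpha> \<beta>"
proof -
  have all: "(\<forall>\<mu>. P \<mu>) \<longleftrightarrow> (\<forall>\<alpha>' \<beta>'. P (case_sum \<alpha>' \<beta>'))" for P :: "('a + 'b \<Rightarrow> 'm) \<Rightarrow> bool"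
    using case_sum_comps by metis
  have "(\<forall>i \<in> Obj J. u \<cdot> case_sum \<alpha> \<beta> i = case_sum \<alpha>' \<beta>' i) \<longleftrightarrow>
     (\<forall>a \<in> A. u \<cdot> \<alpha> a = \<alpha>' a) \<and> (\<forall>b \<in> B. u \<cdot> \<beta> b = \<beta>' b)" for u \<alpha>' \<beta>'
    by (simp add: bip_cat_def Plus_def ball_Un)
  then show ?thesis
    unfolding is_colimit_def bip_colimit_def bip_cocone_iff all by simp
qed

end

context universe begin

lemma small_bip:
  assumes "small TYPE('u) A" "small TYPE('u) B" "small TYPE('u) E"
  shows "small TYPE('u) (Obj (bip_cat A B E s t))" "small TYPE('u) (Arr (bip_cat A B E s t))"
  using assms by (simp_all add: bip_cat_def small_Plus)

lemma cocomplete_bip: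
  assumes "bip_diagram C A B E s t GA GB ge" "cocomplete TYPE('u) C"
    "small TYPE('u) A" "small TYPE('u) B" "small TYPE('u) E"
  obtains x \<alpha> \<beta> where "bip_colimit C A B E s t GA GB ge x \<alpha> \<beta>"
proof -
  interpret bip_diagram C A B E s t GA GB ge by fact
  show ?thesis
    using cocomplete_colimit[OF assms(2) small_bip[OF assms(3-5)] bip_functor] that bip_colimit_iff
      case_sum_comps by metis
qed

lemma cocontinuous_bip:
  assumes "bip_diagram C A B E s t GA GB ge" "cocontinuous TYPE('u) C D F"
    "small TYPE('u) A" "small TYPE('u) B" "small TYPE('u) E"
    "bip_colimit C A B E s t GA GB ge x \<alpha> \<beta>"
  shows "bip_colimit D A B E s t (\<lambda>a. fobj F (GA a)) (\<lambda>b. fobj F (GB b)) (\<lambda>k. farr F (ge k))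
     (fobj F x) (\<lambda>a. farr F (\<alpha> a)) (\<lambda>b. farr F (\<beta> b))"
proof -
  interpret bip_diagram C A B E s t GA GB ge by fact
  have F: "is_functor C D F" using assms(2) unfolding cocontinuous_def by blast
  interpret D: bip_diagram D A B E s t "\<lambda>a. fobj F (GA a)" "\<lambda>b. fobj F (GB b)" "\<lambda>k. farr F (ge k)"
    by (intro bip_diagram.intro bip_diagram_axioms.intro)
      (use s t GA GB ge functorD[OF F] in auto)
  have "is_colimit J D (comp_ftr F G) (fobj F x) (\<lambda>i. farr F (case_sum \<alpha> \<beta> i))"
    using cocontinuous_colimit[OF assms(2) small_bip[OF assms(3-5)] bip_functor]
      bip_colimit_iff assms(6) by blast
  moreover have "(\<lambda>i. farr F (case_sum \<alpha> \<beta> i)) = case_sum (\<lambda>a. farr F (\<alpha> a)) (\<lambda>b. farr F (\<beta> b))"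
    by (auto split: sum.splits)
  moreover have "is_colimit J D (comp_ftr F G) y \<kappa> \<longleftrightarrow> is_colimit J D D.G y \<kappa>" for y \<kappa>
  proof -
    have "farr (comp_ftr F G) a = farr D.G a" if "a \<in> homset J i j" for a i j
      using that functorD(5)[OF F] GA GB
      by (auto simp: comp_ftr_def bip_ftr_def homset_def bip_cat_def split: sum.splits)
    moreover have "fobj (comp_ftr F G) = fobj D.G"
      by (auto simp: comp_ftr_def bip_ftr_def split: sum.splits)
    ultimately have "is_cocone J D (comp_ftr F G) y \<kappa> \<longleftrightarrow> is_cocone J D D.G y \<kappa>" for y \<kappa>
      unfolding is_cocone_def by simp
    then show ?thesis unfolding is_colimit_def by simp
  qed
  ultimately show ?thesis using D.bip_colimit_iff by simp
qed

end

lemma opcat_opcat [simp]: "opcat (opcat C) = C"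
  by (simp add: opcat_def)

context category begin

lemma comp_simps [simp]:
  "f \<in> Arr C \<Longrightarrow> g \<in> Arr C \<Longrightarrow> Cod C f = Dom C g \<Longrightarrow> g \<cdot> f \<in> Arr C"
  "f \<in> Arr C \<Longrightarrow> g \<in> Arr C \<Longrightarrow> Cod C f = Dom C g \<Longrightarrow> Dom C (g \<cdot> f) = Dom C f"
  "f \<in> Arr C \<Longrightarrow> g \<in> Arr C \<Longrightarrow> Cod C f = Dom C g \<Longrightarrow> Cod C (g \<cdot> f) = Cod C g"
  using comp_hom[of f "Dom C f" "Cod C f" g "Cod C g"] by (auto simp: homset_def)

lemma assoc_simp:
  "f \<in> Arr C \<Longrightarrow> g \<in> Arr C \<Longrightarrow> h \<in> Arr C \<Longrightarrow> Cod C f = Dom C g \<Longrightarrow> Cod C g = Dom C h \<Longrightarrow>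
    (h \<cdot> g) \<cdot> f = h \<cdot> (g \<cdot> f)"
  using comp_assoc[of f "Dom C f" "Cod C f" g "Cod C g" h "Cod C h"] by (auto simp: homset_def)

lemma id_simps [simp]:
  "x \<in> Obj C \<Longrightarrow> Id C x \<in> Arr C" "x \<in> Obj C \<Longrightarrow> Dom C (Id C x) = x"
  "x \<in> Obj C \<Longrightarrow> Cod C (Id C x) = x"
  "f \<in> Arr C \<Longrightarrow> Cod C f = x \<Longrightarrow> Id C x \<cdot> f = f" "f \<in> Arr C \<Longrightarrow> Dom C f = x \<Longrightarrow> f \<cdot> Id C x = f"
  using id_hom id_left[of f "Dom C f" "Cod C f"] id_right[of f "Dom C f" "Cod C f"]
  by (auto simp: homset_def)

end

section \<open>Products and pullbacks in the opposite of a cocomplete category\<close>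

text \<open>
  Internal topologies are an affair of a category \<open>D\<close> with small limits. In the application
  \<open>D\<close> is the opposite of a cocomplete category, and small limits in \<open>D\<close> are only ever obtained as
  colimits in \<open>opcat D\<close>; so this is how completeness is expressed.
\<close>

locale complete_cat = universe \<UU> + category D for \<UU> :: "'u itself" and D :: "('o, 'm) cat" (structure) +
  assumes cocompl: "cocomplete TYPE('u) (opcat D)"
begin

lemma has_product:
  fixes I :: "'i set"
  assumes I: "small TYPE('u) I" and A: "\<And>i. i \<in> I \<Longrightarrow> A i \<in> Obj D"
  shows "\<exists>c. is_product D I A (fst c) (snd c)"
proof -
  have b: "bip_diagram (opcat D) I ({} :: unit set) ({} :: unit set) s t A GB ge" for s t GB ge
    using A opcat_category by (intro bip_diagram.intro bip_diagram_axioms.intro) auto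
  obtain x \<alpha> \<beta> where x: "bip_colimit (opcat D) I ({} :: unit set) ({} :: unit set)
      undefined undefined A undefined undefined x \<alpha> \<beta>"
    using cocomplete_bip[OF b cocompl I] small_finite by blast
  have "is_product D I A x \<alpha>"
    unfolding is_product_def
  proof (intro conjI allI impI ballI)
    show "x \<in> Obj D" "\<And>i. i \<in> I \<Longrightarrow> \<alpha> i \<in> homset D x (A i)"
      using x by (auto simp: bip_colimit_def bip_cocone_def)
    fix w f assume "w \<in> Obj D" "\<forall>i\<in>I. f i \<in> homset D w (A i)"
    then show "\<exists>!u. u \<in> homset D w x \<and> (\<forall>i\<in>I. \<alpha> i \<cdot> u = f i)"
      using x unfolding bip_colimit_def bip_cocone_def by simp
  qed
  then show ?thesis by (metis fst_conv snd_conv)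
qed

lemma pullback_exists:
  assumes f: "f \<in> homset D x z" and g: "g \<in> homset D y z"
  obtains w a b where "is_pullback D f g w a b"
proof -
  have b: "bip_diagram (opcat D) {()} (UNIV :: bool set) (UNIV :: bool set) (\<lambda>_. ()) (\<lambda>b. b)
      (\<lambda>_. z) (case_bool x y) (case_bool f g)"
    using assms hom_obj[OF f] hom_obj[OF g] opcat_category
    by (intro bip_diagram.intro bip_diagram_axioms.intro) (auto split: bool.splits)
  obtain w \<alpha> \<beta> where w: "bip_colimit (opcat D) {()} (UNIV :: bool set) (UNIV :: bool set)
      (\<lambda>_. ()) (\<lambda>b. b) (\<lambda>_. z) (case_bool x y) (case_bool f g) w \<alpha> \<beta>"
    using cocomplete_bip[OF b cocompl] small_finite by (metis finite finite.emptyI finite.insertI)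
  have c: "\<alpha> () \<in> homset D w z" "\<beta> True \<in> homset D w x" "\<beta> False \<in> homset D w y"
    "f \<cdot> \<beta> True = \<alpha> ()" "g \<cdot> \<beta> False = \<alpha> ()"
    using w unfolding bip_colimit_def bip_cocone_def by (auto simp: all_bool_eq)
  have "is_pullback D f g w (\<beta> True) (\<beta> False)"
    unfolding is_pullback_def
  proof (intro conjI allI ballI impI)
    fix v a' b' assume a: "a' \<in> homset D v (Dom D f)" and b: "b' \<in> homset D v (Dom D g)"
      and eq: "f \<cdot> a' = g \<cdot> b'"
    have fa: "f \<cdot> a' \<in> homset D v z" using a f comp_hom homsetD[OF f] by metis
    have "bip_cocone (opcat D) {()} UNIV UNIV (\<lambda>_. ()) (\<lambda>b. b) (\<lambda>_. z) (case_bool x y)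
        (case_bool f g) v (\<lambda>_. f \<cdot> a') (case_bool a' b')"
      using a b eq fa hom_obj[OF fa] homsetD[OF f] homsetD[OF g]
      unfolding bip_cocone_def by (auto split: bool.splits)
    then have "\<exists>!u. u \<in> homset (opcat D) w v \<and> (\<forall>c\<in>{()}. u \<cdot>\<^bsub>opcat D\<^esub> \<alpha> c = f \<cdot> a') \<and>
        (\<forall>b\<in>UNIV. u \<cdot>\<^bsub>opcat D\<^esub> \<beta> b = (case b of True \<Rightarrow> a' | False \<Rightarrow> b'))"
      using w unfolding bip_colimit_def by blast
    moreover have "\<alpha> () \<cdot> u = f \<cdot> a'" if "u \<in> homset D v w" "\<beta> True \<cdot> u = a'" for u
      using that c comp_assoc[OF that(1) c(2) f] by simp
    ultimately show "\<exists>!u. u \<in> homset D v w \<and> \<beta> True \<cdot> u = a' \<and> \<beta> False \<cdot> u = b'"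
      by (simp add: all_bool_eq) metis
  qed (use c homsetD[OF f] homsetD[OF g] in auto)
  then show ?thesis using that by blast
qed

lemma pullbackD:
  assumes "is_pullback D f g F a b" and f: "f \<in> homset D x z" and g: "g \<in> homset D y z"
  shows "a \<in> homset D F x" "b \<in> homset D F y" "f \<cdot> a = g \<cdot> b"
    "u \<in> homset D w x \<Longrightarrow> v \<in> homset D w y \<Longrightarrow> f \<cdot> u = g \<cdot> v \<Longrightarrow>
      \<exists>t \<in> homset D w F. a \<cdot> t = u \<and> b \<cdot> t = v"
proof -
  have d: "Dom D f = x" "Dom D g = y" using homsetD[OF f] homsetD[OF g] by auto
  note pb = assms(1)[unfolded is_pullback_def d]
  show "a \<in> homset D F x" "b \<in> homset D F y" "f \<cdot> a = g \<cdot> b" using pb by auto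
  assume uv: "u \<in> homset D w x" "v \<in> homset D w y" "f \<cdot> u = g \<cdot> v"
  have "\<forall>w. \<forall>a' \<in> homset D w x. \<forall>b' \<in> homset D w y. f \<cdot> a' = g \<cdot> b' \<longrightarrow>
     (\<exists>!u. u \<in> homset D w F \<and> a \<cdot> u = a' \<and> b \<cdot> u = b')"
    using pb by (elim conjE)
  from this[rule_format, OF uv]
  show "\<exists>t \<in> homset D w F. a \<cdot> t = u \<and> b \<cdot> t = v" by blast
qed

lemma prd_product:
  assumes "small TYPE('u) I" "\<forall>i \<in> I. A i \<in> Obj D"
  shows "is_product D I (restrict A I) (prd D I A) (prj D I A)"
  unfolding prd_def prj_def prod_cone_def
  by (rule someI_ex) (rule has_product, use assms in auto)

lemma prd_cong: "(\<And>i. i \<in> I \<Longrightarrow> A i = B i) \<Longrightarrow> prd D I A = prd D I B"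
  "(\<And>i. i \<in> I \<Longrightarrow> A i = B i) \<Longrightarrow> prj D I A = prj D I B"
proof -
  assume "\<And>i. i \<in> I \<Longrightarrow> A i = B i"
  then have "restrict A I = restrict B I" by auto
  then show "prd D I A = prd D I B" "prj D I A = prj D I B"
    by (simp_all add: prd_def prj_def prod_cone_def)
qed

context
  fixes I :: "'i set" and A
  assumes I: "small TYPE('u) I" and A: "\<forall>i \<in> I. A i \<in> Obj D"
begin

lemma prd_obj: "prd D I A \<in> Obj D"
  using prd_product[of I A] I A unfolding is_product_def by blast

lemma prj_hom: "i \<in> I \<Longrightarrow> prj D I A i \<in> homset D (prd D I A) (A i)"
  using prd_product[of I A] I A unfolding is_product_def by auto

lemma prd_ex1:
  assumes f: "\<forall>i \<in> I. f i \<in> homset D w (A i)" and w: "w \<in> Obj D"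
  shows "\<exists>!u. u \<in> homset D w (prd D I A) \<and> (\<forall>i\<in>I. prj D I A i \<cdot> u = f i)"
proof -
  have "\<forall>i\<in>I. f i \<in> homset D w (restrict A I i)" using f by auto
  then show ?thesis
    using prd_product[of I A] I A w unfolding is_product_def by blast
qed

lemma tuple_props:
  assumes f: "\<forall>i \<in> I. f i \<in> homset D w (A i)" and w: "w \<in> Obj D"
  shows "tuple D I w f \<in> homset D w (prd D I A)"
    "i \<in> I \<Longrightarrow> prj D I A i \<cdot> tuple D I w f = f i"
proof -
  have *: "prd D I (\<lambda>i. Cod D (f i)) = prd D I A" "prj D I (\<lambda>i. Cod D (f i)) = prj D I A"
    using prd_cong[of I "\<lambda>i. Cod D (f i)" A] f homsetD by metis+
  have "tuple D I w f \<in> homset D w (prd D I A) \<and> (\<forall>i\<in>I. prj D I A i \<cdot> tuple D I w f = f i)"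
    unfolding tuple_def * by (rule theI') (rule prd_ex1[OF assms])
  then show "tuple D I w f \<in> homset D w (prd D I A)"
    "i \<in> I \<Longrightarrow> prj D I A i \<cdot> tuple D I w f = f i" by auto
qed

lemma prd_eqI:
  assumes u: "u \<in> homset D w (prd D I A)" and v: "v \<in> homset D w (prd D I A)"
    and eq: "\<forall>i \<in> I. prj D I A i \<cdot> u = prj D I A i \<cdot> v"
  shows "u = v"
proof -
  have "\<exists>!u. u \<in> homset D w (prd D I A) \<and> (\<forall>i\<in>I. prj D I A i \<cdot> u = prj D I A i \<cdot> v)"
    by (rule prd_ex1) (use comp_hom[OF v prj_hom] hom_obj[OF v] in auto)
  then show ?thesis using u v eq by blast
qed

end

lemma prod_map_props:
  assumes I: "small TYPE('u) I" and f: "\<forall>i \<in> I. f i \<in> homset D (A i) (B i)"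
  shows "prod_map D I f \<in> homset D (prd D I A) (prd D I B)"
    "i \<in> I \<Longrightarrow> prj D I B i \<cdot> prod_map D I f = f i \<cdot> prj D I A i"
proof -
  have *: "prd D I (\<lambda>i. Dom D (f i)) = prd D I A" "prj D I (\<lambda>i. Dom D (f i)) = prj D I A"
    using prd_cong[of I "\<lambda>i. Dom D (f i)" A] f homsetD by metis+
  have A: "\<forall>i \<in> I. A i \<in> Obj D" and B: "\<forall>i \<in> I. B i \<in> Obj D" using f hom_obj by blast+
  have h: "\<forall>i \<in> I. f i \<cdot> prj D I A i \<in> homset D (prd D I A) (B i)"
    using prj_hom[OF I A] comp_hom f by blast
  show "prod_map D I f \<in> homset D (prd D I A) (prd D I B)"
    unfolding prod_map_def * by (rule tuple_props(1)[OF I B h]) (use prd_obj[OF I A] in auto)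
  show "i \<in> I \<Longrightarrow> prj D I B i \<cdot> prod_map D I f = f i \<cdot> prj D I A i"
    unfolding prod_map_def * by (rule tuple_props(2)[OF I B h]) (use prd_obj[OF I A] in auto)
qed

lemma small_bool: "small TYPE('u) (UNIV :: bool set)"
  by (rule small_finite) simp

lemma prd2_props:
  assumes "x \<in> Obj D" "y \<in> Obj D"
  shows "prd2 D x y \<in> Obj D" "prj1 D x y \<in> homset D (prd2 D x y) x"
    "prj2 D x y \<in> homset D (prd2 D x y) y"
proof -
  have A: "\<forall>i\<in>UNIV. case_bool x y i \<in> Obj D" using assms by (auto split: bool.splits)
  show "prd2 D x y \<in> Obj D" "prj1 D x y \<in> homset D (prd2 D x y) x"
    "prj2 D x y \<in> homset D (prd2 D x y) y"
    using prd_obj[OF small_bool A] prj_hom[OF small_bool A, of True] prj_hom[OF small_bool A, of False]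
    by (auto simp: prd2_def prj1_def prj2_def)
qed

lemma pairing_props:
  assumes f: "f \<in> homset D w x" and g: "g \<in> homset D w y"
  shows "pairing D f g \<in> homset D w (prd2 D x y)"
    "prj1 D x y \<cdot> pairing D f g = f" "prj2 D x y \<cdot> pairing D f g = g"
proof -
  have A: "\<forall>i\<in>UNIV. case_bool x y i \<in> Obj D"
    using hom_obj[OF f] hom_obj[OF g] by (auto split: bool.splits)
  have h: "\<forall>i\<in>UNIV. case_bool f g i \<in> homset D w (case_bool x y i)"
    using f g by (auto split: bool.splits)
  have w: "w \<in> Obj D" "Dom D f = w" using hom_obj[OF f] homsetD[OF f] by auto
  show "pairing D f g \<in> homset D w (prd2 D x y)"
    "prj1 D x y \<cdot> pairing D f g = f" "prj2 D x y \<cdot> pairing D f g = g"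
    using tuple_props(1)[OF small_bool A h w(1)]
      tuple_props(2)[OF small_bool A h w(1), of True]
      tuple_props(2)[OF small_bool A h w(1), of False]
    by (auto simp: prd2_def prj1_def prj2_def pairing_def w(2))
qed

lemma prd2_eqI:
  assumes u: "u \<in> homset D w (prd2 D x y)" and v: "v \<in> homset D w (prd2 D x y)"
    and o: "x \<in> Obj D" "y \<in> Obj D"
    and eq: "prj1 D x y \<cdot> u = prj1 D x y \<cdot> v" "prj2 D x y \<cdot> u = prj2 D x y \<cdot> v"
  shows "u = v"
proof -
  have A: "\<forall>i\<in>UNIV. case_bool x y i \<in> Obj D" using o by (auto split: bool.splits)
  show ?thesis
  proof (rule prd_eqI[OF small_bool A])
    show "u \<in> homset D w (prd D UNIV (case_bool x y))" "v \<in> homset D w (prd D UNIV (case_bool x y))"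
      using u v by (simp_all add: prd2_def)
    show "\<forall>i\<in>UNIV. prj D UNIV (case_bool x y) i \<cdot> u = prj D UNIV (case_bool x y) i \<cdot> v"
      using eq by (auto simp: prj1_def prj2_def all_bool_eq)
  qed
qed

lemma prod_map2_props:
  assumes f: "f \<in> homset D x x'" and g: "g \<in> homset D y y'"
  shows "prod_map2 D f g \<in> homset D (prd2 D x y) (prd2 D x' y')"
    "prj1 D x' y' \<cdot> prod_map2 D f g = f \<cdot> prj1 D x y"
    "prj2 D x' y' \<cdot> prod_map2 D f g = g \<cdot> prj2 D x y"
proof -
  have o: "x \<in> Obj D" "y \<in> Obj D" using hom_obj[OF f] hom_obj[OF g] by auto
  have d: "Dom D f = x" "Dom D g = y" using homsetD[OF f] homsetD[OF g] by auto
  note h = comp_hom[OF prd2_props(2)[OF o] f] comp_hom[OF prd2_props(3)[OF o] g]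
  show "prod_map2 D f g \<in> homset D (prd2 D x y) (prd2 D x' y')"
    "prj1 D x' y' \<cdot> prod_map2 D f g = f \<cdot> prj1 D x y"
    "prj2 D x' y' \<cdot> prod_map2 D f g = g \<cdot> prj2 D x y"
    using pairing_props[OF h] by (simp_all add: prod_map2_def d)
qed

subsection \<open>The object of nets with a point\<close>

context
  fixes X and P :: "'p rel"
  assumes X: "X \<in> Obj D" and P: "small TYPE('u) (Field P)"
begin

lemma pow_obj: "pow D X P \<in> Obj D"
  unfolding pow_def using prd_obj[OF P, of "\<lambda>_. X"] X by simp

lemma pow_prj_hom: "p \<in> Field P \<Longrightarrow> pow_prj D X P p \<in> homset D (pow D X P) X"
  unfolding pow_def pow_prj_def using prj_hom[OF P, of "\<lambda>_. X"] X by simp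

lemma nets_obj: "nets D X P \<in> Obj D"
  unfolding nets_def using prd2_props(1)[OF pow_obj X] .

lemma net_of_hom: "net_of D X P \<in> homset D (nets D X P) (pow D X P)"
  unfolding nets_def net_of_def using prd2_props(2)[OF pow_obj X] .

lemma limit_of_hom: "limit_of D X P \<in> homset D (nets D X P) X"
  unfolding nets_def limit_of_def using prd2_props(3)[OF pow_obj X] .

lemma net_pt_hom: "p \<in> Field P \<Longrightarrow> pow_prj D X P p \<cdot> net_of D X P \<in> homset D (nets D X P) X"
  using comp_hom[OF net_of_hom pow_prj_hom] .

lemma nets_eqI:
  assumes u: "u \<in> homset D w (nets D X P)" and v: "v \<in> homset D w (nets D X P)"
    and pt: "\<forall>p \<in> Field P.
      (pow_prj D X P p \<cdot> net_of D X P) \<cdot> u = (pow_prj D X P p \<cdot> net_of D X P) \<cdot> v"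
    and lim: "limit_of D X P \<cdot> u = limit_of D X P \<cdot> v"
  shows "u = v"
proof (rule prd2_eqI[OF u[unfolded nets_def] v[unfolded nets_def] pow_obj X])
  show "prj2 D (pow D X P) X \<cdot> u = prj2 D (pow D X P) X \<cdot> v"
    using lim by (simp add: limit_of_def)
  have "net_of D X P \<cdot> u = net_of D X P \<cdot> v"
  proof (rule prd_eqI[OF P])
    show "net_of D X P \<cdot> u \<in> homset D w (prd D (Field P) (\<lambda>_. X))"
      "net_of D X P \<cdot> v \<in> homset D w (prd D (Field P) (\<lambda>_. X))"
      using comp_hom[OF u net_of_hom] comp_hom[OF v net_of_hom] by (simp_all add: pow_def)
    show "\<forall>p \<in> Field P. prj D (Field P) (\<lambda>_. X) p \<cdot> net_of D X P \<cdot> u =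
        prj D (Field P) (\<lambda>_. X) p \<cdot> net_of D X P \<cdot> v"
      using pt comp_assoc[OF u net_of_hom pow_prj_hom]
        comp_assoc[OF v net_of_hom pow_prj_hom] by (simp add: pow_prj_def)
  qed (use X in auto)
  then show "prj1 D (pow D X P) X \<cdot> u = prj1 D (pow D X P) X \<cdot> v" by (simp add: net_of_def)
qed

lemma net_tuple_props:
  assumes f: "\<forall>p \<in> Field P. f p \<in> homset D w X" and l: "l \<in> homset D w X"
  shows "net_tuple D P w f l \<in> homset D w (nets D X P)"
    "p \<in> Field P \<Longrightarrow> (pow_prj D X P p \<cdot> net_of D X P) \<cdot> net_tuple D P w f l = f p"
    "limit_of D X P \<cdot> net_tuple D P w f l = l"
proof -
  have w: "w \<in> Obj D" using hom_obj[OF l] by blast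
  have t: "tuple D (Field P) w f \<in> homset D w (pow D X P)"
    "p \<in> Field P \<Longrightarrow> pow_prj D X P p \<cdot> tuple D (Field P) w f = f p" for p
    using tuple_props[OF P, of "\<lambda>_. X" f w] X f w by (auto simp: pow_def pow_prj_def)
  show n: "net_tuple D P w f l \<in> homset D w (nets D X P)"
    using pairing_props(1)[OF t(1) l] by (simp add: net_tuple_def nets_def)
  have "net_of D X P \<cdot> net_tuple D P w f l = tuple D (Field P) w f"
    using pairing_props(2)[OF t(1) l] by (simp add: net_tuple_def net_of_def)
  then show "p \<in> Field P \<Longrightarrow> (pow_prj D X P p \<cdot> net_of D X P) \<cdot> net_tuple D P w f l = f p"
    using comp_assoc[OF n net_of_hom pow_prj_hom] t(2) by simp
  show "limit_of D X P \<cdot> net_tuple D P w f l = l"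
    using pairing_props(3)[OF t(1) l] by (simp add: net_tuple_def limit_of_def)
qed

end

text \<open>
  This covers both kinds of morphisms between objects of nets that occur in the definition of a
  topology: reindexing (where \<open>g\<close> is an identity) and applying a morphism to all members of a net
  (where \<open>k\<close> is an identity).
\<close>

lemma net_map_props:
  assumes X: "X \<in> Obj D" and Y: "Y \<in> Obj D"
    and P: "small TYPE('u) (Field P)" and Q: "small TYPE('u) (Field Q)"
    and r: "r \<in> homset D (pow D X P) (pow D Y Q)" and g: "g \<in> homset D X Y"
    and k: "\<forall>q \<in> Field Q. k q \<in> Field P"
    and rk: "\<forall>q \<in> Field Q. pow_prj D Y Q q \<cdot> r = g \<cdot> pow_prj D X P (k q)"
  shows "prod_map2 D r g \<in> homset D (nets D X P) (nets D Y Q)"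
    "q \<in> Field Q \<Longrightarrow> (pow_prj D Y Q q \<cdot> net_of D Y Q) \<cdot> prod_map2 D r g =
        g \<cdot> (pow_prj D X P (k q) \<cdot> net_of D X P)"
    "limit_of D Y Q \<cdot> prod_map2 D r g = g \<cdot> limit_of D X P"
proof -
  note m = prod_map2_props[OF r g]
  show "prod_map2 D r g \<in> homset D (nets D X P) (nets D Y Q)"
    "limit_of D Y Q \<cdot> prod_map2 D r g = g \<cdot> limit_of D X P"
    using m by (simp_all add: nets_def limit_of_def)
  assume q: "q \<in> Field Q"
  note [simp] = homsetD[OF pow_prj_hom[OF Y Q q]] homsetD[OF net_of_hom[OF Y Q]]
    homsetD[OF pow_prj_hom[OF X P k[rule_format, OF q]]] homsetD[OF net_of_hom[OF X P]] homsetD[OF r] homsetD[OF g]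
    homsetD[OF \<open>prod_map2 D r g \<in> homset D (nets D X P) (nets D Y Q)\<close>]
  have e: "net_of D Y Q \<cdot> prod_map2 D r g = r \<cdot> net_of D X P"
    using m(2) by (simp add: net_of_def)
  have "(pow_prj D Y Q q \<cdot> net_of D Y Q) \<cdot> prod_map2 D r g
      = pow_prj D Y Q q \<cdot> (r \<cdot> net_of D X P)"
    using e by (simp add: assoc_simp)
  also have "\<dots> = (g \<cdot> pow_prj D X P (k q)) \<cdot> net_of D X P"
    using rk q by (simp flip: assoc_simp)
  finally show "(pow_prj D Y Q q \<cdot> net_of D Y Q) \<cdot> prod_map2 D r g =
        g \<cdot> (pow_prj D X P (k q) \<cdot> net_of D X P)" by (simp add: assoc_simp)
qed

lemma reindex_props:
  assumes X: "X \<in> Obj D"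
    and P: "small TYPE('u) (Field P)" and Q: "small TYPE('u) (Field Q)"
    and h: "\<forall>q \<in> Field Q. h q \<in> Field P"
  shows "prod_map2 D (reindex D X Q P h) (Id D X) \<in> homset D (nets D X P) (nets D X Q)"
    "q \<in> Field Q \<Longrightarrow> (pow_prj D X Q q \<cdot> net_of D X Q) \<cdot> prod_map2 D (reindex D X Q P h) (Id D X) =
        pow_prj D X P (h q) \<cdot> net_of D X P"
    "limit_of D X Q \<cdot> prod_map2 D (reindex D X Q P h) (Id D X) = limit_of D X P"
proof -
  have t: "reindex D X Q P h \<in> homset D (pow D X P) (pow D X Q)"
    "q \<in> Field Q \<Longrightarrow> pow_prj D X Q q \<cdot> reindex D X Q P h = pow_prj D X P (h q)" for q
    using tuple_props[OF Q, of "\<lambda>_. X" "\<lambda>q. pow_prj D X P (h q)" "pow D X P"] X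
      pow_prj_hom[OF X P] h pow_obj[OF X P]
    by (auto simp: pow_def pow_prj_def reindex_def)
  have rk: "\<forall>q \<in> Field Q. pow_prj D X Q q \<cdot> reindex D X Q P h = Id D X \<cdot> pow_prj D X P (h q)"
    using t(2) id_left[OF pow_prj_hom[OF X P]] h by simp
  note m = net_map_props[OF X X P Q t(1) id_hom[OF X] h rk]
  show "prod_map2 D (reindex D X Q P h) (Id D X) \<in> homset D (nets D X P) (nets D X Q)"
    by (rule m(1))
  show "q \<in> Field Q \<Longrightarrow> (pow_prj D X Q q \<cdot> net_of D X Q) \<cdot> prod_map2 D (reindex D X Q P h) (Id D X) =
        pow_prj D X P (h q) \<cdot> net_of D X P"
    using m(2)[of q] id_left[OF net_pt_hom[OF X P]] h by simp
  show "limit_of D X Q \<cdot> prod_map2 D (reindex D X Q P h) (Id D X) = limit_of D X P"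
    using m(3) id_left[OF limit_of_hom[OF X P]] by simp
qed

end

section \<open>Internal topologies in terms of generalized elements\<close>

text \<open>
  The components of \<open>\<iota> P : C(P,X) \<rightarrow> X\<^sup>P \<times> X\<close>: the members of the universal convergent net and its limit.
\<close>

definition leg :: "('o, 'm) cat \<Rightarrow> 'o \<Rightarrow> ('u rel \<Rightarrow> 'm) \<Rightarrow> 'u rel \<Rightarrow> 'u \<Rightarrow> 'm" where
  "leg D X \<iota> P p = (pow_prj D X P p \<cdot>\<^bsub>D\<^esub> net_of D X P) \<cdot>\<^bsub>D\<^esub> \<iota> P"

definition limit_leg :: "('o, 'm) cat \<Rightarrow> 'o \<Rightarrow> ('u rel \<Rightarrow> 'm) \<Rightarrow> 'u rel \<Rightarrow> 'm" where
  "limit_leg D X \<iota> P = limit_of D X P \<cdot>\<^bsub>D\<^esub> \<iota> P"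

text \<open>
  The relation on generalized elements of \<open>X\<close> at stage \<open>w\<close> that is represented by \<open>C(P,X)\<close>: the net of
  elements \<open>f p : w \<rightarrow> X\<close> converges to \<open>l : w \<rightarrow> X\<close> if the morphism \<open>w \<rightarrow> X\<^sup>P \<times> X\<close> with these components
  factors through \<open>\<iota> P\<close>.
\<close>

definition converges :: "('o, 'm) cat \<Rightarrow> 'o \<Rightarrow> ('u rel \<Rightarrow> 'm) \<Rightarrow> 'o \<Rightarrow> 'u rel \<Rightarrow> ('u \<Rightarrow> 'm) \<Rightarrow> 'm \<Rightarrow> bool"
  where
  "converges D X \<iota> w P f l \<longleftrightarrow> (\<exists>u \<in> homset D w (Dom D (\<iota> P)).
     (\<forall>p \<in> Field P. leg D X \<iota> P p \<cdot>\<^bsub>D\<^esub> u = f p) \<and> limit_leg D X \<iota> P \<cdot>\<^bsub>D\<^esub> u = l)"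

locale net_family = complete_cat \<UU> D for \<UU> :: "'u itself" and D :: "('o, 'm) cat" (structure) +
  fixes X :: 'o and \<iota> :: "'u rel \<Rightarrow> 'm"
  assumes X: "X \<in> Obj D"
    and mon: "small_directed P \<Longrightarrow> monic D (\<iota> P)"
    and cod: "small_directed P \<Longrightarrow> Cod D (\<iota> P) = nets D X P"
begin

lemma iota_hom: "small_directed P \<Longrightarrow> \<iota> P \<in> homset D (Dom D (\<iota> P)) (nets D X P)"
  using mon[of P] cod[of P] by (auto simp: monic_def homset_def)

lemma leg_hom: "small_directed P \<Longrightarrow> p \<in> Field P \<Longrightarrow> leg D X \<iota> P p \<in> homset D (Dom D (\<iota> P)) X"
  unfolding leg_def using comp_hom[OF iota_hom net_pt_hom[OF X]] small_directedD(1) by blast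

lemma limit_leg_hom: "small_directed P \<Longrightarrow> limit_leg D X \<iota> P \<in> homset D (Dom D (\<iota> P)) X"
  unfolding limit_leg_def using comp_hom[OF iota_hom limit_of_hom[OF X]] small_directedD(1) by blast

lemma leg_comp:
  assumes P: "small_directed P" and u: "u \<in> homset D w (Dom D (\<iota> P))"
  shows "p \<in> Field P \<Longrightarrow> leg D X \<iota> P p \<cdot> u = (pow_prj D X P p \<cdot> net_of D X P) \<cdot> (\<iota> P \<cdot> u)"
    "limit_leg D X \<iota> P \<cdot> u = limit_of D X P \<cdot> (\<iota> P \<cdot> u)"
  unfolding leg_def limit_leg_def
  using comp_assoc[OF u iota_hom[OF P] net_pt_hom[OF X small_directedD(1)[OF P]]]
    comp_assoc[OF u iota_hom[OF P] limit_of_hom[OF X small_directedD(1)[OF P]]] by auto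

text \<open>
  Because \<open>\<iota> P\<close> maps into a product, factoring through it can be tested on components. This lemma
  translates each of the axioms, which are about factorizations, into statements about \<open>converges\<close>.
\<close>

lemma factors_iff:
  assumes P: "small_directed P" and m: "m \<in> homset D w (nets D X P)"
  shows "factors_through D m (\<iota> P) \<longleftrightarrow>
    converges D X \<iota> w P (\<lambda>p. (pow_prj D X P p \<cdot> net_of D X P) \<cdot> m) (limit_of D X P \<cdot> m)"
proof -
  have "factors_through D m (\<iota> P) \<longleftrightarrow> (\<exists>u \<in> homset D w (Dom D (\<iota> P)). \<iota> P \<cdot> u = m)"
    using homsetD[OF m] mon[OF P] cod[OF P] unfolding factors_through_def monic_def by auto
  also have "\<dots> \<longleftrightarrow> converges D X \<iota> w P (\<lambda>p. (pow_prj D X P p \<cdot> net_of D X P) \<cdot> m)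
      (limit_of D X P \<cdot> m)"
    unfolding converges_def
  proof (rule bex_cong[OF refl])
    fix u assume u: "u \<in> homset D w (Dom D (\<iota> P))"
    show "(\<iota> P \<cdot> u = m) =
       ((\<forall>p \<in> Field P. leg D X \<iota> P p \<cdot> u = (pow_prj D X P p \<cdot> net_of D X P) \<cdot> m) \<and>
        limit_leg D X \<iota> P \<cdot> u = limit_of D X P \<cdot> m)"
      using leg_comp[OF P u] nets_eqI[OF X small_directedD(1)[OF P] comp_hom[OF u iota_hom[OF P]] m]
      by (metis (lifting))
  qed
  finally show ?thesis .
qed

lemma converges_cong:
  "(\<And>p. p \<in> Field P \<Longrightarrow> f p = g p) \<Longrightarrow> l = m \<Longrightarrow>
    converges D X \<iota> w P f l = converges D X \<iota> w P g m"
  unfolding converges_def by auto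

lemma converges_iff_factors:
  assumes P: "small_directed P" and f: "\<forall>p \<in> Field P. f p \<in> homset D w X"
    and l: "l \<in> homset D w X"
  shows "converges D X \<iota> w P f l \<longleftrightarrow> factors_through D (net_tuple D P w f l) (\<iota> P)"
proof -
  note t = net_tuple_props[OF X small_directedD(1)[OF P] f l]
  show ?thesis
    unfolding factors_iff[OF P t(1)] t(3) using t(2) by (intro converges_cong) simp_all
qed

lemma converges_hom:
  assumes P: "small_directed P" and c: "converges D X \<iota> w P f l"
  shows "p \<in> Field P \<Longrightarrow> f p \<in> homset D w X" "l \<in> homset D w X"
  using c comp_hom[OF _ leg_hom[OF P]] comp_hom[OF _ limit_leg_hom[OF P]]
  unfolding converges_def by (metis, metis)

lemma converges_comp:
  assumes P: "small_directed P" and c: "converges D X \<iota> w P f l" and v: "v \<in> homset D w' w"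
  shows "converges D X \<iota> w' P (\<lambda>p. f p \<cdot> v) (l \<cdot> v)"
proof -
  obtain u where u: "u \<in> homset D w (Dom D (\<iota> P))"
    "\<And>p. p \<in> Field P \<Longrightarrow> leg D X \<iota> P p \<cdot> u = f p" "limit_leg D X \<iota> P \<cdot> u = l"
    using c unfolding converges_def by blast
  have "leg D X \<iota> P p \<cdot> u \<cdot> v = f p \<cdot> v" if "p \<in> Field P" for p
    using u(2)[OF that] comp_assoc[OF v u(1) leg_hom[OF P that]] by simp
  moreover have "limit_leg D X \<iota> P \<cdot> u \<cdot> v = l \<cdot> v"
    using u(3) comp_assoc[OF v u(1) limit_leg_hom[OF P]] by simp
  ultimately show ?thesis
    using comp_hom[OF v u(1)] unfolding converges_def by blast
qed

text \<open>
  It suffices to test the generic element, the identity of \<open>X\<close>; this is the Yoneda lemma.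
\<close>

lemma constant_nets_iff:
  "constant_nets D X \<iota> \<longleftrightarrow> (\<forall>w \<in> Obj D. \<forall>P l. small_directed P \<longrightarrow> l \<in> homset D w X \<longrightarrow>
     converges D X \<iota> w P (\<lambda>_. l) l)"
proof -
  have *: "factors_through D (net_tuple D P X (\<lambda>_. Id D X) (Id D X)) (\<iota> P) \<longleftrightarrow>
      converges D X \<iota> X P (\<lambda>_. Id D X) (Id D X)" if "small_directed P" for P
    using converges_iff_factors[OF that, of "\<lambda>_. Id D X" X "Id D X"] id_hom[OF X] by simp
  have "converges D X \<iota> w P (\<lambda>_. l) l"
    if "converges D X \<iota> X P (\<lambda>_. Id D X) (Id D X)" "small_directed P" "l \<in> homset D w X" for w P l
    using converges_comp[OF that(2,1,3)] id_left[OF that(3)] by simp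
  then show ?thesis unfolding constant_nets_def using * X id_hom[OF X] by meson
qed

lemma cofinal_mapD: "cofinal_map Q P h \<Longrightarrow> \<forall>q \<in> Field Q. h q \<in> Field P"
  unfolding cofinal_map_def by auto

text \<open>
  Here the generic element is the universal convergent net, at stage \<open>C(P,X)\<close>.
\<close>

lemma subnets_iff:
  "subnets D X \<iota> \<longleftrightarrow> (\<forall>w \<in> Obj D. \<forall>P Q h f l. small_directed P \<longrightarrow> small_directed Q \<longrightarrow>
     cofinal_map Q P h \<longrightarrow> converges D X \<iota> w P f l \<longrightarrow> converges D X \<iota> w Q (\<lambda>q. f (h q)) l)"
proof -
  have *: "factors_through D (prod_map2 D (reindex D X Q P h) (Id D X) \<cdot> \<iota> P) (\<iota> Q) \<longleftrightarrow>
      converges D X \<iota> (Dom D (\<iota> P)) Q (\<lambda>q. leg D X \<iota> P (h q)) (limit_leg D X \<iota> P)"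
    if P: "small_directed P" and Q: "small_directed Q" and h: "cofinal_map Q P h" for P Q h
  proof -
    note sP = small_directedD(1)[OF P] and sQ = small_directedD(1)[OF Q]
    note r = reindex_props[OF X sP sQ cofinal_mapD[OF h]]
    have m: "prod_map2 D (reindex D X Q P h) (Id D X) \<cdot> \<iota> P \<in> homset D (Dom D (\<iota> P)) (nets D X Q)"
      using comp_hom[OF iota_hom[OF P] r(1)] .
    have "(pow_prj D X Q q \<cdot> net_of D X Q) \<cdot> prod_map2 D (reindex D X Q P h) (Id D X) \<cdot> \<iota> P
        = leg D X \<iota> P (h q)" if q: "q \<in> Field Q" for q
      using comp_assoc[OF iota_hom[OF P] r(1) net_pt_hom[OF X sQ q]] r(2)[OF q] by (simp add: leg_def)
    moreover have "limit_of D X Q \<cdot> prod_map2 D (reindex D X Q P h) (Id D X) \<cdot> \<iota> P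
        = limit_leg D X \<iota> P"
      using comp_assoc[OF iota_hom[OF P] r(1) limit_of_hom[OF X sQ]] r(3) by (simp add: limit_leg_def)
    ultimately show ?thesis unfolding factors_iff[OF Q m] by (simp cong: converges_cong)
  qed
  have 1: "converges D X \<iota> w Q (\<lambda>q. f (h q)) l"
    if P: "small_directed P" and Q: "small_directed Q" and h: "cofinal_map Q P h"
      and c: "converges D X \<iota> (Dom D (\<iota> P)) Q (\<lambda>q. leg D X \<iota> P (h q)) (limit_leg D X \<iota> P)"
      and f: "converges D X \<iota> w P f l" for P Q h w f l
  proof -
    obtain u where u: "u \<in> homset D w (Dom D (\<iota> P))"
      "\<And>p. p \<in> Field P \<Longrightarrow> leg D X \<iota> P p \<cdot> u = f p" "limit_leg D X \<iota> P \<cdot> u = l"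
      using f unfolding converges_def by blast
    show ?thesis
      using converges_comp[OF Q c u(1)] u(2,3) cofinal_mapD[OF h] by (simp cong: converges_cong)
  qed
  have 2: "converges D X \<iota> (Dom D (\<iota> P)) P (leg D X \<iota> P) (limit_leg D X \<iota> P)"
    if P: "small_directed P" for P
    using leg_hom[OF P] limit_leg_hom[OF P] hom_obj[OF limit_leg_hom[OF P]] id_hom id_right
    unfolding converges_def by (intro bexI[of _ "Id D (Dom D (\<iota> P))"]) fastforce+
  have 3: "Dom D (\<iota> P) \<in> Obj D" if "small_directed P" for P
    using hom_obj[OF iota_hom[OF that]] by blast
  show ?thesis
    unfolding subnets_def
  proof (intro iffI ballI allI impI)
    fix w P Q f l and h :: "'u \<Rightarrow> 'u"
    assume "\<forall>P Q h. small_directed P \<and> small_directed Q \<and> cofinal_map Q P h \<longrightarrow>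
         factors_through D (prod_map2 D (reindex D X Q P h) (Id D X) \<cdot> \<iota> P) (\<iota> Q)"
      and "small_directed P" "small_directed Q" "cofinal_map Q P h" "converges D X \<iota> w P f l"
    then show "converges D X \<iota> w Q (\<lambda>q. f (h q)) l" using * 1 by blast
  next
    fix P Q and h :: "'u \<Rightarrow> 'u"
    assume L: "\<forall>w \<in> Obj D. \<forall>P Q h f l. small_directed P \<longrightarrow> small_directed Q \<longrightarrow>
     cofinal_map Q P h \<longrightarrow> converges D X \<iota> w P f l \<longrightarrow> converges D X \<iota> w Q (\<lambda>q. f (h q)) l"
      and P: "small_directed P \<and> small_directed Q \<and> cofinal_map Q P h"
    then show "factors_through D (prod_map2 D (reindex D X Q P h) (Id D X) \<cdot> \<iota> P) (\<iota> Q)"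
      using *[of P Q h] L[rule_format, OF 3 _ _ _ 2] by blast
  qed
qed

lemma small_cofinal_subsets:
  assumes "small_directed (P :: 'u rel)"
  shows "small TYPE('u) (cofinal_subsets P)"
proof (rule small_subset)
  show "small TYPE('u) (Pow (Field P))" using small_Pow small_directedD(1)[OF assms] by blast
qed (auto simp: cofinal_subsets_def)

text \<open>
  A morphism into the fiber product in the locality axiom is a morphism \<open>m\<close> into \<open>X\<^sup>P \<times> X\<close>, that is,
  a net with a point, together with witnesses for the convergence of all the given subnets.
\<close>

lemma locality_data:
  assumes P: "small_directed (P :: 'u rel)"
    and R: "\<forall>Q \<in> cofinal_subsets P. small_directed (R Q)"
    and h: "\<forall>Q \<in> cofinal_subsets P. cofinal_map (R Q) (Restr P Q) (h Q)"
  defines "b1 \<equiv> prod_map D (cofinal_subsets P) (\<lambda>Q. \<iota> (R Q))"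
    and "b2 \<equiv> tuple D (cofinal_subsets P) (nets D X P)
            (\<lambda>Q. prod_map2 D (reindex D X (R Q) P (h Q)) (Id D X))"
    and "A \<equiv> \<lambda>Q. Dom D (\<iota> (R Q))" and "B \<equiv> \<lambda>Q. nets D X (R Q)"
  shows "b1 \<in> homset D (prd D (cofinal_subsets P) A) (prd D (cofinal_subsets P) B)"
    "b2 \<in> homset D (nets D X P) (prd D (cofinal_subsets P) B)"
    "\<forall>Q \<in> cofinal_subsets P. A Q \<in> Obj D"
    "u \<in> homset D w (prd D (cofinal_subsets P) A) \<Longrightarrow> m \<in> homset D w (nets D X P) \<Longrightarrow>
      b1 \<cdot> u = b2 \<cdot> m \<longleftrightarrow> (\<forall>Q \<in> cofinal_subsets P.
        (\<forall>r \<in> Field (R Q). leg D X \<iota> (R Q) r \<cdot> (prj D (cofinal_subsets P) A Q \<cdot> u)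
          = (pow_prj D X P (h Q r) \<cdot> net_of D X P) \<cdot> m) \<and>
        limit_leg D X \<iota> (R Q) \<cdot> (prj D (cofinal_subsets P) A Q \<cdot> u) = limit_of D X P \<cdot> m)"
    "Q \<in> cofinal_subsets P \<Longrightarrow> r \<in> Field (R Q) \<Longrightarrow> h Q r \<in> Field P"
proof -
  let ?I = "cofinal_subsets P"
  have I: "small TYPE('u) ?I" using small_cofinal_subsets[OF P] .
  note R' = R[rule_format]
  have hP: "\<forall>r \<in> Field (R Q). h Q r \<in> Field P" if "Q \<in> ?I" for Q
    using cofinal_mapD[OF h[rule_format, OF that]] that directed_Restr(2)[OF small_directedD(2)[OF P] that]
    unfolding cofinal_subsets_def by auto
  then show "Q \<in> cofinal_subsets P \<Longrightarrow> r \<in> Field (R Q) \<Longrightarrow> h Q r \<in> Field P" by blast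
  have A: "\<forall>Q \<in> ?I. A Q \<in> Obj D"
    unfolding A_def using hom_obj[OF iota_hom[OF R']] by blast
  then show "\<forall>Q \<in> ?I. A Q \<in> Obj D" .
  have B: "\<forall>Q \<in> ?I. B Q \<in> Obj D"
    unfolding B_def using nets_obj[OF X small_directedD(1)[OF R']] by blast
  have i: "\<forall>Q \<in> ?I. \<iota> (R Q) \<in> homset D (A Q) (B Q)"
    unfolding A_def B_def using iota_hom[OF R'] by blast
  note m1 = prod_map_props[OF I i, folded b1_def]
  note r = reindex_props[OF X small_directedD(1)[OF P] small_directedD(1)[OF R'] hP]
  have r1: "\<forall>Q \<in> ?I. prod_map2 D (reindex D X (R Q) P (h Q)) (Id D X) \<in> homset D (nets D X P) (B Q)"
    unfolding B_def using r(1) by blast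
  note m2 = tuple_props[OF I B r1 nets_obj[OF X small_directedD(1)[OF P]], folded b2_def]
  show b1: "b1 \<in> homset D (prd D ?I A) (prd D ?I B)" using m1(1) .
  show b2: "b2 \<in> homset D (nets D X P) (prd D ?I B)" using m2(1) .
  assume u: "u \<in> homset D w (prd D ?I A)" and m: "m \<in> homset D w (nets D X P)"
  have "b1 \<cdot> u = b2 \<cdot> m \<longleftrightarrow> (\<forall>Q \<in> ?I. prj D ?I B Q \<cdot> (b1 \<cdot> u) = prj D ?I B Q \<cdot> (b2 \<cdot> m))"
    using prd_eqI[OF I B comp_hom[OF u b1] comp_hom[OF m b2]] by auto
  also have "\<dots> \<longleftrightarrow> (\<forall>Q \<in> ?I.
        (\<forall>r \<in> Field (R Q). leg D X \<iota> (R Q) r \<cdot> (prj D ?I A Q \<cdot> u)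
          = (pow_prj D X P (h Q r) \<cdot> net_of D X P) \<cdot> m) \<and>
        limit_leg D X \<iota> (R Q) \<cdot> (prj D ?I A Q \<cdot> u) = limit_of D X P \<cdot> m)"
  proof (rule ball_cong[OF refl])
    fix Q assume Q: "Q \<in> ?I"
    note sRQ = small_directedD(1)[OF R'[OF Q]]
    have pB: "prj D ?I B Q \<in> homset D (prd D ?I B) (nets D X (R Q))"
      using prj_hom[OF I B Q] by (simp add: B_def)
    have pA: "prj D ?I A Q \<in> homset D (prd D ?I A) (Dom D (\<iota> (R Q)))"
      using prj_hom[OF I A Q] by (simp add: A_def)
    let ?u = "prj D ?I A Q \<cdot> u"
    have u': "?u \<in> homset D w (Dom D (\<iota> (R Q)))" using comp_hom[OF u pA] .
    have e1: "prj D ?I B Q \<cdot> (b1 \<cdot> u) = \<iota> (R Q) \<cdot> ?u"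
      using comp_assoc[OF u b1 pB] m1(2)[OF Q] comp_assoc[OF u pA iota_hom[OF R'[OF Q]]] by simp
    let ?r = "prod_map2 D (reindex D X (R Q) P (h Q)) (Id D X)"
    have rh: "?r \<in> homset D (nets D X P) (nets D X (R Q))" using r1[rule_format, OF Q] by (simp add: B_def)
    have e2: "prj D ?I B Q \<cdot> (b2 \<cdot> m) = ?r \<cdot> m"
      using comp_assoc[OF m b2 pB] m2(2)[OF Q] by simp
    have rm: "(pow_prj D X (R Q) q \<cdot> net_of D X (R Q)) \<cdot> (?r \<cdot> m)
        = (pow_prj D X P (h Q q) \<cdot> net_of D X P) \<cdot> m" if q: "q \<in> Field (R Q)" for q
      using comp_assoc[OF m rh net_pt_hom[OF X sRQ q]] r(2)[OF Q Q q] by simp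
    have rl: "limit_of D X (R Q) \<cdot> (?r \<cdot> m) = limit_of D X P \<cdot> m"
      using comp_assoc[OF m rh limit_of_hom[OF X sRQ]] r(3)[OF Q Q] by simp
    show "(prj D ?I B Q \<cdot> (b1 \<cdot> u) = prj D ?I B Q \<cdot> (b2 \<cdot> m)) =
       ((\<forall>r \<in> Field (R Q). leg D X \<iota> (R Q) r \<cdot> ?u = (pow_prj D X P (h Q r) \<cdot> net_of D X P) \<cdot> m) \<and>
        limit_leg D X \<iota> (R Q) \<cdot> ?u = limit_of D X P \<cdot> m)"
      unfolding e1 e2 using leg_comp[OF R'[OF Q] u'] rm rl
        nets_eqI[OF X sRQ comp_hom[OF u' iota_hom[OF R'[OF Q]]] comp_hom[OF m rh]] by metis
  qed
  finally show "b1 \<cdot> u = b2 \<cdot> m \<longleftrightarrow> (\<forall>Q \<in> ?I.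
        (\<forall>r \<in> Field (R Q). leg D X \<iota> (R Q) r \<cdot> (prj D ?I A Q \<cdot> u)
          = (pow_prj D X P (h Q r) \<cdot> net_of D X P) \<cdot> m) \<and>
        limit_leg D X \<iota> (R Q) \<cdot> (prj D ?I A Q \<cdot> u) = limit_of D X P \<cdot> m)" .
qed

text \<open>
  The generic element is now the one given by the fiber product. In the other direction a concrete
  net factors through a fiber product, which exists by completeness.
\<close>

lemma locality_iff:
  "locality D X \<iota> \<longleftrightarrow> (\<forall>w \<in> Obj D. \<forall>P R h f l. small_directed P \<longrightarrow>
     f ` Field P \<subseteq> homset D w X \<longrightarrow> l \<in> homset D w X \<longrightarrow>
     (\<forall>Q \<in> cofinal_subsets P. small_directed (R Q) \<and> cofinal_map (R Q) (Restr P Q) (h Q) \<and>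
        converges D X \<iota> w (R Q) (\<lambda>r. f (h Q r)) l) \<longrightarrow> converges D X \<iota> w P f l)" (is "_ \<longleftrightarrow> ?R")
proof
  assume L: "locality D X \<iota>"
  show ?R
  proof (intro ballI allI impI)
    fix w P f l and R :: "'u set \<Rightarrow> 'u rel" and h :: "'u set \<Rightarrow> 'u \<Rightarrow> 'u"
    assume w: "w \<in> Obj D" and P: "small_directed P" and f: "f ` Field P \<subseteq> homset D w X"
      and l: "l \<in> homset D w X"
      and RQ: "\<forall>Q \<in> cofinal_subsets P. small_directed (R Q) \<and> cofinal_map (R Q) (Restr P Q) (h Q) \<and>
        converges D X \<iota> w (R Q) (\<lambda>r. f (h Q r)) l"
    let ?I = "cofinal_subsets P" and ?A = "\<lambda>Q. Dom D (\<iota> (R Q))"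
    have R: "\<forall>Q \<in> ?I. small_directed (R Q)" and h: "\<forall>Q \<in> ?I. cofinal_map (R Q) (Restr P Q) (h Q)"
      using RQ by auto
    note d = locality_data[OF P R h]
    obtain F a b where pb: "is_pullback D (prod_map D ?I (\<lambda>Q. \<iota> (R Q)))
         (tuple D ?I (nets D X P) (\<lambda>Q. prod_map2 D (reindex D X (R Q) P (h Q)) (Id D X))) F a b"
      using pullback_exists[OF d(1,2)] by blast
    have "\<forall>Q\<in>?I. \<exists>u \<in> homset D w (?A Q). (\<forall>r \<in> Field (R Q). leg D X \<iota> (R Q) r \<cdot> u = f (h Q r)) \<and>
        limit_leg D X \<iota> (R Q) \<cdot> u = l"
      using RQ unfolding converges_def by simp
    then obtain u where u: "\<forall>Q \<in> ?I. u Q \<in> homset D w (?A Q)"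
      "\<And>Q r. Q \<in> ?I \<Longrightarrow> r \<in> Field (R Q) \<Longrightarrow> leg D X \<iota> (R Q) r \<cdot> u Q = f (h Q r)"
      "\<And>Q. Q \<in> ?I \<Longrightarrow> limit_leg D X \<iota> (R Q) \<cdot> u Q = l" by metis
    note t = tuple_props[OF small_cofinal_subsets[OF P] d(3) u(1) w]
    have fp: "\<forall>p \<in> Field P. f p \<in> homset D w X" using f by auto
    note n = net_tuple_props[OF X small_directedD(1)[OF P] fp l]
    have "prod_map D ?I (\<lambda>Q. \<iota> (R Q)) \<cdot> tuple D ?I w u = tuple D ?I (nets D X P)
        (\<lambda>Q. prod_map2 D (reindex D X (R Q) P (h Q)) (Id D X)) \<cdot> net_tuple D P w f l"
      unfolding d(4)[OF t(1) n(1)] using t(2) u(2,3) n(2,3) d(5) by simp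
    from pullbackD(4)[OF pb d(1,2) t(1) n(1) this]
    obtain v where v: "v \<in> homset D w F" "b \<cdot> v = net_tuple D P w f l" by blast
    have b: "b \<in> homset D F (nets D X P)" using pullbackD(2)[OF pb d(1,2)] .
    have "factors_through D b (\<iota> P)" using L pb RQ P unfolding locality_def by blast
    from converges_comp[OF P this[unfolded factors_iff[OF P b]] v(1)]
    show "converges D X \<iota> w P f l"
      using n(2,3) v(2) comp_assoc[OF v(1) b net_pt_hom[OF X small_directedD(1)[OF P]]]
        comp_assoc[OF v(1) b limit_of_hom[OF X small_directedD(1)[OF P]]]
      by (simp cong: converges_cong)
  qed
next
  assume R: ?R
  show "locality D X \<iota>"
    unfolding locality_def
  proof (intro allI impI)
    fix P F a b and R :: "'u set \<Rightarrow> 'u rel" and h :: "'u set \<Rightarrow> 'u \<Rightarrow> 'u"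
    assume PR: "small_directed P \<and> (\<forall>Q \<in> cofinal_subsets P. small_directed (R Q) \<and>
        cofinal_map (R Q) (Restr P Q) (h Q))"
      and pb: "is_pullback D (prod_map D (cofinal_subsets P) (\<lambda>Q. \<iota> (R Q)))
         (tuple D (cofinal_subsets P) (nets D X P)
            (\<lambda>Q. prod_map2 D (reindex D X (R Q) P (h Q)) (Id D X))) F a b"
    let ?I = "cofinal_subsets P" and ?A = "\<lambda>Q. Dom D (\<iota> (R Q))"
    have P: "small_directed P" and Rs: "\<forall>Q \<in> ?I. small_directed (R Q)"
      and h: "\<forall>Q \<in> ?I. cofinal_map (R Q) (Restr P Q) (h Q)" using PR by auto
    note d = locality_data[OF P Rs h]
    note ab = pullbackD[OF pb d(1,2)]
    have q: "\<forall>Q \<in> ?I.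
        (\<forall>r \<in> Field (R Q). leg D X \<iota> (R Q) r \<cdot> (prj D ?I ?A Q \<cdot> a)
          = (pow_prj D X P (h Q r) \<cdot> net_of D X P) \<cdot> b) \<and>
        limit_leg D X \<iota> (R Q) \<cdot> (prj D ?I ?A Q \<cdot> a) = limit_of D X P \<cdot> b"
      using d(4)[OF ab(1,2)] ab(3) by simp
    have "prj D ?I ?A Q \<cdot> a \<in> homset D F (?A Q)" if "Q \<in> ?I" for Q
      using comp_hom[OF ab(1) prj_hom[OF small_cofinal_subsets[OF P] d(3) that]] .
    then have "\<forall>Q \<in> ?I. converges D X \<iota> F (R Q)
        (\<lambda>r. (pow_prj D X P (h Q r) \<cdot> net_of D X P) \<cdot> b) (limit_of D X P \<cdot> b)"
      using q unfolding converges_def by blast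
    moreover have "(\<lambda>p. (pow_prj D X P p \<cdot> net_of D X P) \<cdot> b) ` Field P \<subseteq> homset D F X"
      using comp_hom[OF ab(2) net_pt_hom[OF X small_directedD(1)[OF P]]] by auto
    moreover have "limit_of D X P \<cdot> b \<in> homset D F X"
      using comp_hom[OF ab(2) limit_of_hom[OF X small_directedD(1)[OF P]]] .
    ultimately have "converges D X \<iota> F P (\<lambda>p. (pow_prj D X P p \<cdot> net_of D X P) \<cdot> b) (limit_of D X P \<cdot> b)"
      using R[rule_format, of F P "\<lambda>p. (pow_prj D X P p \<cdot> net_of D X P) \<cdot> b" "limit_of D X P \<cdot> b" R h]
        P Rs h hom_obj[OF ab(1)] by blast
    then show "factors_through D b (\<iota> P)" using factors_iff[OF P ab(2)] by blast
  qed
qed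

text \<open>
  A morphism into the fiber product in the iteration axiom is a convergent net together with, for each of its
  members, a net that converges to this member.
\<close>

lemma iteration_data:
  assumes P: "small_directed P" and Q_all: "\<forall>p \<in> Field P. small_directed (Q p)"
  defines "A \<equiv> prd D (Field P) (\<lambda>p. Dom D (\<iota> (Q p)))"
    and "pr \<equiv> prj D (Field P) (\<lambda>p. Dom D (\<iota> (Q p)))"
  defines "b1 \<equiv> tuple D (Field P) A (\<lambda>p. limit_of D X (Q p) \<cdot> \<iota> (Q p) \<cdot> pr p)"
    and "b2 \<equiv> net_of D X P \<cdot> \<iota> P"
  shows "b1 \<in> homset D A (pow D X P)" "b2 \<in> homset D (Dom D (\<iota> P)) (pow D X P)"
    "\<And>p. p \<in> Field P \<Longrightarrow> pr p \<in> homset D A (Dom D (\<iota> (Q p)))"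
    "u \<in> homset D w A \<Longrightarrow> m \<in> homset D w (Dom D (\<iota> P)) \<Longrightarrow>
      b1 \<cdot> u = b2 \<cdot> m \<longleftrightarrow>
        (\<forall>p \<in> Field P. limit_leg D X \<iota> (Q p) \<cdot> (pr p \<cdot> u) = leg D X \<iota> P p \<cdot> m)"
proof -
  note sP = small_directedD(1)[OF P] and Q = Q_all[rule_format]
  have o: "\<forall>p \<in> Field P. Dom D (\<iota> (Q p)) \<in> Obj D"
    using hom_obj[OF iota_hom[OF Q]] by blast
  have X': "\<forall>p \<in> Field P. X \<in> Obj D" using X by blast
  have A: "A \<in> Obj D" unfolding A_def by (rule prd_obj[OF sP o])
  have pr: "pr p \<in> homset D A (Dom D (\<iota> (Q p)))" if "p \<in> Field P" for p
    unfolding A_def pr_def using prj_hom[OF sP o that] .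
  then show "\<And>p. p \<in> Field P \<Longrightarrow> pr p \<in> homset D A (Dom D (\<iota> (Q p)))" .
  have lp: "limit_of D X (Q p) \<cdot> \<iota> (Q p) \<cdot> pr p = limit_leg D X \<iota> (Q p) \<cdot> pr p" if "p \<in> Field P" for p
    using comp_assoc[OF pr[OF that] iota_hom[OF Q[OF that]] limit_of_hom[OF X small_directedD(1)[OF Q[OF that]]]]
    by (simp add: limit_leg_def)
  have lh: "\<forall>p \<in> Field P. limit_of D X (Q p) \<cdot> \<iota> (Q p) \<cdot> pr p \<in> homset D A X"
    using comp_hom[OF pr limit_leg_hom[OF Q]] lp by simp
  note t = tuple_props[OF sP X' lh A, folded b1_def]
  show b1: "b1 \<in> homset D A (pow D X P)" using t(1) by (simp add: pow_def)
  show b2: "b2 \<in> homset D (Dom D (\<iota> P)) (pow D X P)"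
    unfolding b2_def using comp_hom[OF iota_hom[OF P] net_of_hom[OF X sP]] .
  assume u: "u \<in> homset D w A" and m: "m \<in> homset D w (Dom D (\<iota> P))"
  have "b1 \<cdot> u = b2 \<cdot> m \<longleftrightarrow>
      (\<forall>p \<in> Field P. pow_prj D X P p \<cdot> (b1 \<cdot> u) = pow_prj D X P p \<cdot> (b2 \<cdot> m))"
    using prd_eqI[OF sP X'] comp_hom[OF u b1] comp_hom[OF m b2]
    unfolding pow_def pow_prj_def by metis
  also have "\<dots> \<longleftrightarrow> (\<forall>p \<in> Field P. limit_leg D X \<iota> (Q p) \<cdot> (pr p \<cdot> u) = leg D X \<iota> P p \<cdot> m)"
  proof (rule ball_cong[OF refl])
    fix p assume p: "p \<in> Field P"
    have "pow_prj D X P p \<cdot> (b1 \<cdot> u) = limit_leg D X \<iota> (Q p) \<cdot> (pr p \<cdot> u)"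
      using comp_assoc[OF u b1 pow_prj_hom[OF X sP p]] t(2)[OF p] lp[OF p]
        comp_assoc[OF u pr[OF p] limit_leg_hom[OF Q[OF p]]] by (simp add: pow_prj_def)
    moreover have "pow_prj D X P p \<cdot> (b2 \<cdot> m) = leg D X \<iota> P p \<cdot> m"
      using comp_assoc[OF m b2 pow_prj_hom[OF X sP p]]
        comp_assoc[OF iota_hom[OF P] net_of_hom[OF X sP] pow_prj_hom[OF X sP p]]
      by (simp add: leg_def b2_def)
    ultimately show "(pow_prj D X P p \<cdot> (b1 \<cdot> u) = pow_prj D X P p \<cdot> (b2 \<cdot> m)) =
        (limit_leg D X \<iota> (Q p) \<cdot> (pr p \<cdot> u) = leg D X \<iota> P p \<cdot> m)" by simp
  qed
  finally show "b1 \<cdot> u = b2 \<cdot> m \<longleftrightarrow>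
        (\<forall>p \<in> Field P. limit_leg D X \<iota> (Q p) \<cdot> (pr p \<cdot> u) = leg D X \<iota> P p \<cdot> m)" .
qed

lemma order_isoD:
  assumes "order_iso S (iter_index P Q) \<phi>" "s \<in> Field S" "\<phi> s = (p, f)"
  shows "p \<in> Field P" "\<And>i. i \<in> Field P \<Longrightarrow> f i \<in> Field (Q i)"
proof -
  have "(p, f) \<in> Field (iter_index P Q)"
    using assms unfolding order_iso_def bij_betw_def by force
  then show "p \<in> Field P" "\<And>i. i \<in> Field P \<Longrightarrow> f i \<in> Field (Q i)"
    unfolding Field_def iter_index_def by auto
qed

lemma iteration_leg:
  assumes Q: "\<forall>p \<in> Field P. small_directed (Q p)"
    and S: "order_iso S (iter_index P Q) \<phi>" and s: "s \<in> Field S"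
    and a: "\<forall>p \<in> Field P. pr p \<cdot> a \<in> homset D G (Dom D (\<iota> (Q p)))"
  shows "(case \<phi> s of (p, f) \<Rightarrow> pow_prj D X (Q p) (f p) \<cdot> net_of D X (Q p) \<cdot> \<iota> (Q p) \<cdot> pr p \<cdot> a) =
    (case \<phi> s of (p, f) \<Rightarrow> leg D X \<iota> (Q p) (f p) \<cdot> (pr p \<cdot> a))"
proof -
  obtain p f where pf: "\<phi> s = (p, f)" by force
  note p = order_isoD[OF S s pf]
  note qq = Q[rule_format, OF p(1)] and fp = p(2)[OF p(1)]
  note sq = small_directedD(1)[OF qq]
  note w = a[rule_format, OF p(1)]
  show ?thesis
    using leg_comp(1)[OF qq w fp]
      comp_assoc[OF comp_hom[OF w iota_hom[OF qq]] net_of_hom[OF X sq] pow_prj_hom[OF X sq fp]]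
    by (simp add: pf)
qed

lemma iterations_iff:
  "iterations D X \<iota> \<longleftrightarrow> (\<forall>w \<in> Obj D. \<forall>P Q S \<phi> g l m. small_directed P \<longrightarrow>
     (\<forall>p \<in> Field P. small_directed (Q p)) \<longrightarrow>
     small_directed S \<longrightarrow> order_iso S (iter_index P Q) \<phi> \<longrightarrow>
     (\<forall>p \<in> Field P. converges D X \<iota> w (Q p) (g p) (l p)) \<longrightarrow> converges D X \<iota> w P l m \<longrightarrow>
     converges D X \<iota> w S (\<lambda>s. case \<phi> s of (p, f) \<Rightarrow> g p (f p)) m)" (is "_ \<longleftrightarrow> ?R")
proof
  assume L: "iterations D X \<iota>"
  show ?R
  proof (intro ballI allI impI)
    fix w P g l m and S :: "'u rel" and \<phi> and Q :: "'u \<Rightarrow> 'u rel"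
    assume w: "w \<in> Obj D" and P: "small_directed P" and Q: "\<forall>p \<in> Field P. small_directed (Q p)"
      and S: "small_directed S" and \<phi>: "order_iso S (iter_index P Q) \<phi>"
      and g: "\<forall>p \<in> Field P. converges D X \<iota> w (Q p) (g p) (l p)" and l: "converges D X \<iota> w P l m"
    let ?A = "prd D (Field P) (\<lambda>p. Dom D (\<iota> (Q p)))"
    let ?pr = "prj D (Field P) (\<lambda>p. Dom D (\<iota> (Q p)))"
    have Q': "\<And>p. p \<in> Field P \<Longrightarrow> small_directed (Q p)" using Q by blast
    note sP = small_directedD(1)[OF P] and sS = small_directedD(1)[OF S]
    note d = iteration_data[OF P Q]
    obtain G a b where pb: "is_pullback D
           (tuple D (Field P) ?A (\<lambda>p. limit_of D X (Q p) \<cdot> \<iota> (Q p) \<cdot> ?pr p))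
           (net_of D X P \<cdot> \<iota> P) G a b"
      using pullback_exists[OF d(1,2)] by blast
    note ab = pullbackD[OF pb d(1,2)]
    have "\<forall>p\<in>Field P. \<exists>u \<in> homset D w (Dom D (\<iota> (Q p))).
        (\<forall>q \<in> Field (Q p). leg D X \<iota> (Q p) q \<cdot> u = g p q) \<and> limit_leg D X \<iota> (Q p) \<cdot> u = l p"
      using g unfolding converges_def by simp
    then obtain u where u: "\<forall>p \<in> Field P. u p \<in> homset D w (Dom D (\<iota> (Q p)))"
      "\<And>p q. p \<in> Field P \<Longrightarrow> q \<in> Field (Q p) \<Longrightarrow> leg D X \<iota> (Q p) q \<cdot> u p = g p q"
      "\<And>p. p \<in> Field P \<Longrightarrow> limit_leg D X \<iota> (Q p) \<cdot> u p = l p" by metis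
    obtain v where v: "v \<in> homset D w (Dom D (\<iota> P))"
      "\<And>p. p \<in> Field P \<Longrightarrow> leg D X \<iota> P p \<cdot> v = l p" "limit_leg D X \<iota> P \<cdot> v = m"
      using l unfolding converges_def by blast
    have o: "\<forall>p \<in> Field P. Dom D (\<iota> (Q p)) \<in> Obj D"
      using hom_obj u(1) by blast
    note t = tuple_props[OF sP o u(1) w]
    have "tuple D (Field P) ?A (\<lambda>p. limit_of D X (Q p) \<cdot> \<iota> (Q p) \<cdot> ?pr p) \<cdot> tuple D (Field P) w u =
        (net_of D X P \<cdot> \<iota> P) \<cdot> v"
      unfolding d(4)[OF t(1) v(1)] using t(2) u(3) v(2) by simp
    from pullbackD(4)[OF pb d(1,2) t(1) v(1) this]
    obtain x where x: "x \<in> homset D w G" "a \<cdot> x = tuple D (Field P) w u" "b \<cdot> x = v" by blast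
    let ?f = "\<lambda>s. case \<phi> s of (p, f) \<Rightarrow>
      pow_prj D X (Q p) (f p) \<cdot> net_of D X (Q p) \<cdot> \<iota> (Q p) \<cdot> ?pr p \<cdot> a"
    let ?l = "limit_of D X P \<cdot> \<iota> P \<cdot> b"
    have pa: "\<forall>p \<in> Field P. ?pr p \<cdot> a \<in> homset D G (Dom D (\<iota> (Q p)))"
      using comp_hom[OF ab(1) d(3)] by simp
    note f_eq = iteration_leg[OF Q \<phi> _ pa]
    have l_eq: "?l = limit_leg D X \<iota> P \<cdot> b" using leg_comp(2)[OF P ab(2)] by simp
    have f: "\<forall>s \<in> Field S. ?f s \<in> homset D G X"
    proof
      fix s assume s: "s \<in> Field S"
      obtain p f where pf: "\<phi> s = (p, f)" by force
      note p = order_isoD[OF \<phi> s pf]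
      show "?f s \<in> homset D G X"
        using f_eq[OF s] comp_hom[OF pa[rule_format, OF p(1)] leg_hom[OF Q'[OF p(1)] p(2)[OF p(1)]]] by (simp add: pf)
    qed
    have lh: "?l \<in> homset D G X" using l_eq comp_hom[OF ab(2) limit_leg_hom[OF P]] by simp
    have "factors_through D (net_tuple D S G ?f ?l) (\<iota> S)"
      using L pb P Q S \<phi> unfolding iterations_def Let_def by blast
    then have "converges D X \<iota> G S ?f ?l" using converges_iff_factors[OF S f lh] by blast
    from converges_comp[OF S this x(1)]
    have "converges D X \<iota> w S (\<lambda>s. ?f s \<cdot> x) (?l \<cdot> x)" .
    moreover have "?l \<cdot> x = m"
      using l_eq x(3) v(3) comp_assoc[OF x(1) ab(2) limit_leg_hom[OF P]] by simp
    moreover have "?f s \<cdot> x = (case \<phi> s of (p, f) \<Rightarrow> g p (f p))" if s: "s \<in> Field S" for s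
    proof -
      obtain p f where pf: "\<phi> s = (p, f)" by force
      note p = order_isoD[OF \<phi> s pf]
      have "?f s \<cdot> x = leg D X \<iota> (Q p) (f p) \<cdot> ((?pr p \<cdot> a) \<cdot> x)"
        using f_eq[OF s] comp_assoc[OF x(1) pa[rule_format, OF p(1)] leg_hom[OF Q'[OF p(1)] p(2)[OF p(1)]]]
        by (simp add: pf)
      also have "(?pr p \<cdot> a) \<cdot> x = u p"
        using comp_assoc[OF x(1) ab(1) d(3)[OF p(1)]] x(2) t(2)[OF p(1)] by simp
      finally show ?thesis using u(2)[OF p(1) p(2)[OF p(1)]] by (simp add: pf)
    qed
    ultimately show "converges D X \<iota> w S (\<lambda>s. case \<phi> s of (p, f) \<Rightarrow> g p (f p)) m"
      by (simp cong: converges_cong)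
  qed
next
  assume R: ?R
  show "iterations D X \<iota>"
    unfolding iterations_def Let_def
  proof (intro allI impI)
    fix P \<phi> G a b and S :: "'u rel" and Q :: "'u \<Rightarrow> 'u rel"
    let ?A = "prd D (Field P) (\<lambda>p. Dom D (\<iota> (Q p)))"
    let ?pr = "prj D (Field P) (\<lambda>p. Dom D (\<iota> (Q p)))"
    assume PQ: "small_directed P \<and> (\<forall>p \<in> Field P. small_directed (Q p)) \<and>
       small_directed S \<and> order_iso S (iter_index P Q) \<phi>"
      and pb: "is_pullback D
           (tuple D (Field P) ?A (\<lambda>p. limit_of D X (Q p) \<cdot> \<iota> (Q p) \<cdot> ?pr p))
           (net_of D X P \<cdot> \<iota> P) G a b"
    have P: "small_directed P" and Q: "\<And>p. p \<in> Field P \<Longrightarrow> small_directed (Q p)"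
      and S: "small_directed S" and \<phi>: "order_iso S (iter_index P Q) \<phi>" using PQ by auto
    have PQ': "\<forall>p \<in> Field P. small_directed (Q p)" using Q by blast
    note d = iteration_data[OF P PQ']
    note ab = pullbackD[OF pb d(1,2)]
    let ?f = "\<lambda>s. case \<phi> s of (p, f) \<Rightarrow>
      pow_prj D X (Q p) (f p) \<cdot> net_of D X (Q p) \<cdot> \<iota> (Q p) \<cdot> ?pr p \<cdot> a"
    let ?l = "limit_of D X P \<cdot> \<iota> P \<cdot> b"
    have pa: "\<forall>p \<in> Field P. ?pr p \<cdot> a \<in> homset D G (Dom D (\<iota> (Q p)))"
      using comp_hom[OF ab(1) d(3)] by simp
    note f_eq = iteration_leg[OF PQ' \<phi> _ pa]
    have l_eq: "?l = limit_leg D X \<iota> P \<cdot> b" using leg_comp(2)[OF P ab(2)] by simp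
    have e: "limit_leg D X \<iota> (Q p) \<cdot> (?pr p \<cdot> a) = leg D X \<iota> P p \<cdot> b" if "p \<in> Field P" for p
      using d(4)[OF ab(1,2)] ab(3) that by simp
    have 1: "\<forall>p \<in> Field P. converges D X \<iota> G (Q p) (\<lambda>q. leg D X \<iota> (Q p) q \<cdot> (?pr p \<cdot> a))
        (leg D X \<iota> P p \<cdot> b)"
      using pa e unfolding converges_def by blast
    have 2: "converges D X \<iota> G P (\<lambda>p. leg D X \<iota> P p \<cdot> b) (limit_leg D X \<iota> P \<cdot> b)"
      using ab(2) unfolding converges_def by blast
    have "converges D X \<iota> G S (\<lambda>s. case \<phi> s of (p, f) \<Rightarrow> leg D X \<iota> (Q p) (f p) \<cdot> (?pr p \<cdot> a))
        (limit_leg D X \<iota> P \<cdot> b)"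
      using R[rule_format, OF _ P Q S \<phi>, of G "\<lambda>p q. leg D X \<iota> (Q p) q \<cdot> (?pr p \<cdot> a)"
          "\<lambda>p. leg D X \<iota> P p \<cdot> b" "limit_leg D X \<iota> P \<cdot> b"] 1 2 hom_obj[OF ab(1)] by blast
    then have c: "converges D X \<iota> G S ?f ?l"
      using f_eq l_eq by (simp cong: converges_cong)
    have "\<forall>s \<in> Field S. ?f s \<in> homset D G X" using converges_hom(1)[OF S c] by blast
    from converges_iff_factors[OF S this converges_hom(2)[OF S c]] c
    show "factors_through D (net_tuple D S G ?f ?l) (\<iota> S)" by blast
  qed
qed

text \<open>
  An internal topology is the same as a family of subobjects \<open>\<iota> P\<close> that represent a net convergence
  relation on each set of generalized elements of \<open>X\<close>. This is what reduces the theory of internal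
  topologies to that of topologies on sets.
\<close>

theorem topology_iff_net_convergence:
  assumes "\<iota> \<in> extensional {P. small_directed P}"
  shows "is_topology D X \<iota> \<longleftrightarrow>
    (\<forall>w \<in> Obj D. net_convergence (homset D w X) (converges D X \<iota> w))"
proof -
  have 1: "\<forall>w \<in> Obj D. \<forall>P f l. small_directed P \<longrightarrow> converges D X \<iota> w P f l \<longrightarrow>
      f ` Field P \<subseteq> homset D w X \<and> l \<in> homset D w X"
    using converges_hom by blast
  have 2: "\<forall>w \<in> Obj D. \<forall>P f g l. small_directed P \<longrightarrow> converges D X \<iota> w P f l \<longrightarrow>
      (\<forall>p \<in> Field P. f p = g p) \<longrightarrow> converges D X \<iota> w P g l"
    using converges_cong by blast
  have 3: "\<forall>P. small_directed P \<longrightarrow> monic D (\<iota> P) \<and> Cod D (\<iota> P) = nets D X P"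
    using mon cod by blast
  show ?thesis
    unfolding is_topology_def constant_nets_iff subnets_iff locality_iff iterations_iff
      net_convergence_def ball_conj_distrib
    by (intro iffI conjI; (elim conjE)?; (rule X assms 1 2 3 | assumption))
qed

end

lemma topology_net_family:
  "complete_cat U D \<Longrightarrow> is_topology D X \<iota> \<Longrightarrow> net_family U D X \<iota>"
  unfolding net_family_def net_family_axioms_def is_topology_def by blast

section \<open>The category of small topological spaces\<close>

text \<open>
  Arrows of \<open>TOP\<close> are extensional functions; restricting here makes any function that is continuous
  on the space usable.
\<close>

definition top_arr :: "'u topology \<Rightarrow> 'u topology \<Rightarrow> ('u \<Rightarrow> 'u) \<Rightarrow> 'u topology \<times> ('u \<Rightarrow> 'u) \<times> 'u topology"
  where "top_arr S T f = (S, restrict f (topspace S), T)"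

lemma TOP_Obj: "T \<in> Obj TOP \<longleftrightarrow> small TYPE('u) (topspace (T :: 'u topology))"
  by (simp add: TOP_def)

lemma TOP_homset:
  "homset TOP S T = {(S, f, T) | f. S \<in> Obj TOP \<and> T \<in> Obj TOP \<and> continuous_map S T f \<and>
     f \<in> extensional (topspace S)}"
  by (auto simp: homset_def TOP_def)

lemma continuous_map_in: "continuous_map S T f \<Longrightarrow> x \<in> topspace S \<Longrightarrow> f x \<in> topspace T"
  by (auto simp: continuous_map_def)

lemma top_arr_hom:
  "S \<in> Obj TOP \<Longrightarrow> T \<in> Obj TOP \<Longrightarrow> continuous_map S T f \<Longrightarrow> top_arr S T f \<in> homset TOP S T"
  by (auto simp: TOP_homset top_arr_def intro: continuous_map_eq)

lemma top_arrE:
  assumes "a \<in> homset TOP S T"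
  obtains f where "a = top_arr S T f" "continuous_map S T f" "S \<in> Obj TOP" "T \<in> Obj TOP"
proof -
  obtain f where "a = (S, f, T)" "S \<in> Obj TOP" "T \<in> Obj TOP" "continuous_map S T f"
    "f \<in> extensional (topspace S)" using assms unfolding TOP_homset by blast
  then show ?thesis by (intro that[of f]) (auto simp: top_arr_def extensional_restrict)
qed

lemma top_arr_cong: "(\<And>x. x \<in> topspace S \<Longrightarrow> f x = g x) \<Longrightarrow> top_arr S T f = top_arr S T g"
  by (auto simp: top_arr_def)

lemma top_arr_eqD: "top_arr S T f = top_arr S T g \<Longrightarrow> x \<in> topspace S \<Longrightarrow> f x = g x"
  unfolding top_arr_def by (metis fst_conv restrict_apply' snd_conv)

lemma top_arr_comp:
  "continuous_map S T f \<Longrightarrow> top_arr T W g \<cdot>\<^bsub>TOP\<^esub> top_arr S T f = top_arr S W (\<lambda>x. g (f x))"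
  by (auto simp: TOP_def top_arr_def compose_def continuous_map_def fun_eq_iff)

lemma TOP_Id: "Id TOP S = top_arr S S (\<lambda>x. x)"
  by (simp add: TOP_def top_arr_def)

lemma category_TOP: "category TOP"
proof (unfold_locales, goal_cases)
  case (1 f) then show ?case by (auto simp: TOP_def)
next
  case (2 x) then show ?case by (simp add: TOP_Id top_arr_hom)
next
  case (3 f x y g z)
  obtain f' where f: "f = top_arr x y f'" "continuous_map x y f'" "x \<in> Obj TOP"
    using 3(1) by (elim top_arrE)
  obtain g' where g: "g = top_arr y z g'" "continuous_map y z g'" "z \<in> Obj TOP"
    using 3(2) by (elim top_arrE)
  show ?case
    unfolding f(1) g(1) top_arr_comp[OF f(2)]
    by (rule top_arr_hom[OF f(3) g(3) continuous_map_compose[OF f(2) g(2), unfolded comp_def]])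
next
  case (4 f x y) then show ?case by (elim top_arrE) (simp add: TOP_Id top_arr_comp)
next
  case (5 f x y) then show ?case by (elim top_arrE) (simp add: TOP_Id top_arr_comp)
next
  case (6 f w x g y h z)
  obtain f' where f: "f = top_arr w x f'" "continuous_map w x f'" using 6(1) by (elim top_arrE)
  obtain g' where g: "g = top_arr x y g'" "continuous_map x y g'" using 6(2) by (elim top_arrE)
  obtain h' where h: "h = top_arr y z h'" using 6(3) by (elim top_arrE)
  show ?case
    unfolding f(1) g(1) h top_arr_comp[OF f(2)] top_arr_comp[OF g(2)]
      top_arr_comp[OF continuous_map_compose[OF f(2) g(2), unfolded comp_def]] ..
qed

lemma topspace_point_space: "topspace point_space = {undefined}"
  by (simp add: point_space_def)

lemma point_of_eq: "point_of T x = top_arr point_space T (\<lambda>_. x)"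
  by (simp add: point_of_def top_arr_def)

lemma point_of_inj: "point_of T x = point_of T y \<longleftrightarrow> x = y"
proof
  assume "point_of T x = point_of T y"
  from top_arr_eqD[OF this[unfolded point_of_eq], of undefined]
  show "x = y" by (simp add: topspace_point_space)
qed simp

lemma arr_point_of:
  "x \<in> topspace S \<Longrightarrow> top_arr S T f \<cdot>\<^bsub>TOP\<^esub> point_of S x = point_of T (f x)"
  unfolding point_of_eq by (rule top_arr_comp) (simp add: point_space_def)

lemma top_arr_eqI:
  assumes a: "a \<in> homset TOP S T" and b: "b \<in> homset TOP S T"
    and eq: "\<And>x. x \<in> topspace S \<Longrightarrow> a \<cdot>\<^bsub>TOP\<^esub> point_of S x = b \<cdot>\<^bsub>TOP\<^esub> point_of S x"
  shows "a = b"
proof -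
  obtain f g where f: "a = top_arr S T f" "b = top_arr S T g" using a b by (elim top_arrE)
  show ?thesis unfolding f
    by (rule top_arr_cong) (use eq in \<open>simp add: f arr_point_of point_of_inj\<close>)
qed

text \<open>
  Points outside the images of all the maps \<open>g\<close> with \<open>(S, g) \<in> K\<close> are isolated. To include them, the
  description of \<open>T\<close> as a colimit below adds the points of \<open>T\<close> to the domains of the maps.
\<close>

definition final_maps :: "'u topology \<Rightarrow> ('u topology \<times> ('u \<Rightarrow> 'u)) set \<Rightarrow> bool" where
  "final_maps T K \<longleftrightarrow> (\<forall>S g. (S, g) \<in> K \<longrightarrow> S \<in> Obj TOP \<and> continuous_map S T g) \<and>
     (\<forall>V. V \<subseteq> topspace T \<longrightarrow>
        (\<forall>S g. (S, g) \<in> K \<longrightarrow> openin S {s \<in> topspace S. g s \<in> V}) \<longrightarrow> openin T V)"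

definition net_maps :: "'u topology \<Rightarrow> ('u topology \<times> ('u \<Rightarrow> 'u)) set" where
  "net_maps T = {(net_space P, g) | P g. small_directed P \<and> continuous_map (net_space P) T g}"

context universe begin

lemma point_space_Obj: "point_space \<in> Obj (TOP :: ('u topology, _) cat)"
  by (simp add: TOP_Obj topspace_point_space small_finite)

lemma point_of_hom:
  "(T :: 'u topology) \<in> Obj TOP \<Longrightarrow> x \<in> topspace T \<Longrightarrow> point_of T x \<in> homset TOP point_space T"
  unfolding point_of_eq by (rule top_arr_hom[OF point_space_Obj]) auto

lemma point_homE:
  assumes "a \<in> homset TOP (point_space :: 'u topology) T"
  obtains x where "x \<in> topspace T" "a = point_of T x"
proof -
  obtain f where f: "a = top_arr point_space T f" "continuous_map point_space T f"
    using assms by (elim top_arrE)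
  have "a = point_of T (f undefined)"
    unfolding f point_of_eq by (rule top_arr_cong) (simp add: topspace_point_space)
  moreover have "f undefined \<in> topspace T"
    using continuous_map_in[OF f(2)] by (simp add: topspace_point_space)
  ultimately show ?thesis using that by blast
qed

lemma locally_small_TOP: "locally_small TYPE('u) (TOP :: ('u topology, _) cat)"
  unfolding locally_small_def
proof (intro ballI)
  fix S T :: "'u topology" assume S: "S \<in> Obj TOP" and T: "T \<in> Obj TOP"
  let ?F = "\<Pi>\<^sub>E x \<in> topspace S. topspace T"
  have "homset TOP S T \<subseteq> (\<lambda>f. (S, f, T)) ` ?F"
    by (auto simp: TOP_homset continuous_map_def PiE_def)
  moreover have "small TYPE('u) ?F"
    using small_PiE[of "topspace S" "\<lambda>_. topspace T"] S T by (simp add: TOP_Obj)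
  ultimately show "small TYPE('u) (homset TOP S T)" using small_subset[OF small_image] by blast
qed

subsection \<open>Cocompleteness\<close>

text \<open>
  The colimit is the quotient of the disjoint union of the spaces by the equivalence relation
  generated by the arrows of the diagram, with the final topology. The relation is described by
  functions instead of by generators: two points are identified if every function to \<open>'u\<close> that is
  constant along the arrows (\<open>compat\<close>) agrees on them. Every cocone provides such a function, so that
  cocones factor through the quotient, and no induction along zigzags is needed.
\<close>

lemma cocomplete_TOP: "cocomplete TYPE('u) (TOP :: ('u topology, _) cat)"
  unfolding cocomplete_def
proof (intro allI impI, elim conjE)
  fix J :: "('u, 'u) cat" and G :: "('u, 'u, 'u topology, _) ftr"
  assume J: "small_category J" and G: "is_functor J TOP G"
  let ?G = "\<lambda>i. topspace (fobj G i)"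
  define m where "m a = fst (snd (farr G a))" for a
  have farr_G: "farr G a = top_arr (fobj G i) (fobj G j) (m a)" "continuous_map (fobj G i) (fobj G j) (m a)"
    if "a \<in> homset J i j" for a i j
    using functorD(4)[OF G that] unfolding TOP_homset m_def top_arr_def
    by (auto simp: extensional_restrict)
  have GO: "fobj G i \<in> Obj TOP" if "i \<in> Obj J" for i using functorD(3)[OF G that] .
  define D where "D = Sigma (Obj J) ?G"
  have D: "small TYPE('u) D"
    unfolding D_def using J GO by (intro small_Sigma) (auto simp: small_category_def TOP_Obj)
  define compat :: "('u \<times> 'u \<Rightarrow> 'u) \<Rightarrow> bool" where
    "compat \<phi> \<longleftrightarrow> (\<forall>i j. \<forall>a \<in> homset J i j. \<forall>x \<in> ?G i. \<phi> (j, m a x) = \<phi> (i, x))" for \<phi>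
  define cls where "cls p = {q \<in> D. \<forall>\<phi>. compat \<phi> \<longrightarrow> \<phi> p = \<phi> q}" for p
  \<comment> \<open>Equivalence classes are coded by elements of \<open>'u\<close>, since objects of \<open>TOP\<close> are topologies on \<open>'u\<close>.\<close>
  obtain e :: "('u \<times> 'u) set \<Rightarrow> 'u" where e: "inj_on e (cls ` D)"
    using small_ex_inj[OF small_image[OF D]] .
  define k where "k i x = e (cls (i, x))" for i x
  define Q where "Q = e ` cls ` D"
  have k_in: "k i x \<in> Q" if "i \<in> Obj J" "x \<in> ?G i" for i x
    using that unfolding k_def Q_def D_def by auto
  have Q_ex: "\<exists>i \<in> Obj J. \<exists>x \<in> ?G i. z = k i x" if "z \<in> Q" for z
    using that unfolding k_def Q_def D_def by auto
  have k_eq: "\<phi> (i, x) = \<phi> (j, y)"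
    if "k i x = k j y" "compat \<phi>" "i \<in> Obj J" "x \<in> ?G i" "j \<in> Obj J" "y \<in> ?G j" for i x j y \<phi>
  proof -
    have d: "(i, x) \<in> D" "(j, y) \<in> D" using that by (auto simp: D_def)
    then have "cls (i, x) = cls (j, y)" using that(1) e unfolding k_def by (auto simp: inj_on_def)
    moreover have "(j, y) \<in> cls (j, y)" using d by (simp add: cls_def)
    ultimately show ?thesis using that(2) unfolding cls_def by blast
  qed
  have k_m: "k j (m a x) = k i x" if "a \<in> homset J i j" "x \<in> ?G i" for a i j x
  proof -
    have "\<phi> (j, m a x) = \<phi> (i, x)" if "compat \<phi>" for \<phi>
      using that \<open>a \<in> homset J i j\<close> \<open>x \<in> ?G i\<close> unfolding compat_def by blast
    then have "(\<forall>\<phi>. compat \<phi> \<longrightarrow> \<phi> (j, m a x) = \<phi> q) \<longleftrightarrow> (\<forall>\<phi>. compat \<phi> \<longrightarrow> \<phi> (i, x) = \<phi> q)" for q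
      by metis
    then have "cls (j, m a x) = cls (i, x)" unfolding cls_def by simp
    then show ?thesis by (simp add: k_def)
  qed
  define op where "op U \<longleftrightarrow> U \<subseteq> Q \<and> (\<forall>i \<in> Obj J. openin (fobj G i) {x \<in> ?G i. k i x \<in> U})" for U
  have "istopology op"
    unfolding istopology_def
  proof (intro conjI allI impI)
    fix U V assume U: "op U" and V: "op V"
    have "{x \<in> ?G i. k i x \<in> U \<inter> V} = {x \<in> ?G i. k i x \<in> U} \<inter> {x \<in> ?G i. k i x \<in> V}" for i
      by auto
    then show "op (U \<inter> V)" using U V unfolding op_def by auto
  next
    fix K assume K: "\<forall>U\<in>K. op U"
    have "{x \<in> ?G i. k i x \<in> \<Union>K} = (\<Union>U\<in>K. {x \<in> ?G i. k i x \<in> U})" for i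
      by auto
    then show "op (\<Union>K)" using K unfolding op_def by auto
  qed
  then have open_iff: "openin (topology op) = op" by (rule topology_inverse')
  let ?X = "topology op"
  have "op Q"
  proof -
    have "{x \<in> ?G i. k i x \<in> Q} = ?G i" if "i \<in> Obj J" for i using k_in[OF that] by auto
    then show ?thesis unfolding op_def by auto
  qed
  then have top: "topspace ?X = Q"
    unfolding topspace_def open_iff by (auto simp: op_def)
  have XO: "?X \<in> Obj TOP"
    using small_image[OF small_image[OF D]] by (simp add: TOP_Obj top Q_def)
  have k_cont: "continuous_map (fobj G i) ?X (k i)" if "i \<in> Obj J" for i
    using that k_in unfolding continuous_map_def top open_iff op_def by auto
  let ?\<kappa> = "\<lambda>i. top_arr (fobj G i) ?X (k i)"
  have "is_colimit J TOP G ?X ?\<kappa>"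
    unfolding is_colimit_def
  proof (intro conjI allI impI)
    have oJ: "i \<in> Obj J \<and> j \<in> Obj J" if "a \<in> homset J i j" for a i j
      using that functorD(1)[OF G] category.hom_obj by fast
    show "is_cocone J TOP G ?X ?\<kappa>"
      unfolding is_cocone_def
    proof (intro conjI XO ballI allI)
      show "?\<kappa> i \<in> homset TOP (fobj G i) ?X" if "i \<in> Obj J" for i
        using top_arr_hom[OF GO XO k_cont] that by blast
      fix i j a assume a: "a \<in> homset J i j"
      show "?\<kappa> j \<cdot>\<^bsub>TOP\<^esub> farr G a = ?\<kappa> i"
        unfolding farr_G(1)[OF a] top_arr_comp[OF farr_G(2)[OF a]]
        by (rule top_arr_cong) (rule k_m[OF a])
    qed
    fix Y \<mu> assume co: "is_cocone J TOP G Y \<mu>"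
    define n where "n i = fst (snd (\<mu> i))" for i
    have \<mu>: "\<mu> i = top_arr (fobj G i) Y (n i)" "continuous_map (fobj G i) Y (n i)" "Y \<in> Obj TOP"
      if "i \<in> Obj J" for i
      using co that unfolding is_cocone_def TOP_homset n_def top_arr_def
      by (auto simp: extensional_restrict)
    have YO: "Y \<in> Obj TOP" using co unfolding is_cocone_def by blast
    define \<phi> where "\<phi> = (\<lambda>(i, x). n i x)"
    have \<phi>: "compat \<phi>"
      unfolding compat_def
    proof (intro allI ballI)
      fix i j a x assume a: "a \<in> homset J i j" and x: "x \<in> ?G i"
      have "\<mu> j \<cdot>\<^bsub>TOP\<^esub> farr G a = \<mu> i" using co a unfolding is_cocone_def by blast
      then have "top_arr (fobj G i) Y (\<lambda>x. n j (m a x)) = top_arr (fobj G i) Y (n i)"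
        using \<mu>(1) oJ[OF a] farr_G(1)[OF a] top_arr_comp[OF farr_G(2)[OF a]] by simp
      from top_arr_eqD[OF this x] show "\<phi> (j, m a x) = \<phi> (i, x)" by (simp add: \<phi>_def)
    qed
    define u where "u z = (SOME y. \<exists>i \<in> Obj J. \<exists>x \<in> ?G i. z = k i x \<and> y = n i x)" for z
    have u: "u (k i x) = n i x" if "i \<in> Obj J" "x \<in> ?G i" for i x
      unfolding u_def
    proof (rule some_equality)
      show "\<exists>i'\<in>Obj J. \<exists>x'\<in>?G i'. k i x = k i' x' \<and> n i x = n i' x'" using that by blast
      fix y assume "\<exists>i'\<in>Obj J. \<exists>x'\<in>?G i'. k i x = k i' x' \<and> y = n i' x'"
      then obtain i' x' where y: "i' \<in> Obj J" "x' \<in> ?G i'" "k i x = k i' x'" "y = n i' x'" by blast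
      have "\<phi> (i, x) = \<phi> (i', x')" by (rule k_eq[OF y(3) \<phi> that y(1,2)])
      then show "y = n i x" using y(4) by (simp add: \<phi>_def)
    qed
    have u_cont: "continuous_map ?X Y u"
      unfolding continuous_map_def top open_iff
    proof (intro conjI allI impI)
      show "u \<in> Q \<rightarrow> topspace Y"
      proof
        fix z assume "z \<in> Q"
        then obtain i x where z: "i \<in> Obj J" "x \<in> ?G i" "z = k i x" using Q_ex by blast
        then show "u z \<in> topspace Y" using u[OF z(1,2)] continuous_map_in[OF \<mu>(2)[OF z(1)] z(2)] by simp
      qed
      fix V assume V: "openin Y V"
      have "{x \<in> ?G i. k i x \<in> {z \<in> Q. u z \<in> V}} = {x \<in> ?G i. n i x \<in> V}" if "i \<in> Obj J" for i
        using k_in[OF that] u[OF that] by auto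
      then show "op {z \<in> Q. u z \<in> V}"
        unfolding op_def using V \<mu>(2) by (auto simp: continuous_map_def)
    qed
    show "\<exists>!v. v \<in> homset TOP ?X Y \<and> (\<forall>i\<in>Obj J. v \<cdot>\<^bsub>TOP\<^esub> ?\<kappa> i = \<mu> i)"
    proof (rule ex1I[of _ "top_arr ?X Y u"], intro conjI ballI)
      show "top_arr ?X Y u \<in> homset TOP ?X Y" by (rule top_arr_hom[OF XO YO u_cont])
      fix i assume i: "i \<in> Obj J"
      show "top_arr ?X Y u \<cdot>\<^bsub>TOP\<^esub> ?\<kappa> i = \<mu> i"
        unfolding top_arr_comp[OF k_cont[OF i]] \<mu>(1)[OF i]
        by (rule top_arr_cong) (rule u[OF i])
    next
      fix v assume v: "v \<in> homset TOP ?X Y \<and> (\<forall>i\<in>Obj J. v \<cdot>\<^bsub>TOP\<^esub> ?\<kappa> i = \<mu> i)"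
      then obtain w where w: "v = top_arr ?X Y w" by (auto elim: top_arrE)
      show "v = top_arr ?X Y u"
        unfolding w
      proof (rule top_arr_cong)
        fix z assume "z \<in> topspace ?X"
        then obtain i x where z: "i \<in> Obj J" "x \<in> ?G i" "z = k i x" using Q_ex unfolding top by blast
        have "top_arr (fobj G i) Y (\<lambda>x. w (k i x)) = top_arr (fobj G i) Y (n i)"
          using v z(1) \<mu>(1) top_arr_comp[OF k_cont[OF z(1)]] unfolding w by metis
        from top_arr_eqD[OF this z(2)] show "w z = u z" using u[OF z(1,2)] z(3) by simp
      qed
    qed
  qed
  then show "\<exists>x \<kappa>. is_colimit J TOP G x \<kappa>" by blast
qed

subsection \<open>The spaces classifying convergent nets\<close>

lemma infpt_notin: "small_directed (P :: 'u rel) \<Longrightarrow> infpt P \<notin> Field P"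
  unfolding infpt_def using small_not_UNIV[OF small_directedD(1), of P]
  by (intro someI_ex[of "\<lambda>x. x \<notin> Field P"]) auto

lemma openin_net_space:
  assumes P: "small_directed (P :: 'u rel)"
  shows "openin (net_space P) U \<longleftrightarrow> U \<subseteq> insert (infpt P) (Field P) \<and>
     (infpt P \<in> U \<longrightarrow> tail_in P (\<lambda>p. p) U)"
proof -
  let ?op = "\<lambda>U. U \<subseteq> insert (infpt P) (Field P) \<and>
     (infpt P \<in> U \<longrightarrow> (\<exists>p \<in> Field P. \<forall>q. (p, q) \<in> P \<longrightarrow> q \<in> U))"
  have "istopology ?op"
    unfolding istopology_def
  proof (intro conjI allI impI)
    fix U V assume U: "?op U" and V: "?op V"
    then show "U \<inter> V \<subseteq> insert (infpt P) (Field P)" by blast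
    assume "infpt P \<in> U \<inter> V"
    then show "\<exists>p \<in> Field P. \<forall>q. (p, q) \<in> P \<longrightarrow> q \<in> U \<inter> V"
      using U V tail_in_Int[OF small_directedD(2)[OF P], of "\<lambda>p. p" U V] unfolding tail_in_def by blast
  next
    fix K assume K: "\<forall>U\<in>K. ?op U"
    then show "\<Union>K \<subseteq> insert (infpt P) (Field P)" by blast
    assume "infpt P \<in> \<Union>K"
    then show "\<exists>p \<in> Field P. \<forall>q. (p, q) \<in> P \<longrightarrow> q \<in> \<Union>K" using K by (metis Union_iff)
  qed
  then show ?thesis unfolding net_space_def tail_in_def by (simp add: topology_inverse')
qed

lemma topspace_net_space:
  assumes P: "small_directed (P :: 'u rel)"
  shows "topspace (net_space P) = insert (infpt P) (Field P)"
proof -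
  have "openin (net_space P) (insert (infpt P) (Field P))"
    unfolding openin_net_space[OF P] by (auto intro: tail_in_all small_directedD(2)[OF P])
  then show ?thesis
    using openin_net_space[OF P] openin_subset openin_topspace by (metis subset_antisym)
qed

lemma net_space_Obj: "small_directed (P :: 'u rel) \<Longrightarrow> net_space P \<in> Obj TOP"
  by (simp add: TOP_Obj topspace_net_space small_insert small_directedD(1))

text \<open>
  This is why \<open>net_space P\<close> is the universal example: it classifies convergent nets. The second
  version takes the net and its limit separately.
\<close>

lemma continuous_map_net_space:
  assumes P: "small_directed (P :: 'u rel)"
  shows "continuous_map (net_space P) T g \<longleftrightarrow> net_limit T P g (g (infpt P))"
proof -
  have "tail_in P (\<lambda>p. p) {x \<in> insert (infpt P) (Field P). g x \<in> U} \<longleftrightarrow> tail_in P g U" for U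
    unfolding tail_in_def by (auto dest: FieldI2)
  then show ?thesis
    unfolding continuous_map_def net_limit_def topspace_net_space[OF P] openin_net_space[OF P]
    by (auto simp: Pi_iff)
qed

lemma continuous_map_net_space':
  assumes P: "small_directed (P :: 'u rel)"
  shows "continuous_map (net_space P) T (f(infpt P := l)) \<longleftrightarrow> net_limit T P f l"
proof -
  have "net_limit T P (f(infpt P := l)) l \<longleftrightarrow> net_limit T P f l"
    using infpt_notin[OF P] unfolding net_limit_def tail_in_def
    by (intro conj_cong) (auto simp: image_iff, (metis FieldI2)+)
  then show ?thesis by (simp add: continuous_map_net_space[OF P])
qed

subsection \<open>Final families of maps\<close>

lemma final_mapsD:
  assumes "final_maps T K" "(S, g) \<in> K"
  shows "S \<in> Obj TOP" "continuous_map S T g"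
  using assms unfolding final_maps_def by auto

lemma final_maps_openI:
  assumes "final_maps T K" "V \<subseteq> topspace T"
    and "\<And>S g. (S, g) \<in> K \<Longrightarrow> openin S {s \<in> topspace S. g s \<in> V}"
  shows "openin T V"
  using assms unfolding final_maps_def by blast

lemma final_maps_continuous:
  fixes T :: "'u topology"
  assumes K: "final_maps T K" and h: "h ` topspace T \<subseteq> topspace W"
    and c: "\<And>S g. (S, g) \<in> K \<Longrightarrow> continuous_map S W (\<lambda>s. h (g s))"
  shows "continuous_map T W h"
  unfolding continuous_map_def
proof (intro conjI allI impI)
  show "h \<in> topspace T \<rightarrow> topspace W" using h by blast
  fix V assume V: "openin W V"
  have "openin S {s \<in> topspace S. g s \<in> {x \<in> topspace T. h x \<in> V}}" if Sg: "(S, g) \<in> K" for S g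
  proof -
    have "{s \<in> topspace S. g s \<in> {x \<in> topspace T. h x \<in> V}} = {s \<in> topspace S. h (g s) \<in> V}"
      using continuous_map_in[OF final_mapsD(2)[OF K Sg]] by auto
    then show ?thesis using c[OF Sg] V by (simp add: continuous_map_def)
  qed
  then show "openin T {x \<in> topspace T. h x \<in> V}"
    by (intro final_maps_openI[OF K]) auto
qed

text \<open>
  The key to all size questions: however large \<open>K\<close> is, a small part of it suffices, because it is
  enough to have one witness in \<open>K\<close> for each of the small number of subsets of \<open>T\<close> that are not open.
\<close>

lemma final_maps_small:
  fixes T :: "'u topology"
  assumes K: "final_maps T K" and T: "T \<in> Obj TOP"
  obtains K' where "K' \<subseteq> K" "small TYPE('u) K'" "final_maps T K'"
proof -
  let ?B = "{V. V \<subseteq> topspace T \<and> \<not> openin T V}"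
  have "\<forall>V \<in> ?B. \<exists>k. k \<in> K \<and> \<not> openin (fst k) {s \<in> topspace (fst k). snd k s \<in> V}"
  proof (rule ballI, rule ccontr)
    fix V assume V: "V \<in> ?B"
      and "\<nexists>k. k \<in> K \<and> \<not> openin (fst k) {s \<in> topspace (fst k). snd k s \<in> V}"
    then have "openin S {s \<in> topspace S. g s \<in> V}" if "(S, g) \<in> K" for S g
      using that by (metis fst_conv snd_conv)
    then have "openin T V" using V by (intro final_maps_openI[OF K]) auto
    then show False using V by blast
  qed
  from bchoice[OF this] obtain k where k: "\<forall>V \<in> ?B. k V \<in> K \<and>
      \<not> openin (fst (k V)) {s \<in> topspace (fst (k V)). snd (k V) s \<in> V}" ..
  have "small TYPE('u) (Pow (topspace T))" using T small_Pow by (simp add: TOP_Obj)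
  then have "small TYPE('u) ?B" by (rule small_subset) auto
  then have "small TYPE('u) (k ` ?B)" by (rule small_image)
  moreover have "k ` ?B \<subseteq> K" using k by auto
  moreover have "final_maps T (k ` ?B)"
    unfolding final_maps_def
  proof (intro conjI allI impI)
    show "S \<in> Obj TOP" "continuous_map S T g" if "(S, g) \<in> k ` ?B" for S g
      using final_mapsD[OF K subsetD[OF \<open>k ` ?B \<subseteq> K\<close> that]] by auto
    fix V assume V: "V \<subseteq> topspace T"
      and o: "\<forall>S g. (S, g) \<in> k ` ?B \<longrightarrow> openin S {s \<in> topspace S. g s \<in> V}"
    show "openin T V"
    proof (rule ccontr)
      assume "\<not> openin T V"
      then have V': "V \<in> ?B" using V by blast
      then have "openin (fst (k V)) {s \<in> topspace (fst (k V)). snd (k V) s \<in> V}"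
        using o[rule_format, of "fst (k V)" "snd (k V)"] by simp
      then show False using k V' by blast
    qed
  qed
  ultimately show ?thesis using that by blast
qed

text \<open>
  Convergent nets determine the topology. If \<open>V\<close> is not open, some \<open>l \<in> V\<close> has no neighbourhood inside
  \<open>V\<close>; choosing in each open neighbourhood of \<open>l\<close> a point outside \<open>V\<close> gives a net that converges
  to \<open>l\<close> and never meets \<open>V\<close>.
\<close>

lemma final_net_maps:
  fixes T :: "'u topology"
  assumes T: "T \<in> Obj TOP"
  shows "final_maps T (net_maps T)"
  unfolding final_maps_def
proof (intro conjI allI impI)
  show "S \<in> Obj TOP" "continuous_map S T g" if "(S, g) \<in> net_maps T" for S g
    using that unfolding net_maps_def using net_space_Obj by auto
  fix V assume V: "V \<subseteq> topspace T"
    and K: "\<forall>S g. (S, g) \<in> net_maps T \<longrightarrow> openin S {s \<in> topspace S. g s \<in> V}"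
  show "openin T V"
  proof (rule ccontr)
    assume "\<not> openin T V"
    then obtain l where l: "l \<in> V" and no: "\<And>W. openin T W \<Longrightarrow> l \<in> W \<Longrightarrow> \<not> W \<subseteq> V"
      unfolding openin_subopen[of T V] by blast
    define I where "I = {(W, W'). openin T W \<and> openin T W' \<and> l \<in> W' \<and> W' \<subseteq> W}"
    have F: "Field I = {W. openin T W \<and> l \<in> W}" unfolding I_def Field_def by auto
    have dir: "directed I"
    proof (rule directedI[of _ "topspace T"])
      show "topspace T \<in> Field I" using l V unfolding F by auto
      fix W W' assume "W \<in> Field I" "W' \<in> Field I"
      then show "\<exists>R. (W, R) \<in> I \<and> (W', R) \<in> I"
        unfolding F by (intro exI[of _ "W \<inter> W'"]) (auto simp: I_def)
    qed (auto simp: F, auto simp: I_def)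
    have "small TYPE('u) (Field I)"
    proof (rule small_subset)
      show "small TYPE('u) (Pow (topspace T))" using T by (simp add: TOP_Obj small_Pow)
      show "Field I \<subseteq> Pow (topspace T)" using openin_subset unfolding F by auto
    qed
    then obtain P :: "'u rel" and \<phi> where P: "small_directed P" "order_iso P I \<phi>"
      using small_directed_code[OF dir] by blast
    have \<phi>: "\<phi> p \<in> Field I" if "p \<in> Field P" for p
      using P(2) that unfolding order_iso_def bij_betw_def by blast
    have \<phi>': "\<phi> q \<subseteq> \<phi> p" if "(p, q) \<in> P" for p q
      using P(2) that FieldI1[OF that] FieldI2[OF that] unfolding order_iso_def I_def by blast
    have "\<forall>p \<in> Field P. \<exists>x. x \<in> \<phi> p \<and> x \<notin> V" using \<phi> no unfolding F by blast
    then obtain f where f: "\<forall>p \<in> Field P. f p \<in> \<phi> p \<and> f p \<notin> V" by metis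
    have "net_limit T P f l"
      unfolding net_limit_def
    proof (intro conjI allI impI)
      show "f ` Field P \<subseteq> topspace T"
      proof (rule image_subsetI)
        fix p assume p: "p \<in> Field P"
        then show "f p \<in> topspace T" using f \<phi>[OF p] openin_subset[of T "\<phi> p"] unfolding F by auto
      qed
      show "l \<in> topspace T" using l V by blast
      fix W assume W: "openin T W" "l \<in> W"
      then have "W \<in> \<phi> ` Field P" using P(2) F unfolding order_iso_def bij_betw_def by simp
      then obtain p where p: "p \<in> Field P" "\<phi> p = W" by blast
      have "f q \<in> W" if "(p, q) \<in> P" for q
        using f \<phi>'[OF that] p(2) FieldI2[OF that] by blast
      then show "tail_in P f W" using p(1) unfolding tail_in_def by blast
    qed
    then have "continuous_map (net_space P) T (f(infpt P := l))"
      by (simp only: continuous_map_net_space'[OF P(1)])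
    then have "(net_space P, f(infpt P := l)) \<in> net_maps T" using P(1) unfolding net_maps_def
      by (intro CollectI exI conjI) (rule refl)
    from K[rule_format, OF this]
    have "openin (net_space P) {s \<in> topspace (net_space P). (f(infpt P := l)) s \<in> V}" .
    then have "tail_in P (\<lambda>p. p) {s \<in> topspace (net_space P). (f(infpt P := l)) s \<in> V}"
      using l unfolding openin_net_space[OF P(1)] topspace_net_space[OF P(1)] by simp
    then obtain p where "p \<in> Field P" "(f(infpt P := l)) p \<in> V"
      using tail_in_nonempty[OF small_directedD(2)[OF P(1)]] by (metis (no_types, lifting) mem_Collect_eq)
    then show False using f infpt_notin[OF P(1)] by (auto split: if_splits)
  qed
qed

text \<open>
  The topologies on hom sets that are constructed below are not topologies on \<open>'u\<close>; this makes
  objects of \<open>TOP\<close> out of them.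
\<close>

lemma small_copy:
  assumes small: "small TYPE('u) (topspace \<tau>)"
  obtains R e d where "(R :: 'u topology) \<in> Obj TOP" "homeomorphic_maps \<tau> R e d"
proof -
  let ?H = "topspace \<tau>"
  obtain e :: "_ \<Rightarrow> 'u" where e: "inj_on e ?H" using small_ex_inj[OF small] .
  define d where "d = inv_into ?H e"
  have de: "d (e h) = h" if "h \<in> ?H" for h using e that by (simp add: d_def)
  define R where "R = pullback_topology (e ` ?H) d \<tau>"
  have d_in: "d x \<in> ?H" "e (d x) = x" if "x \<in> e ` ?H" for x using that de by auto
  have topR: "topspace R = e ` ?H"
    unfolding R_def topspace_pullback_topology using d_in by auto
  have d_cont: "continuous_map R \<tau> d"
    unfolding continuous_map_def topR
  proof (intro conjI allI impI)
    show "d \<in> e ` ?H \<rightarrow> ?H" using d_in by blast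
    fix V assume "openin \<tau> V"
    moreover have "{x \<in> e ` ?H. d x \<in> V} = d -` V \<inter> e ` ?H" by auto
    ultimately show "openin R {x \<in> e ` ?H. d x \<in> V}"
      unfolding R_def openin_pullback_topology by blast
  qed
  have e_cont: "continuous_map \<tau> R e"
    unfolding continuous_map_def topR
  proof (intro conjI allI impI)
    show "e \<in> ?H \<rightarrow> e ` ?H" by blast
    fix W assume "openin R W"
    then obtain V where V: "openin \<tau> V" "W = d -` V \<inter> e ` ?H"
      unfolding R_def openin_pullback_topology by blast
    have "V \<subseteq> ?H" using openin_subset[OF V(1)] by blast
    then have "{h \<in> ?H. e h \<in> W} = V" unfolding V(2) using de e by (auto simp: inj_on_def)
    then show "openin \<tau> {h \<in> ?H. e h \<in> W}" using V(1) by simp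
  qed
  have "homeomorphic_maps \<tau> R e d"
    unfolding homeomorphic_maps_def using d_cont e_cont de d_in(2) by (simp add: topR)
  moreover have "R \<in> Obj TOP" using small_image[OF small] by (simp add: TOP_Obj topR)
  ultimately show ?thesis using that by blast
qed

subsection \<open>Spaces as colimits of points and test spaces\<close>

lemma final_bip_diagram:
  fixes T :: "'u topology"
  assumes K: "final_maps T K" and T: "T \<in> Obj TOP"
  shows "bip_diagram TOP (topspace T) K (Sigma K (\<lambda>k. topspace (fst k))) (\<lambda>(k, s). snd k s) fst
     (\<lambda>_. point_space) fst (\<lambda>(k, s). point_of (fst k) s)"
  using continuous_map_in[OF final_mapsD(2)[OF K]] final_mapsD(1)[OF K] point_of_hom point_space_Obj
  by (intro bip_diagram.intro bip_diagram_axioms.intro category_TOP) auto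

text \<open>
  A space with the final topology with respect to \<open>K\<close> is the colimit of its points and of the domains
  of the maps in \<open>K\<close>, with an edge from the point \<open>g s\<close> to the domain \<open>S\<close> of \<open>g\<close> for every \<open>s\<close> in
  \<open>S\<close>. A cocone is the same as a function on \<open>T\<close> that becomes continuous on composing with all maps in \<open>K\<close>.
\<close>

lemma final_bip_colimit:
  fixes T :: "'u topology"
  assumes K: "final_maps T K" and T: "T \<in> Obj TOP"
  shows "bip_colimit TOP (topspace T) K (Sigma K (\<lambda>k. topspace (fst k))) (\<lambda>(k, s). snd k s) fst
     (\<lambda>_. point_space) fst (\<lambda>(k, s). point_of (fst k) s)
     T (point_of T) (\<lambda>k. top_arr (fst k) T (snd k))"
  unfolding bip_colimit_def
proof (intro conjI allI impI)
  interpret TOP: category TOP by (rule category_TOP)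
  show "bip_cocone TOP (topspace T) K (Sigma K (\<lambda>k. topspace (fst k))) (\<lambda>(k, s). snd k s) fst
     (\<lambda>_. point_space) fst (\<lambda>(k, s). point_of (fst k) s) T (point_of T) (\<lambda>k. top_arr (fst k) T (snd k))"
    unfolding bip_cocone_def
    using T point_of_hom[OF T] top_arr_hom[OF final_mapsD(1)[OF K] T final_mapsD(2)[OF K]] arr_point_of
    by auto
  fix Y \<alpha> \<beta>
  assume co: "bip_cocone TOP (topspace T) K (Sigma K (\<lambda>k. topspace (fst k))) (\<lambda>(k, s). snd k s) fst
     (\<lambda>_. point_space) fst (\<lambda>(k, s). point_of (fst k) s) Y \<alpha> \<beta>"
  have Y: "Y \<in> Obj TOP" using co unfolding bip_cocone_def by blast
  have co_edge: "\<forall>e \<in> Sigma K (\<lambda>k. topspace (fst k)). \<beta> (fst e) \<cdot>\<^bsub>TOP\<^esub>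
      (case e of (k, s) \<Rightarrow> point_of (fst k) s) = \<alpha> (case e of (k, s) \<Rightarrow> snd k s)"
    using co unfolding bip_cocone_def by (elim conjE)
  have "\<forall>t \<in> topspace T. \<exists>y. y \<in> topspace Y \<and> \<alpha> t = point_of Y y"
    using co point_homE unfolding bip_cocone_def by metis
  then obtain h where h: "\<forall>t \<in> topspace T. h t \<in> topspace Y \<and> \<alpha> t = point_of Y (h t)" by metis
  have \<beta>: "continuous_map S Y (\<lambda>s. h (g s))" "\<beta> (S, g) = top_arr S Y (\<lambda>s. h (g s))"
    if Sg: "(S, g) \<in> K" for S g
  proof -
    have "\<forall>b \<in> K. \<beta> b \<in> homset TOP (fst b) Y" using co unfolding bip_cocone_def by blast
    from bspec[OF this Sg] have "\<beta> (S, g) \<in> homset TOP S Y" by simp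
    then obtain b where b: "\<beta> (S, g) = top_arr S Y b" "continuous_map S Y b" by (elim top_arrE)
    have "b s = h (g s)" if s: "s \<in> topspace S" for s
    proof -
      have "\<beta> (S, g) \<cdot>\<^bsub>TOP\<^esub> point_of S s = \<alpha> (g s)"
        using bspec[OF co_edge, of "((S, g), s)"] Sg s by simp
      then have "point_of Y (b s) = point_of Y (h (g s))"
        using b(1) arr_point_of[OF s] h continuous_map_in[OF final_mapsD(2)[OF K Sg] s] by simp
      then show ?thesis by (simp add: point_of_inj)
    qed
    then show "continuous_map S Y (\<lambda>s. h (g s))" "\<beta> (S, g) = top_arr S Y (\<lambda>s. h (g s))"
      using b continuous_map_eq[of S Y b "\<lambda>s. h (g s)"] top_arr_cong[of S b] by metis+
  qed
  have h_cont: "continuous_map T Y h"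
    by (rule final_maps_continuous[OF K _ \<beta>(1)]) (use h in auto)
  show "\<exists>!u. u \<in> homset TOP T Y \<and> (\<forall>t\<in>topspace T. u \<cdot>\<^bsub>TOP\<^esub> point_of T t = \<alpha> t) \<and>
       (\<forall>k\<in>K. u \<cdot>\<^bsub>TOP\<^esub> top_arr (fst k) T (snd k) = \<beta> k)"
  proof (rule ex1I[of _ "top_arr T Y h"], intro conjI ballI)
    show "top_arr T Y h \<in> homset TOP T Y" by (rule top_arr_hom[OF T Y h_cont])
    show "top_arr T Y h \<cdot>\<^bsub>TOP\<^esub> point_of T t = \<alpha> t" if "t \<in> topspace T" for t
      using arr_point_of[OF that] h that by simp
    show "top_arr T Y h \<cdot>\<^bsub>TOP\<^esub> top_arr (fst k) T (snd k) = \<beta> k" if "k \<in> K" for k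
      using top_arr_comp[OF final_mapsD(2)[OF K, of "fst k" "snd k"]] \<beta>(2)[of "fst k" "snd k"] that by simp
    fix v assume "v \<in> homset TOP T Y \<and> (\<forall>t\<in>topspace T. v \<cdot>\<^bsub>TOP\<^esub> point_of T t = \<alpha> t) \<and>
       (\<forall>k\<in>K. v \<cdot>\<^bsub>TOP\<^esub> top_arr (fst k) T (snd k) = \<beta> k)"
    then show "v = top_arr T Y h"
      by (intro top_arr_eqI[OF _ top_arr_hom[OF T Y h_cont]]) (use h in \<open>auto simp: arr_point_of\<close>)
  qed
qed

lemma points_epi_diagram:
  fixes T :: "'u topology"
  assumes T: "T \<in> Obj TOP"
  shows "bip_diagram TOP (topspace T) (UNIV :: bool set) (topspace T \<times> UNIV) fst snd
     (\<lambda>_. point_space) (\<lambda>_. T) (\<lambda>(t, b). point_of T t)"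
  using T point_of_hom point_space_Obj category_TOP
  by (intro bip_diagram.intro bip_diagram_axioms.intro) auto

text \<open>
  The points of \<open>T\<close> are jointly epic. This is expressed by a colimit, two copies of \<open>T\<close> glued along
  all points, in order to be preserved by cocontinuous functors.
\<close>

lemma points_epi_colimit:
  fixes T :: "'u topology"
  assumes T: "T \<in> Obj TOP"
  shows "bip_colimit TOP (topspace T) (UNIV :: bool set) (topspace T \<times> UNIV) fst snd
     (\<lambda>_. point_space) (\<lambda>_. T) (\<lambda>(t, b). point_of T t) T (point_of T) (\<lambda>_. Id TOP T)"
  unfolding bip_colimit_def
proof (intro conjI allI impI)
  interpret TOP: category TOP by (rule category_TOP)
  show "bip_cocone TOP (topspace T) (UNIV :: bool set) (topspace T \<times> UNIV) fst snd
     (\<lambda>_. point_space) (\<lambda>_. T) (\<lambda>(t, b). point_of T t) T (point_of T) (\<lambda>_. Id TOP T)"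
    unfolding bip_cocone_def
    using T point_of_hom[OF T] TOP.id_hom[OF T] TOP.id_left[OF point_of_hom[OF T]] by auto
  fix Y \<alpha> \<beta>
  assume co: "bip_cocone TOP (topspace T) (UNIV :: bool set) (topspace T \<times> UNIV) fst snd
     (\<lambda>_. point_space) (\<lambda>_. T) (\<lambda>(t, b). point_of T t) Y \<alpha> \<beta>"
  have \<beta>: "\<beta> b \<in> homset TOP T Y" "\<And>t. t \<in> topspace T \<Longrightarrow> \<beta> b \<cdot>\<^bsub>TOP\<^esub> point_of T t = \<alpha> t" for b
    using co unfolding bip_cocone_def by auto
  have eq: "\<beta> b = \<beta> True" for b
    by (rule top_arr_eqI[OF \<beta>(1) \<beta>(1)]) (simp add: \<beta>(2))
  show "\<exists>!u. u \<in> homset TOP T Y \<and> (\<forall>t\<in>topspace T. u \<cdot>\<^bsub>TOP\<^esub> point_of T t = \<alpha> t) \<and>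
       (\<forall>b\<in>UNIV. u \<cdot>\<^bsub>TOP\<^esub> Id TOP T = \<beta> b)"
  proof (rule ex1I[of _ "\<beta> True"], intro conjI ballI)
    show "\<beta> True \<cdot>\<^bsub>TOP\<^esub> Id TOP T = \<beta> b" for b using TOP.id_right[OF \<beta>(1)] eq by metis
    fix v assume "v \<in> homset TOP T Y \<and> (\<forall>t\<in>topspace T. v \<cdot>\<^bsub>TOP\<^esub> point_of T t = \<alpha> t) \<and>
       (\<forall>b\<in>UNIV. v \<cdot>\<^bsub>TOP\<^esub> Id TOP T = \<beta> b)"
    then show "v = \<beta> True" using TOP.id_right by (metis UNIV_I)
  qed (use \<beta> in auto)
qed

end

section \<open>Categories of internal spaces\<close>

text \<open>
  Morphisms of internal spaces as they act on generalized elements.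
\<close>

definition continuous_arr where
  "continuous_arr D X \<iota> f Y \<kappa> \<longleftrightarrow> (\<forall>w \<in> Obj D. \<forall>P g l. small_directed P \<longrightarrow>
     converges D X \<iota> w P g l \<longrightarrow> converges D Y \<kappa> w P (\<lambda>p. f \<cdot>\<^bsub>D\<^esub> g p) (f \<cdot>\<^bsub>D\<^esub> l))"

context complete_cat begin

text \<open>
  Again it is enough to consider the universal convergent net, at the stage \<open>Dom D (\<iota> P)\<close>.
\<close>

lemma continuous_arr_iff:
  fixes \<iota> \<kappa> :: "'u rel \<Rightarrow> 'm"
  assumes "net_family \<UU> D X \<iota>" "net_family \<UU> D Y \<kappa>" and f: "f \<in> homset D X Y"
  shows "(\<forall>P. small_directed P \<longrightarrow>
      factors_through D (prod_map2 D (prod_map D (Field P) (\<lambda>_. f)) f \<cdot> \<iota> P) (\<kappa> P)) \<longleftrightarrow>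
    continuous_arr D X \<iota> f Y \<kappa>"
proof -
  interpret X: net_family \<UU> D X \<iota> by fact
  interpret Y: net_family \<UU> D Y \<kappa> by fact
  have *: "factors_through D (prod_map2 D (prod_map D (Field P) (\<lambda>_. f)) f \<cdot> \<iota> P) (\<kappa> P) \<longleftrightarrow>
      converges D Y \<kappa> (Dom D (\<iota> P)) P (\<lambda>p. f \<cdot> leg D X \<iota> P p) (f \<cdot> limit_leg D X \<iota> P)"
    if P: "small_directed P" for P
  proof -
    note sP = small_directedD(1)[OF P]
    have "\<forall>p\<in>Field P. f \<in> homset D X Y" using f by blast
    note pm = prod_map_props[OF sP this]
    have r: "prod_map D (Field P) (\<lambda>_. f) \<in> homset D (pow D X P) (pow D Y P)"
      using pm(1) by (simp add: pow_def)
    have rk: "\<forall>p \<in> Field P. pow_prj D Y P p \<cdot> prod_map D (Field P) (\<lambda>_. f) = f \<cdot> pow_prj D X P p"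
      using pm(2) by (simp add: pow_prj_def)
    have k: "\<forall>p \<in> Field P. p \<in> Field P" by blast
    note nm = net_map_props[OF X.X Y.X sP sP r f k rk]
    let ?h = "prod_map2 D (prod_map D (Field P) (\<lambda>_. f)) f"
    have m: "?h \<cdot> \<iota> P \<in> homset D (Dom D (\<iota> P)) (nets D Y P)"
      using comp_hom[OF X.iota_hom[OF P] nm(1)] .
    have "(pow_prj D Y P p \<cdot> net_of D Y P) \<cdot> (?h \<cdot> \<iota> P) = f \<cdot> leg D X \<iota> P p" if p: "p \<in> Field P" for p
      using comp_assoc[OF X.iota_hom[OF P] nm(1) net_pt_hom[OF Y.X sP p]] nm(2)[OF p]
        comp_assoc[OF X.iota_hom[OF P] net_pt_hom[OF X.X sP p] f] by (simp add: leg_def)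
    moreover have "limit_of D Y P \<cdot> (?h \<cdot> \<iota> P) = f \<cdot> limit_leg D X \<iota> P"
      using comp_assoc[OF X.iota_hom[OF P] nm(1) limit_of_hom[OF Y.X sP]] nm(3)
        comp_assoc[OF X.iota_hom[OF P] limit_of_hom[OF X.X sP] f] by (simp add: limit_leg_def)
    ultimately show ?thesis unfolding Y.factors_iff[OF P m] by (intro Y.converges_cong) auto
  qed
  have 1: "converges D Y \<kappa> w P (\<lambda>p. f \<cdot> g p) (f \<cdot> l)"
    if P: "small_directed P" and c: "converges D X \<iota> w P g l"
      and d: "converges D Y \<kappa> (Dom D (\<iota> P)) P (\<lambda>p. f \<cdot> leg D X \<iota> P p) (f \<cdot> limit_leg D X \<iota> P)"
    for P w g l
  proof -
    obtain u where u: "u \<in> homset D w (Dom D (\<iota> P))"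
      "\<And>p. p \<in> Field P \<Longrightarrow> leg D X \<iota> P p \<cdot> u = g p" "limit_leg D X \<iota> P \<cdot> u = l"
      using c unfolding converges_def by blast
    have "(f \<cdot> leg D X \<iota> P p) \<cdot> u = f \<cdot> g p" if "p \<in> Field P" for p
      using comp_assoc[OF u(1) X.leg_hom[OF P that] f] u(2)[OF that] by simp
    moreover have "(f \<cdot> limit_leg D X \<iota> P) \<cdot> u = f \<cdot> l"
      using comp_assoc[OF u(1) X.limit_leg_hom[OF P] f] u(3) by simp
    ultimately have "converges D Y \<kappa> w P (\<lambda>p. (f \<cdot> leg D X \<iota> P p) \<cdot> u) ((f \<cdot> limit_leg D X \<iota> P) \<cdot> u) \<longleftrightarrow>
        converges D Y \<kappa> w P (\<lambda>p. f \<cdot> g p) (f \<cdot> l)"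
      by (intro Y.converges_cong)
    then show ?thesis using Y.converges_comp[OF P d u(1)] by blast
  qed
  have 2: "converges D X \<iota> (Dom D (\<iota> P)) P (leg D X \<iota> P) (limit_leg D X \<iota> P)" "Dom D (\<iota> P) \<in> Obj D"
    if P: "small_directed P" for P
    using X.leg_hom[OF P] X.limit_leg_hom[OF P] hom_obj[OF X.limit_leg_hom[OF P]] id_hom id_right
    unfolding converges_def by (blast intro!: bexI[of _ "Id D (Dom D (\<iota> P))"])+
  show ?thesis
    unfolding continuous_arr_def using * 1 2 by blast
qed

lemma Top_in_homset:
  "homset (Top_in D) A B = {(A, f, B) | f. is_topology D (fst A) (snd A :: 'u rel \<Rightarrow> 'm) \<and>
     is_topology D (fst B) (snd B) \<and> f \<in> homset D (fst A) (fst B) \<and>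
     continuous_arr D (fst A) (snd A) f (fst B) (snd B)}"
proof -
  have nf: "net_family \<UU> D X \<iota>" if "is_topology D X \<iota>" for X and \<iota> :: "'u rel \<Rightarrow> 'm"
    using topology_net_family[OF complete_cat_axioms that] .
  have "((X, \<iota>), f, (Y, \<kappa>)) \<in> Arr (Top_in D) \<longleftrightarrow>
      is_topology D X \<iota> \<and> is_topology D Y \<kappa> \<and> f \<in> homset D X Y \<and> continuous_arr D X \<iota> f Y \<kappa>"
    for X f Y and \<iota> \<kappa> :: "'u rel \<Rightarrow> 'm"
    using continuous_arr_iff[OF nf nf, of X \<iota> Y \<kappa> f] by (simp add: Top_in_def cong: conj_cong)
  then show ?thesis
    unfolding homset_def[of "Top_in D"] by (cases A; cases B) (auto simp: Top_in_def)
qed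

lemma continuous_arr_comp:
  fixes \<iota> \<kappa> \<nu> :: "'u rel \<Rightarrow> 'm"
  assumes "net_family \<UU> D X \<iota>" "net_family \<UU> D Y \<kappa>" "net_family \<UU> D Z \<nu>"
    and f: "f \<in> homset D X Y" "continuous_arr D X \<iota> f Y \<kappa>"
    and g: "g \<in> homset D Y Z" "continuous_arr D Y \<kappa> g Z \<nu>"
  shows "continuous_arr D X \<iota> (g \<cdot> f) Z \<nu>"
  unfolding continuous_arr_def
proof (intro ballI allI impI)
  interpret X: net_family \<UU> D X \<iota> by fact
  interpret Z: net_family \<UU> D Z \<nu> by fact
  fix w P a l assume w: "w \<in> Obj D" and P: "small_directed P" and c: "converges D X \<iota> w P a l"
  have "converges D Z \<nu> w P (\<lambda>p. g \<cdot> f \<cdot> a p) (g \<cdot> f \<cdot> l)"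
    using f(2) g(2) c w P unfolding continuous_arr_def by blast
  moreover have "converges D Z \<nu> w P (\<lambda>p. g \<cdot> f \<cdot> a p) (g \<cdot> f \<cdot> l) \<longleftrightarrow>
      converges D Z \<nu> w P (\<lambda>p. (g \<cdot> f) \<cdot> a p) ((g \<cdot> f) \<cdot> l)"
    using comp_assoc[OF X.converges_hom(1)[OF P c] f(1) g(1)]
      comp_assoc[OF X.converges_hom(2)[OF P c] f(1) g(1)] by (intro Z.converges_cong) auto
  ultimately show "converges D Z \<nu> w P (\<lambda>p. (g \<cdot> f) \<cdot> a p) ((g \<cdot> f) \<cdot> l)" by blast
qed

lemma continuous_arr_id:
  fixes \<iota> :: "'u rel \<Rightarrow> 'm"
  assumes "net_family \<UU> D X \<iota>"
  shows "continuous_arr D X \<iota> (Id D X) X \<iota>"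
  unfolding continuous_arr_def
proof (intro ballI allI impI)
  interpret X: net_family \<UU> D X \<iota> by fact
  fix w P a l assume P: "small_directed P" and c: "converges D X \<iota> w P a l"
  have "converges D X \<iota> w P (\<lambda>p. Id D X \<cdot> a p) (Id D X \<cdot> l) \<longleftrightarrow> converges D X \<iota> w P a l"
    using id_left[OF X.converges_hom(1)[OF P c]] id_left[OF X.converges_hom(2)[OF P c]]
    by (intro X.converges_cong) auto
  then show "converges D X \<iota> w P (\<lambda>p. Id D X \<cdot> a p) (Id D X \<cdot> l)" using c by blast
qed

lemma Top_in_simps:
  "Obj (Top_in D) = {A. is_topology D (fst A) (snd A :: 'u rel \<Rightarrow> 'm)}"
  "Id (Top_in D) A = (A, Id D (fst A), A)"
  "(T', g, W) \<cdot>\<^bsub>Top_in D\<^esub> (S, f, T) = (S, g \<cdot> f, W)"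
  by (auto simp: Top_in_def)

lemma category_Top_in: "category (Top_in D :: (_ \<times> ('u rel \<Rightarrow> 'm), _) cat)"
proof -
  have nf: "net_family \<UU> D X \<iota>" if "is_topology D X \<iota>" for X and \<iota> :: "'u rel \<Rightarrow> 'm"
    using topology_net_family[OF complete_cat_axioms that] .
  show ?thesis
  proof (unfold_locales, goal_cases)
    case (1 f)
    then show ?case by (auto simp: Top_in_def)
  next
    case (2 A)
    then have t: "is_topology D (fst A) (snd A)" by (simp add: Top_in_simps)
    then have "fst A \<in> Obj D" by (simp add: is_topology_def)
    then show ?case
      unfolding Top_in_homset Top_in_simps using t id_hom continuous_arr_id[OF nf[OF t]] by auto
  next
    case (3 f x y g z)
    then show ?case
      unfolding Top_in_homset using comp_hom continuous_arr_comp[OF nf nf nf]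
      by (auto simp: Top_in_simps)
  next
    case (4 f x y)
    then show ?case unfolding Top_in_homset using id_left by (auto simp: Top_in_simps)
  next
    case (5 f x y)
    then show ?case unfolding Top_in_homset using id_right by (auto simp: Top_in_simps)
  next
    case (6 f w x g y h z)
    then show ?case unfolding Top_in_homset using comp_assoc by (auto simp: Top_in_simps)
  qed
qed

end

section \<open>The category of cocontinuous functors\<close>

lemma Hom_c_Obj: "Obj (Hom_c U A B) = {F. cocontinuous U A B F \<and>
     fobj F \<in> extensional (Obj A) \<and> farr F \<in> extensional (Arr A)}"
  by (simp add: Hom_c_def Let_def)

lemma Hom_c_homset:
  "homset (Hom_c U A B) F G = {(F, \<eta>, G) | \<eta>. F \<in> Obj (Hom_c U A B) \<and> G \<in> Obj (Hom_c U A B) \<and>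
     is_nat_trans A B F G \<eta> \<and> \<eta> \<in> extensional (Obj A)}"
  by (auto simp: Hom_c_def Let_def homset_def)

lemma Hom_c_simps:
  "Id (Hom_c U A B) F = (F, \<lambda>x \<in> Obj A. Id B (fobj F x), F)"
  "(G', \<theta>, H) \<cdot>\<^bsub>Hom_c U A B\<^esub> (F, \<eta>, G) = (F, \<lambda>x \<in> Obj A. \<theta> x \<cdot>\<^bsub>B\<^esub> \<eta> x, H)"
  by (simp_all add: Hom_c_def Let_def)

lemma nat_transD:
  assumes "is_nat_trans A B F G \<eta>"
  shows "is_functor A B F" "is_functor A B G"
    "x \<in> Obj A \<Longrightarrow> \<eta> x \<in> homset B (fobj F x) (fobj G x)"
    "f \<in> homset A x y \<Longrightarrow> \<eta> y \<cdot>\<^bsub>B\<^esub> farr F f = farr G f \<cdot>\<^bsub>B\<^esub> \<eta> x"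
  using assms unfolding is_nat_trans_def by blast+

lemma nat_trans_id:
  assumes F: "is_functor A B F"
  shows "is_nat_trans A B F F (\<lambda>x \<in> Obj A. Id B (fobj F x))"
proof -
  interpret A: category A using functorD[OF F] by blast
  interpret B: category B using functorD[OF F] by blast
  show ?thesis
    unfolding is_nat_trans_def
  proof (intro conjI F ballI allI)
    fix x y f assume f: "f \<in> homset A x y"
    show "(\<lambda>x \<in> Obj A. Id B (fobj F x)) y \<cdot>\<^bsub>B\<^esub> farr F f =
        farr F f \<cdot>\<^bsub>B\<^esub> (\<lambda>x \<in> Obj A. Id B (fobj F x)) x"
      using A.hom_obj[OF f] B.id_left[OF functorD(4)[OF F f]] B.id_right[OF functorD(4)[OF F f]] by simp
  qed (use B.id_hom functorD(3)[OF F] in auto)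
qed

lemma nat_trans_comp:
  assumes \<eta>: "is_nat_trans A B F G \<eta>" and \<theta>: "is_nat_trans A B G H \<theta>"
  shows "is_nat_trans A B F H (\<lambda>x \<in> Obj A. \<theta> x \<cdot>\<^bsub>B\<^esub> \<eta> x)"
proof -
  interpret A: category A using functorD[OF nat_transD(1)[OF \<eta>]] by blast
  interpret B: category B using functorD[OF nat_transD(1)[OF \<eta>]] by blast
  show ?thesis
    unfolding is_nat_trans_def
  proof (intro conjI nat_transD(1)[OF \<eta>] nat_transD(2)[OF \<theta>] ballI allI)
    show "(\<lambda>x \<in> Obj A. \<theta> x \<cdot>\<^bsub>B\<^esub> \<eta> x) x \<in> homset B (fobj F x) (fobj H x)" if x: "x \<in> Obj A" for x
      using B.comp_hom[OF nat_transD(3)[OF \<eta> x] nat_transD(3)[OF \<theta> x]] x by simp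
    fix x y f assume f: "f \<in> homset A x y"
    have o: "x \<in> Obj A" "y \<in> Obj A" using A.hom_obj[OF f] by auto
    note Ff = functorD(4)[OF nat_transD(1)[OF \<eta>] f] and Gf = functorD(4)[OF nat_transD(2)[OF \<eta>] f]
      and Hf = functorD(4)[OF nat_transD(2)[OF \<theta>] f]
    note \<eta>x = nat_transD(3)[OF \<eta>] and \<theta>x = nat_transD(3)[OF \<theta>]
    have "(\<theta> y \<cdot>\<^bsub>B\<^esub> \<eta> y) \<cdot>\<^bsub>B\<^esub> farr F f = \<theta> y \<cdot>\<^bsub>B\<^esub> (farr G f \<cdot>\<^bsub>B\<^esub> \<eta> x)"
      using B.comp_assoc[OF Ff \<eta>x[OF o(2)] \<theta>x[OF o(2)]] nat_transD(4)[OF \<eta> f] by simp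
    also have "\<dots> = (farr H f \<cdot>\<^bsub>B\<^esub> \<theta> x) \<cdot>\<^bsub>B\<^esub> \<eta> x"
      using B.comp_assoc[OF \<eta>x[OF o(1)] Gf \<theta>x[OF o(2)]] nat_transD(4)[OF \<theta> f] by simp
    also have "\<dots> = farr H f \<cdot>\<^bsub>B\<^esub> (\<theta> x \<cdot>\<^bsub>B\<^esub> \<eta> x)"
      using B.comp_assoc[OF \<eta>x[OF o(1)] \<theta>x[OF o(1)] Hf] .
    finally show "(\<lambda>x \<in> Obj A. \<theta> x \<cdot>\<^bsub>B\<^esub> \<eta> x) y \<cdot>\<^bsub>B\<^esub> farr F f =
        farr H f \<cdot>\<^bsub>B\<^esub> (\<lambda>x \<in> Obj A. \<theta> x \<cdot>\<^bsub>B\<^esub> \<eta> x) x" using o by simp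
  qed
qed

lemma category_Hom_c:
  assumes "category A" "category B"
  shows "category (Hom_c U A B)"
proof -
  interpret A: category A by fact
  interpret B: category B by fact
  have fun_F: "is_functor A B F" if "F \<in> Obj (Hom_c U A B)" for F
    using that unfolding Hom_c_Obj cocontinuous_def by blast
  show ?thesis
  proof (unfold_locales, goal_cases)
    case (1 f) then show ?case by (auto simp: Hom_c_def Let_def)
  next
    case (2 F) then show ?case
      unfolding Hom_c_homset Hom_c_simps using nat_trans_id[OF fun_F] by auto
  next
    case (3 f x y g z) then show ?case
      unfolding Hom_c_homset using nat_trans_comp by (auto simp: Hom_c_simps)
  next
    case (4 f F G)
    then obtain \<eta> where f: "f = (F, \<eta>, G)" and \<eta>: "is_nat_trans A B F G \<eta>" "\<eta> \<in> extensional (Obj A)"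
      unfolding Hom_c_homset by blast
    have "(\<lambda>x \<in> Obj A. (\<lambda>x \<in> Obj A. Id B (fobj G x)) x \<cdot>\<^bsub>B\<^esub> \<eta> x) = \<eta>"
      using B.id_left[OF nat_transD(3)[OF \<eta>(1)]] \<eta>(2) by (intro extensionalityI[of _ "Obj A"]) auto
    then show ?case unfolding f Hom_c_simps by simp
  next
    case (5 f F G)
    then obtain \<eta> where f: "f = (F, \<eta>, G)" and \<eta>: "is_nat_trans A B F G \<eta>" "\<eta> \<in> extensional (Obj A)"
      unfolding Hom_c_homset by blast
    have "(\<lambda>x \<in> Obj A. \<eta> x \<cdot>\<^bsub>B\<^esub> (\<lambda>x \<in> Obj A. Id B (fobj F x)) x) = \<eta>"
      using B.id_right[OF nat_transD(3)[OF \<eta>(1)]] \<eta>(2) by (intro extensionalityI[of _ "Obj A"]) auto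
    then show ?case unfolding f Hom_c_simps by simp
  next
    case (6 f F G g H h K)
    obtain \<eta> where f: "f = (F, \<eta>, G)" and \<eta>: "is_nat_trans A B F G \<eta>"
      using 6(1) unfolding Hom_c_homset by blast
    obtain \<theta> where g: "g = (G, \<theta>, H)" and \<theta>: "is_nat_trans A B G H \<theta>"
      using 6(2) unfolding Hom_c_homset by blast
    obtain \<zeta> where h: "h = (H, \<zeta>, K)" and \<zeta>: "is_nat_trans A B H K \<zeta>"
      using 6(3) unfolding Hom_c_homset by blast
    have "(\<zeta> x \<cdot>\<^bsub>B\<^esub> \<theta> x) \<cdot>\<^bsub>B\<^esub> \<eta> x = \<zeta> x \<cdot>\<^bsub>B\<^esub> (\<theta> x \<cdot>\<^bsub>B\<^esub> \<eta> x)" if "x \<in> Obj A" for x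
      using B.comp_assoc[OF nat_transD(3)[OF \<eta> that] nat_transD(3)[OF \<theta> that] nat_transD(3)[OF \<zeta> that]] .
    then show ?case unfolding f g h Hom_c_simps by (auto simp: restrict_def)
  qed
qed

section \<open>Cocontinuous functors on topological spaces\<close>

locale cocomplete_cat = universe \<UU> + category C for \<UU> :: "'u itself" and C :: "('o, 'm) cat" (structure) +
  assumes cocomplete: "cocomplete TYPE('u) C" and locally_small: "locally_small TYPE('u) C"
begin

sublocale op: complete_cat \<UU> "opcat C"
  by (intro complete_cat.intro universe_axioms opcat_category complete_cat_axioms.intro)
    (simp add: cocomplete)

end

lemma (in universe) cocomplete_cat_TOP: "cocomplete_cat \<UU> (TOP :: ('u topology, _) cat)"
  by (intro cocomplete_cat.intro universe_axioms category_TOP cocomplete_cat_axioms.intro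
      cocomplete_TOP locally_small_TOP)

locale cocontinuous_on_TOP = cocomplete_cat \<UU> C for \<UU> :: "'u itself" and C :: "('o, 'm) cat" (structure) +
  fixes F :: "('u topology, 'u topology \<times> ('u \<Rightarrow> 'u) \<times> 'u topology, 'o, 'm) ftr"
  assumes cocont: "cocontinuous TYPE('u) TOP C F"
begin

lemma F: "is_functor TOP C F"
  using cocont unfolding cocontinuous_def by blast

abbreviation "X \<equiv> fobj F point_space"

text \<open>
  The image of a point of \<open>T\<close>. A morphism out of \<open>F T\<close> is thought of as a family of morphisms
  \<open>X \<rightarrow> y\<close> indexed by the points of \<open>T\<close>, which is justified by the next lemmas.
\<close>

definition pt :: "'u topology \<Rightarrow> 'u \<Rightarrow> 'm" where
  "pt T t = farr F (point_of T t)"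

lemma X_Obj: "X \<in> Obj C"
  using functorD(3)[OF F point_space_Obj] .

lemma F_Obj: "T \<in> Obj TOP \<Longrightarrow> fobj F T \<in> Obj C"
  using functorD(3)[OF F] .

lemma pt_hom: "T \<in> Obj TOP \<Longrightarrow> t \<in> topspace T \<Longrightarrow> pt T t \<in> homset C X (fobj F T)"
  unfolding pt_def using functorD(4)[OF F point_of_hom] .

lemma arr_pt:
  assumes "S \<in> Obj TOP" "T \<in> Obj TOP" "continuous_map S T f" "s \<in> topspace S"
  shows "farr F (top_arr S T f) \<cdot> pt S s = pt T (f s)"
  unfolding pt_def
  using functorD(6)[OF F point_of_hom[OF assms(1,4)] top_arr_hom[OF assms(1-3)]]
  by (simp add: arr_point_of[OF assms(4)])

lemma pt_epi:
  assumes T: "T \<in> Obj TOP" and u: "u \<in> homset C (fobj F T) y" and v: "v \<in> homset C (fobj F T) y"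
    and eq: "\<And>t. t \<in> topspace T \<Longrightarrow> u \<cdot> pt T t = v \<cdot> pt T t"
  shows "u = v"
proof -
  have s: "small TYPE('u) (topspace T)" using T by (simp add: TOP_Obj)
  have b: "small TYPE('u) (UNIV :: bool set)" by (rule small_finite) simp
  have co: "bip_colimit C (topspace T) (UNIV :: bool set) (topspace T \<times> UNIV) fst snd
      (\<lambda>_. X) (\<lambda>_. fobj F T) (\<lambda>k. farr F (case k of (t, b) \<Rightarrow> point_of T t))
      (fobj F T) (\<lambda>t. farr F (point_of T t)) (\<lambda>_. farr F (Id TOP T))"
    by (rule cocontinuous_bip[OF points_epi_diagram[OF T] cocont s b small_Times[OF s b]
          points_epi_colimit[OF T]])
  have id: "farr F (Id TOP T) = Id C (fobj F T)" using functorD(5)[OF F T] .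
  have up: "u \<cdot> pt T t \<in> homset C X y" if "t \<in> topspace T" for t
    using comp_hom[OF pt_hom[OF T that] u] .
  have "bip_cocone C (topspace T) (UNIV :: bool set) (topspace T \<times> UNIV) fst snd
      (\<lambda>_. X) (\<lambda>_. fobj F T) (\<lambda>k. farr F (case k of (t, b) \<Rightarrow> point_of T t))
      y (\<lambda>t. u \<cdot> pt T t) (\<lambda>b. if b then u else v)"
    unfolding bip_cocone_def
    using u v eq up hom_obj[OF u] by (auto simp: pt_def)
  then obtain w where w: "w \<in> homset C (fobj F T) y"
    "\<forall>b\<in>UNIV. w \<cdot> farr F (Id TOP T) = (if b then u else v)"
    using co unfolding bip_colimit_def by blast
  then have "w = u" "w = v"
    using id_right[OF w(1)] unfolding id by (auto simp: all_bool_eq)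
  then show ?thesis by simp
qed

definition extends :: "'u topology \<Rightarrow> 'o \<Rightarrow> ('u \<Rightarrow> 'm) \<Rightarrow> bool" where
  "extends T y \<phi> \<longleftrightarrow> (\<exists>u \<in> homset C (fobj F T) y. \<forall>t \<in> topspace T. u \<cdot> pt T t = \<phi> t)"

lemma extends_hom:
  assumes "T \<in> Obj TOP" "extends T y \<phi>" "t \<in> topspace T"
  shows "\<phi> t \<in> homset C X y"
proof -
  obtain u where u: "u \<in> homset C (fobj F T) y" "u \<cdot> pt T t = \<phi> t"
    using assms(2,3) unfolding extends_def by blast
  show ?thesis using comp_hom[OF pt_hom[OF assms(1,3)] u(1)] u(2) by simp
qed

lemma extends_cong: "(\<And>t. t \<in> topspace T \<Longrightarrow> \<phi> t = \<psi> t) \<Longrightarrow> extends T y \<phi> \<longleftrightarrow> extends T y \<psi>"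
  unfolding extends_def by simp

lemma extends_comp:
  assumes ST: "S \<in> Obj TOP" "T \<in> Obj TOP" "continuous_map S T f" and "extends T y \<phi>"
  shows "extends S y (\<lambda>s. \<phi> (f s))"
proof -
  obtain u where u: "u \<in> homset C (fobj F T) y" "\<And>t. t \<in> topspace T \<Longrightarrow> u \<cdot> pt T t = \<phi> t"
    using assms(4) unfolding extends_def by blast
  have Ff: "farr F (top_arr S T f) \<in> homset C (fobj F S) (fobj F T)"
    using functorD(4)[OF F top_arr_hom[OF ST]] .
  have "(u \<cdot> farr F (top_arr S T f)) \<cdot> pt S s = \<phi> (f s)" if s: "s \<in> topspace S" for s
    using comp_assoc[OF pt_hom[OF ST(1) s] Ff u(1)] arr_pt[OF ST s] u(2) continuous_map_in[OF ST(3) s] by simp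
  then show ?thesis unfolding extends_def using comp_hom[OF Ff u(1)] by blast
qed

text \<open>
  Being a morphism out of \<open>F T\<close> can be tested on a final family of maps, as for continuity.
  A small subfamily is final as well, so \<open>T\<close> is a small colimit, which \<open>F\<close> preserves.
\<close>

lemma extends_final:
  assumes K: "final_maps T K" and T: "T \<in> Obj TOP"
    and \<phi>: "\<And>t. t \<in> topspace T \<Longrightarrow> \<phi> t \<in> homset C X y" and y: "y \<in> Obj C"
    and ext: "\<And>S g. (S, g) \<in> K \<Longrightarrow> extends S y (\<lambda>s. \<phi> (g s))"
  shows "extends T y \<phi>"
proof -
  obtain K' where K': "K' \<subseteq> K" "small TYPE('u) K'" "final_maps T K'" using final_maps_small[OF K T] .
  have sT: "small TYPE('u) (topspace T)" using T by (simp add: TOP_Obj)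
  have "small TYPE('u) (topspace (fst k))" if "k \<in> K'" for k
    using final_mapsD(1)[OF K'(3), of "fst k" "snd k"] that by (simp add: TOP_Obj)
  then have sE: "small TYPE('u) (Sigma K' (\<lambda>k. topspace (fst k)))" by (rule small_Sigma[OF K'(2)])
  have co: "bip_colimit C (topspace T) K' (Sigma K' (\<lambda>k. topspace (fst k))) (\<lambda>(k, s). snd k s) fst
     (\<lambda>_. X) (\<lambda>k. fobj F (fst k)) (\<lambda>e. farr F (case e of (k, s) \<Rightarrow> point_of (fst k) s))
     (fobj F T) (\<lambda>t. farr F (point_of T t)) (\<lambda>k. farr F (top_arr (fst k) T (snd k)))"
    by (rule cocontinuous_bip[OF final_bip_diagram[OF K'(3) T] cocont sT K'(2) sE
          final_bip_colimit[OF K'(3) T]])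
  have "\<forall>k \<in> K'. \<exists>u. u \<in> homset C (fobj F (fst k)) y \<and>
      (\<forall>s \<in> topspace (fst k). u \<cdot> pt (fst k) s = \<phi> (snd k s))"
  proof
    fix k assume "k \<in> K'"
    then have "(fst k, snd k) \<in> K" using K'(1) by auto
    from ext[OF this] show "\<exists>u. u \<in> homset C (fobj F (fst k)) y \<and>
      (\<forall>s \<in> topspace (fst k). u \<cdot> pt (fst k) s = \<phi> (snd k s))" unfolding extends_def by blast
  qed
  from bchoice[OF this] obtain u where u: "\<forall>k \<in> K'. u k \<in> homset C (fobj F (fst k)) y \<and>
      (\<forall>s \<in> topspace (fst k). u k \<cdot> pt (fst k) s = \<phi> (snd k s))" ..
  have "bip_cocone C (topspace T) K' (Sigma K' (\<lambda>k. topspace (fst k))) (\<lambda>(k, s). snd k s) fst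
     (\<lambda>_. X) (\<lambda>k. fobj F (fst k)) (\<lambda>e. farr F (case e of (k, s) \<Rightarrow> point_of (fst k) s)) y \<phi> u"
    unfolding bip_cocone_def using \<phi> u y by (auto simp: pt_def)
  then obtain v where v: "v \<in> homset C (fobj F T) y" "\<forall>t\<in>topspace T. v \<cdot> farr F (point_of T t) = \<phi> t"
    using co unfolding bip_colimit_def by blast
  then show ?thesis unfolding extends_def pt_def by blast
qed

text \<open>
  The functor \<open>T \<mapsto> hom (F T) y\<close> is represented by a topology on \<open>hom X y\<close>, as special adjoint functor
  theorems predict. Take the final topology with respect to all families that extend, for all
  spaces \<open>T\<close> at once. These families form a final family of maps into \<open>hom X y\<close>, and so, by
  the previous lemma, the identity of \<open>hom X y\<close>, seen as a family of morphisms \<open>X \<rightarrow> y\<close>, extends.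
  Every continuous map into \<open>hom X y\<close> then extends by composition.
\<close>

lemma extends_topology:
  assumes y: "y \<in> Obj C"
  shows "\<exists>\<tau>. topspace \<tau> = homset C X y \<and>
    (\<forall>T \<in> Obj TOP. \<forall>\<phi>. extends T y \<phi> \<longleftrightarrow> continuous_map T \<tau> \<phi>)"
proof -
  let ?H = "homset C X y"
  define op where "op V \<longleftrightarrow> V \<subseteq> ?H \<and> (\<forall>T \<in> Obj TOP. \<forall>\<phi>. extends T y \<phi> \<longrightarrow>
      openin T {t \<in> topspace T. \<phi> t \<in> V})" for V
  have "istopology op"
    unfolding istopology_def
  proof (intro conjI allI impI)
    fix V W assume V: "op V" and W: "op W"
    have "{t \<in> topspace T. \<phi> t \<in> V \<inter> W} = {t \<in> topspace T. \<phi> t \<in> V} \<inter> {t \<in> topspace T. \<phi> t \<in> W}"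
      for T :: "'u topology" and \<phi> by auto
    then show "op (V \<inter> W)" using V W unfolding op_def by auto
  next
    fix \<V> assume V: "\<forall>V\<in>\<V>. op V"
    have "{t \<in> topspace T. \<phi> t \<in> \<Union>\<V>} = (\<Union>V\<in>\<V>. {t \<in> topspace T. \<phi> t \<in> V})"
      for T :: "'u topology" and \<phi> by auto
    then show "op (\<Union>\<V>)" using V unfolding op_def by auto
  qed
  then have open_iff: "openin (topology op) = op" by (rule topology_inverse')
  let ?\<tau> = "topology op"
  have "op ?H"
  proof -
    have "{t \<in> topspace T. \<phi> t \<in> ?H} = topspace T" if "T \<in> Obj TOP" "extends T y \<phi>" for T \<phi>
      using extends_hom[OF that] by auto
    then show ?thesis unfolding op_def by auto
  qed
  then have top: "topspace ?\<tau> = ?H"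
    unfolding topspace_def open_iff by (auto simp: op_def)
  have ext_cont: "continuous_map T ?\<tau> \<phi>" if "T \<in> Obj TOP" "extends T y \<phi>" for T \<phi>
    using that extends_hom[OF that] unfolding continuous_map_def top open_iff op_def by auto
  have "small TYPE('u) (topspace ?\<tau>)"
    using locally_small X_Obj y unfolding top locally_small_def by blast
  then obtain R e d where R: "(R :: 'u topology) \<in> Obj TOP" and ed: "homeomorphic_maps ?\<tau> R e d"
    by (rule small_copy)
  have e_cont: "continuous_map ?\<tau> R e" and d_cont: "continuous_map R ?\<tau> d"
    and de: "\<And>h. h \<in> ?H \<Longrightarrow> d (e h) = h" and ed: "\<And>x. x \<in> topspace R \<Longrightarrow> e (d x) = x"
    using ed top unfolding homeomorphic_maps_def by auto
  have d_in: "d x \<in> ?H" if "x \<in> topspace R" for x using continuous_map_in[OF d_cont that] top by simp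
  \<comment> \<open>\<open>R\<close> is a copy of \<open>hom X y\<close> in \<open>TOP\<close>, with inverse homeomorphisms \<open>e\<close> and \<open>d\<close>.\<close>
  define K where "K = {(T, g). T \<in> Obj TOP \<and> continuous_map T R g \<and> extends T y (\<lambda>t. d (g t))}"
  have K: "final_maps R K"
    unfolding final_maps_def
  proof (intro conjI allI impI)
    show "S \<in> Obj TOP" "continuous_map S R g" if "(S, g) \<in> K" for S g
      using that unfolding K_def by auto
    fix V assume V: "V \<subseteq> topspace R" and o: "\<forall>S g. (S, g) \<in> K \<longrightarrow> openin S {s \<in> topspace S. g s \<in> V}"
    have dV: "d ` V \<subseteq> ?H" using V d_in by blast
    have "openin T {t \<in> topspace T. \<phi> t \<in> d ` V}" if T: "T \<in> Obj TOP" and \<phi>: "extends T y \<phi>" for T \<phi>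
    proof -
      have \<phi>H: "\<phi> t \<in> ?H" if "t \<in> topspace T" for t using extends_hom[OF T \<phi> that] .
      have "continuous_map T R (\<lambda>t. e (\<phi> t))"
        using continuous_map_compose[OF ext_cont[OF T \<phi>] e_cont] by (simp add: comp_def)
      moreover have "extends T y (\<lambda>t. d (e (\<phi> t)))"
        using \<phi> extends_cong[of T "\<lambda>t. d (e (\<phi> t))" \<phi>] \<phi>H de by simp
      ultimately have "(T, \<lambda>t. e (\<phi> t)) \<in> K" using T unfolding K_def by blast
      from o[rule_format, OF this] have "openin T {t \<in> topspace T. e (\<phi> t) \<in> V}" .
      moreover have "e (\<phi> t) \<in> V \<longleftrightarrow> \<phi> t \<in> d ` V" if t: "t \<in> topspace T" for t
      proof
        assume "e (\<phi> t) \<in> V" then show "\<phi> t \<in> d ` V" using de[OF \<phi>H[OF t]] by (metis imageI)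
      next
        assume "\<phi> t \<in> d ` V"
        then obtain x where "x \<in> V" "\<phi> t = d x" by blast
        then show "e (\<phi> t) \<in> V" using ed V by auto
      qed
      then have "{t \<in> topspace T. \<phi> t \<in> d ` V} = {t \<in> topspace T. e (\<phi> t) \<in> V}" by auto
      ultimately show ?thesis by simp
    qed
    then have "op (d ` V)" unfolding op_def using dV by blast
    then have "openin ?\<tau> (d ` V)" by (simp add: open_iff)
    then have "openin R {x \<in> topspace R. d x \<in> d ` V}" using d_cont unfolding continuous_map_def by blast
    moreover have "x \<in> V" if x: "x \<in> topspace R" "d x \<in> d ` V" for x
    proof -
      obtain v where "v \<in> V" "d x = d v" using x(2) by blast
      then show ?thesis using ed[OF x(1)] ed[of v] V by auto
    qed
    then have "{x \<in> topspace R. d x \<in> d ` V} = V" using V by blast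
    ultimately show "openin R V" by simp
  qed
  have "extends R y d"
  proof (rule extends_final[OF K R _ y])
    show "d x \<in> ?H" if "x \<in> topspace R" for x by (rule d_in[OF that])
    show "extends S y (\<lambda>s. d (g s))" if "(S, g) \<in> K" for S g using that unfolding K_def by blast
  qed
  then have "extends T y \<phi>" if T: "T \<in> Obj TOP" and \<phi>: "continuous_map T ?\<tau> \<phi>" for T \<phi>
  proof -
    have "extends T y (\<lambda>t. d (e (\<phi> t)))"
      using extends_comp[OF T R continuous_map_compose[OF \<phi> e_cont] \<open>extends R y d\<close>] by (simp add: comp_def)
    moreover have "\<phi> t \<in> ?H" if "t \<in> topspace T" for t
      using continuous_map_in[OF \<phi> that] top by simp
    ultimately show ?thesis using extends_cong[of T "\<lambda>t. d (e (\<phi> t))" \<phi>] de by simp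
  qed
  then show ?thesis using top ext_cont by blast
qed

end

section \<open>Evaluation at the universal cotopological space\<close>

text \<open>
  The axioms concern small directed sets only, whereas the relations compared here are not controlled on others.
\<close>

lemma net_convergence_cong:
  fixes c c' :: "'u rel \<Rightarrow> ('u \<Rightarrow> 'h) \<Rightarrow> 'h \<Rightarrow> bool"
  assumes e: "\<And>P f l. small_directed P \<Longrightarrow> c P f l \<longleftrightarrow> c' P f l" and "net_convergence H c"
  shows "net_convergence H c'"
  unfolding net_convergence_def
proof (intro conjI allI impI)
  note ax = assms(2)[unfolded net_convergence_def]
  note ax1 = ax[THEN conjunct1] and ax2 = ax[THEN conjunct2, THEN conjunct1]
    and ax3 = ax[THEN conjunct2, THEN conjunct2, THEN conjunct1]
    and ax4 = ax[THEN conjunct2, THEN conjunct2, THEN conjunct2, THEN conjunct1]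
    and ax5 = ax[THEN conjunct2, THEN conjunct2, THEN conjunct2, THEN conjunct2, THEN conjunct1]
    and ax6 = ax[THEN conjunct2, THEN conjunct2, THEN conjunct2, THEN conjunct2, THEN conjunct2]
  {
    fix P :: "'u rel" and f l assume "small_directed P" "c' P f l"
    then show "f ` Field P \<subseteq> H" "l \<in> H" using ax1 e by blast+
  next
    fix P :: "'u rel" and f g l assume "small_directed P" "c' P f l" "\<forall>p\<in>Field P. f p = g p"
    then show "c' P g l" using ax2[rule_format, of P f l g] e by blast
  next
    fix P :: "'u rel" and l assume "small_directed P" "l \<in> H"
    then show "c' P (\<lambda>_. l) l" using ax3[rule_format, of P l] e by blast
  next
    fix P Q :: "'u rel" and h f l assume "small_directed P" "small_directed Q" "cofinal_map Q P h" "c' P f l"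
    then show "c' Q (\<lambda>q. f (h q)) l" using ax4[rule_format, of P Q h f l] e by blast
  next
    fix P and R :: "'u set \<Rightarrow> 'u rel" and h f l assume P: "small_directed P" "f ` Field P \<subseteq> H" "l \<in> H"
      and R: "\<forall>Q \<in> cofinal_subsets P. small_directed (R Q) \<and> cofinal_map (R Q) (Restr P Q) (h Q) \<and>
           c' (R Q) (\<lambda>r. f (h Q r)) l"
    have "\<forall>Q \<in> cofinal_subsets P. small_directed (R Q) \<and> cofinal_map (R Q) (Restr P Q) (h Q) \<and>
           c (R Q) (\<lambda>r. f (h Q r)) l"
      using R by (simp add: e)
    then have "c P f l" using P ax5 by blast
    then show "c' P f l" using e[OF P(1)] by simp
  next
    fix P S :: "'u rel" and Q :: "'u \<Rightarrow> 'u rel" and \<phi> g l m assume P: "small_directed P" "\<forall>p \<in> Field P. small_directed (Q p)"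
      "small_directed S" "order_iso S (iter_index P Q) \<phi>" and g: "\<forall>p \<in> Field P. c' (Q p) (g p) (l p)"
      and l: "c' P l m"
    have "\<forall>p \<in> Field P. c (Q p) (g p) (l p)" using P(2) g by (simp add: e)
    then have "c S (\<lambda>s. case \<phi> s of (p, f) \<Rightarrow> g p (f p)) m" using ax6 P l e[OF P(1)] by blast
    then show "c' S (\<lambda>s. case \<phi> s of (p, f) \<Rightarrow> g p (f p)) m" using e[OF P(3)] by simp
  }
qed

context cocomplete_cat begin

lemma CoTop_Obj: "Obj (CoTop C) = {A. is_topology (opcat C) (fst A) (snd A :: 'u rel \<Rightarrow> 'm)}"
  by (simp add: CoTop_def op.Top_in_simps)

lemma CoTop_homset:
  "homset (CoTop C) A B = {(B, f, A) | f. is_topology (opcat C) (fst A) (snd A :: 'u rel \<Rightarrow> 'm) \<and>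
     is_topology (opcat C) (fst B) (snd B) \<and> f \<in> homset C (fst A) (fst B) \<and>
     continuous_arr (opcat C) (fst B) (snd B) f (fst A) (snd A)}"
  unfolding CoTop_def by (auto simp: op.Top_in_homset)

lemma CoTop_simps:
  "Id (CoTop C) A = (A, Id C (fst A), A)"
  "(T, g, W) \<cdot>\<^bsub>CoTop C\<^esub> (T', f, S) = (T, g \<cdot> f, S)"
  by (simp_all add: CoTop_def Top_in_def)

end

context universe begin

interpretation TOP: cocomplete_cat \<UU> "TOP :: ('u topology, _) cat"
  by (rule cocomplete_cat_TOP)

text \<open>
  Morphisms of \<open>opcat TOP\<close> into \<open>nets\<close> are continuous maps out of a coproduct of points; the components of
  the universal example are the points of \<open>net_space P\<close>.
\<close>

lemma universal_comps:
  fixes P :: "'u rel"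
  assumes P: "small_directed P"
  defines "i \<equiv> snd universal_cospace P"
  shows "i \<in> homset (opcat TOP) (net_space P) (nets (opcat TOP) point_space P)"
    "p \<in> Field P \<Longrightarrow> (pow_prj (opcat TOP) point_space P p \<cdot>\<^bsub>opcat TOP\<^esub> net_of (opcat TOP) point_space P)
       \<cdot>\<^bsub>opcat TOP\<^esub> i = point_of (net_space P) p"
    "limit_of (opcat TOP) point_space P \<cdot>\<^bsub>opcat TOP\<^esub> i = point_of (net_space P) (infpt P)"
proof -
  have o: "point_space \<in> Obj (opcat (TOP :: ('u topology, _) cat))" using point_space_Obj by simp
  have top: "topspace (net_space P) = insert (infpt P) (Field P)" by (rule topspace_net_space[OF P])
  have f: "\<forall>p \<in> Field P. point_of (net_space P) p \<in> homset (opcat TOP) (net_space P) point_space"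
    using point_of_hom[OF net_space_Obj[OF P]] top by simp
  have l: "point_of (net_space P) (infpt P) \<in> homset (opcat TOP) (net_space P) point_space"
    using point_of_hom[OF net_space_Obj[OF P]] top by simp
  have i: "i = net_tuple (opcat TOP) P (net_space P) (point_of (net_space P)) (point_of (net_space P) (infpt P))"
    using P by (simp add: i_def universal_cospace_def)
  note t = TOP.op.net_tuple_props[OF o small_directedD(1)[OF P] f l]
  show "i \<in> homset (opcat TOP) (net_space P) (nets (opcat TOP) point_space P)"
    "p \<in> Field P \<Longrightarrow> (pow_prj (opcat TOP) point_space P p \<cdot>\<^bsub>opcat TOP\<^esub> net_of (opcat TOP) point_space P)
       \<cdot>\<^bsub>opcat TOP\<^esub> i = point_of (net_space P) p"
    "limit_of (opcat TOP) point_space P \<cdot>\<^bsub>opcat TOP\<^esub> i = point_of (net_space P) (infpt P)"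
    unfolding i using t(1) t(2) t(3) by blast+
qed

lemma universal_parts:
  fixes P :: "'u rel"
  assumes P: "small_directed P"
  shows "nets (opcat TOP) point_space P \<in> Obj (TOP :: ('u topology, _) cat)"
    "p \<in> Field P \<Longrightarrow> pow_prj (opcat TOP) point_space P p \<cdot>\<^bsub>opcat TOP\<^esub> net_of (opcat TOP) point_space P
       \<in> homset TOP point_space (nets (opcat TOP) (point_space :: 'u topology) P)"
    "limit_of (opcat TOP) point_space P \<in> homset TOP point_space (nets (opcat TOP) (point_space :: 'u topology) P)"
proof -
  have o: "point_space \<in> Obj (opcat (TOP :: ('u topology, _) cat))" using point_space_Obj by simp
  note sP = small_directedD(1)[OF P]
  show "nets (opcat TOP) point_space P \<in> Obj (TOP :: ('u topology, _) cat)"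
    using TOP.op.nets_obj[OF o sP] by simp
  show "p \<in> Field P \<Longrightarrow> pow_prj (opcat TOP) point_space P p \<cdot>\<^bsub>opcat TOP\<^esub> net_of (opcat TOP) point_space P
       \<in> homset TOP point_space (nets (opcat TOP) (point_space :: 'u topology) P)"
    using TOP.op.net_pt_hom[OF o sP] by simp
  show "limit_of (opcat TOP) point_space P \<in> homset TOP point_space (nets (opcat TOP) (point_space :: 'u topology) P)"
    using TOP.op.limit_of_hom[OF o sP] by simp
qed

end

context cocontinuous_on_TOP begin

definition ev_map :: "'u rel \<Rightarrow> 'm" where
  "ev_map = snd (cospace_image TOP C F universal_cospace)"

lemma ev_eq: "cospace_image TOP C F universal_cospace = (X, ev_map)"
  by (simp add: ev_map_def cospace_image_def space_image_def universal_cospace_def)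

lemma ev_map_extensional: "ev_map \<in> extensional {P. small_directed P}"
  by (simp add: ev_map_def cospace_image_def space_image_def universal_cospace_def)

text \<open>
  The comparison morphism that is part of \<open>space_image\<close> is designed such that the components of \<open>ev_map P\<close> are
  the images under \<open>F\<close> of the components of the universal example.
\<close>

lemma ev_map_props:
  assumes P: "small_directed P"
  shows "ev_map P \<in> homset (opcat C) (fobj F (net_space P)) (nets (opcat C) X P)"
    "p \<in> Field P \<Longrightarrow> leg (opcat C) X ev_map P p = pt (net_space P) p"
    "limit_leg (opcat C) X ev_map P = pt (net_space P) (infpt P)"
proof -
  let ?N = "nets (opcat TOP) (point_space :: 'u topology) P"
  let ?q = "\<lambda>p. pow_prj (opcat TOP) (point_space :: 'u topology) P p \<cdot>\<^bsub>opcat TOP\<^esub> net_of (opcat TOP) point_space P"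
  let ?l = "limit_of (opcat TOP) (point_space :: 'u topology) P"
  let ?i = "snd universal_cospace P"
  let ?t = "net_tuple (opcat C) P (fobj F ?N) (\<lambda>p. farr F (?q p)) (farr F ?l)"
  note sP = small_directedD(1)[OF P]
  note u = universal_comps[OF P] and v = universal_parts[OF P]
  have Xo: "X \<in> Obj (opcat C)" using X_Obj by simp
  have i: "?i \<in> homset TOP ?N (net_space P)" using u(1) by simp
  have q: "\<forall>p \<in> Field P. farr F (?q p) \<in> homset (opcat C) (fobj F ?N) X"
    using functorD(4)[OF F v(2)] by simp
  have l: "farr F ?l \<in> homset (opcat C) (fobj F ?N) X"
    using functorD(4)[OF F v(3)] by simp
  note t = op.net_tuple_props[OF Xo sP q l]
  have Fi: "farr F ?i \<in> homset (opcat C) (fobj F (net_space P)) (fobj F ?N)"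
    using functorD(4)[OF F i] by simp
  have e: "ev_map P = ?t \<cdot>\<^bsub>opcat C\<^esub> farr F ?i"
    using P unfolding ev_map_def cospace_image_def space_image_def universal_cospace_def by simp
  show "ev_map P \<in> homset (opcat C) (fobj F (net_space P)) (nets (opcat C) X P)"
    unfolding e by (rule op.comp_hom[OF Fi t(1)])
  show "leg (opcat C) X ev_map P p = pt (net_space P) p" if p: "p \<in> Field P"
  proof -
    have "leg (opcat C) X ev_map P p = farr F (?q p) \<cdot>\<^bsub>opcat C\<^esub> farr F ?i"
      unfolding leg_def e using op.comp_assoc[OF Fi t(1) op.net_pt_hom[OF Xo sP p]] t(2)[OF p] by simp
    also have "\<dots> = farr F (?i \<cdot>\<^bsub>TOP\<^esub> ?q p)"
      using functorD(6)[OF F v(2)[OF p] i] by simp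
    finally show ?thesis using u(2)[OF p] by (simp add: pt_def)
  qed
  show "limit_leg (opcat C) X ev_map P = pt (net_space P) (infpt P)"
  proof -
    have "limit_leg (opcat C) X ev_map P = farr F ?l \<cdot>\<^bsub>opcat C\<^esub> farr F ?i"
      unfolding limit_leg_def e using op.comp_assoc[OF Fi t(1) op.limit_of_hom[OF Xo sP]] t(3) by simp
    also have "\<dots> = farr F (?i \<cdot>\<^bsub>TOP\<^esub> ?l)"
      using functorD(6)[OF F v(3) i] by simp
    finally show ?thesis using u(3) by (simp add: pt_def)
  qed
qed

lemma ev_map_monic:
  assumes P: "small_directed P"
  shows "monic (opcat C) (ev_map P)"
  unfolding monic_def
proof (intro conjI allI ballI impI)
  note e = ev_map_props[OF P]
  show "ev_map P \<in> Arr (opcat C)" using homsetD[OF e(1)] by blast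
  have d: "Dom (opcat C) (ev_map P) = fobj F (net_space P)" using homsetD[OF e(1)] by blast
  note sP = small_directedD(1)[OF P]
  have Xo: "X \<in> Obj (opcat C)" using X_Obj by simp
  fix w f g assume f: "f \<in> homset (opcat C) w (Dom (opcat C) (ev_map P))"
    and g: "g \<in> homset (opcat C) w (Dom (opcat C) (ev_map P))"
    and eq: "ev_map P \<cdot>\<^bsub>opcat C\<^esub> f = ev_map P \<cdot>\<^bsub>opcat C\<^esub> g"
  show "f = g"
  proof (rule pt_epi[OF net_space_Obj[OF P]])
    show f': "f \<in> homset C (fobj F (net_space P)) w" and g': "g \<in> homset C (fobj F (net_space P)) w"
      using f g d by simp_all
    fix s assume "s \<in> topspace (net_space P)"
    then consider "s = infpt P" | "s \<in> Field P" by (auto simp: topspace_net_space[OF P])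
    then show "f \<cdot> pt (net_space P) s = g \<cdot> pt (net_space P) s"
    proof cases
      case 1
      have "limit_leg (opcat C) X ev_map P \<cdot>\<^bsub>opcat C\<^esub> h = limit_of (opcat C) X P \<cdot>\<^bsub>opcat C\<^esub> (ev_map P \<cdot>\<^bsub>opcat C\<^esub> h)"
        if "h \<in> homset C (fobj F (net_space P)) w" for h
        unfolding limit_leg_def using op.comp_assoc[OF _ e(1) op.limit_of_hom[OF Xo sP], of h w] that by simp
      from this[OF f'] this[OF g'] show ?thesis using eq 1 unfolding e(3) by simp
    next
      case 2
      have "leg (opcat C) X ev_map P s \<cdot>\<^bsub>opcat C\<^esub> h =
          (pow_prj (opcat C) X P s \<cdot>\<^bsub>opcat C\<^esub> net_of (opcat C) X P) \<cdot>\<^bsub>opcat C\<^esub> (ev_map P \<cdot>\<^bsub>opcat C\<^esub> h)"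
        if "h \<in> homset C (fobj F (net_space P)) w" for h
        unfolding leg_def using op.comp_assoc[OF _ e(1) op.net_pt_hom[OF Xo sP 2], of h w] that by simp
      from this[OF f'] this[OF g'] show ?thesis using eq unfolding e(2)[OF 2] by simp
    qed
  qed
qed

lemma ev_family: "net_family \<UU> (opcat C) X ev_map"
proof -
  have "Cod (opcat C) (ev_map P) = nets (opcat C) X P" if "small_directed P" for P
    using homsetD[OF ev_map_props(1)[OF that]] by blast
  then show ?thesis
    by (intro net_family.intro op.complete_cat_axioms net_family_axioms.intro)
      (use X_Obj ev_map_monic in auto)
qed

lemma ev_converges_iff:
  assumes P: "small_directed P"
  shows "converges (opcat C) X ev_map y P f l \<longleftrightarrow> extends (net_space P) y (f(infpt P := l))"
proof -
  note e = ev_map_props[OF P]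
  have d: "Cod C (ev_map P) = fobj F (net_space P)" using homsetD[OF e(1)] by simp
  have n: "infpt P \<notin> Field P" by (rule infpt_notin[OF P])
  have "(\<forall>s \<in> topspace (net_space P). u \<cdot> pt (net_space P) s = (f(infpt P := l)) s) \<longleftrightarrow>
      (\<forall>p \<in> Field P. u \<cdot> leg (opcat C) X ev_map P p = f p) \<and> u \<cdot> limit_leg (opcat C) X ev_map P = l" for u
    using e(2,3) n by (auto simp: topspace_net_space[OF P])
  then show ?thesis unfolding converges_def extends_def by (simp add: d)
qed

text \<open>
  Convergence at stage \<open>y\<close> is convergence in the topology on \<open>hom X y\<close> provided by
  \<open>extends_topology\<close>, because \<open>net_space P\<close> classifies convergent nets.
\<close>

theorem ev_topology: "is_topology (opcat C) X ev_map"
proof -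
  interpret ev: net_family \<UU> "opcat C" X ev_map by (rule ev_family)
  have "net_convergence (homset (opcat C) y X) (converges (opcat C) X ev_map y)"
    if "y \<in> Obj (opcat C)" for y
  proof -
    have "y \<in> Obj C" using that by simp
    from extends_topology[OF this] obtain \<tau> where top: "topspace \<tau> = homset C X y"
      and ext: "\<forall>T \<in> Obj TOP. \<forall>\<phi>. extends T y \<phi> \<longleftrightarrow> continuous_map T \<tau> \<phi>" by blast
    note \<tau> = top ext[rule_format]
    have c: "net_limit \<tau> P f l \<longleftrightarrow> converges (opcat C) X ev_map y P f l" if P: "small_directed P" for P f l
      unfolding ev_converges_iff[OF P] \<tau>(2)[OF net_space_Obj[OF P]]
      by (rule continuous_map_net_space'[OF P, symmetric])
    have "net_convergence (topspace \<tau>) (net_limit \<tau> :: 'u rel \<Rightarrow> _)"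
      by (rule net_limit_net_convergence)
    then show ?thesis using net_convergence_cong[OF c] by (simp add: \<tau>(1))
  qed
  then show ?thesis using ev.topology_iff_net_convergence[OF ev_map_extensional] by blast
qed

end

lemma comp_id_ftr: "comp_ftr id_ftr G = G"
  by (cases G) (simp add: comp_ftr_def id_ftr_def)

lemma cocontinuous_id: "is_functor A A id_ftr \<Longrightarrow> cocontinuous U A A id_ftr"
  unfolding cocontinuous_def comp_id_ftr by (simp add: id_ftr_def)

lemma id_functor: "category A \<Longrightarrow> is_functor A A id_ftr"
  by (simp add: is_functor_def id_ftr_def)

context universe begin

text \<open>
  The universal example is its own image under the identity functor.
\<close>

theorem universal_cospace_CoTop: "(universal_cospace :: 'u topology \<times> _) \<in> Obj (CoTop TOP)"
proof -
  interpret I: cocontinuous_on_TOP \<UU> "TOP :: ('u topology, _) cat" id_ftr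
    by (intro cocontinuous_on_TOP.intro cocontinuous_on_TOP_axioms.intro cocomplete_cat_TOP
        cocontinuous_id id_functor category_TOP)
  let ?E = "universal_cospace :: 'u topology \<times> _"
  have o: "point_space \<in> Obj (opcat (TOP :: ('u topology, _) cat))" using point_space_Obj by simp
  have "I.ev_map P = snd ?E P" if P: "small_directed P" for P
  proof (rule I.op.nets_eqI[OF o small_directedD(1)[OF P]])
    note u = universal_comps[OF P] and e = I.ev_map_props[OF P]
    show "I.ev_map P \<in> homset (opcat TOP) (net_space P) (nets (opcat TOP) point_space P)"
      using e(1) by (simp add: id_ftr_def)
    show "snd ?E P \<in> homset (opcat TOP) (net_space P) (nets (opcat TOP) point_space P)" by (rule u(1))
    show "\<forall>p\<in>Field P. (pow_prj (opcat TOP) point_space P p \<cdot>\<^bsub>opcat TOP\<^esub> net_of (opcat TOP) point_space P)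
         \<cdot>\<^bsub>opcat TOP\<^esub> I.ev_map P =
       (pow_prj (opcat TOP) point_space P p \<cdot>\<^bsub>opcat TOP\<^esub> net_of (opcat TOP) point_space P) \<cdot>\<^bsub>opcat TOP\<^esub> snd ?E P"
      using e(2) u(2) unfolding leg_def I.pt_def by (simp add: id_ftr_def)
    show "limit_of (opcat TOP) point_space P \<cdot>\<^bsub>opcat TOP\<^esub> I.ev_map P =
        limit_of (opcat TOP) point_space P \<cdot>\<^bsub>opcat TOP\<^esub> snd ?E P"
      using e(3) u(3) unfolding limit_leg_def I.pt_def by (simp add: id_ftr_def)
  qed
  moreover have "snd ?E \<in> extensional {P. small_directed P}" by (simp add: universal_cospace_def)
  ultimately have "I.ev_map = snd ?E"
    using I.ev_map_extensional by (intro extensionalityI[of _ "{P. small_directed P}"]) auto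
  moreover have "fst ?E = point_space" by (simp add: universal_cospace_def)
  ultimately show ?thesis using I.ev_topology by (simp add: I.CoTop_Obj id_ftr_def)
qed

end

section \<open>Evaluation is fully faithful\<close>

lemma cocontinuous_of_Hom_c: "F \<in> Obj (Hom_c U A B) \<Longrightarrow> cocontinuous U A B F"
  by (simp add: Hom_c_Obj)

locale two_functors = F: cocontinuous_on_TOP \<UU> C F + G: cocontinuous_on_TOP \<UU> C G
  for \<UU> :: "'u itself" and C :: "('o, 'm) cat" (structure) and F G
begin

lemma nat_pt:
  assumes \<eta>: "is_nat_trans TOP C F G \<eta>" and T: "T \<in> Obj TOP" and t: "t \<in> topspace T"
  shows "\<eta> T \<cdot> F.pt T t = G.pt T t \<cdot> \<eta> point_space"
  unfolding F.pt_def G.pt_def using nat_transD(4)[OF \<eta> F.point_of_hom[OF T t]] .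

lemma ev_arr_continuous:
  assumes \<eta>: "is_nat_trans TOP C F G \<eta>"
  shows "continuous_arr (opcat C) G.X G.ev_map (\<eta> point_space) F.X F.ev_map"
  unfolding continuous_arr_def
proof (intro ballI allI impI)
  fix w P g l assume P: "small_directed P" and c: "converges (opcat C) G.X G.ev_map w P g l"
  let ?S = "net_space P"
  have S: "?S \<in> Obj TOP" by (rule F.net_space_Obj[OF P])
  obtain u where u: "u \<in> homset C (fobj G ?S) w"
    "\<And>s. s \<in> topspace ?S \<Longrightarrow> u \<cdot> G.pt ?S s = (g(infpt P := l)) s"
    using c unfolding G.ev_converges_iff[OF P] G.extends_def by blast
  note \<eta>S = nat_transD(3)[OF \<eta> S] and \<eta>0 = nat_transD(3)[OF \<eta> F.point_space_Obj]
  have "(u \<cdot> \<eta> ?S) \<cdot> F.pt ?S s = (g(infpt P := l)) s \<cdot> \<eta> point_space" if s: "s \<in> topspace ?S" for s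
    using F.comp_assoc[OF F.pt_hom[OF S s] \<eta>S u(1)] nat_pt[OF \<eta> S s]
      F.comp_assoc[OF \<eta>0 G.pt_hom[OF S s] u(1)] u(2)[OF s] by simp
  then have "F.extends ?S w (\<lambda>s. (g(infpt P := l)) s \<cdot> \<eta> point_space)"
    unfolding F.extends_def using F.comp_hom[OF \<eta>S u(1)] by blast
  moreover have "(\<lambda>s. (g(infpt P := l)) s \<cdot> \<eta> point_space) =
      (\<lambda>p. g p \<cdot> \<eta> point_space)(infpt P := l \<cdot> \<eta> point_space)" by auto
  ultimately show "converges (opcat C) F.X F.ev_map w P (\<lambda>p. \<eta> point_space \<cdot>\<^bsub>opcat C\<^esub> g p)
      (\<eta> point_space \<cdot>\<^bsub>opcat C\<^esub> l)"
    unfolding F.ev_converges_iff[OF P] by simp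
qed

lemma nat_trans_unique:
  assumes \<eta>: "is_nat_trans TOP C F G \<eta>" "\<eta> \<in> extensional (Obj TOP)"
    and \<theta>: "is_nat_trans TOP C F G \<theta>" "\<theta> \<in> extensional (Obj TOP)"
    and eq: "\<eta> point_space = \<theta> point_space"
  shows "\<eta> = \<theta>"
proof (rule extensionalityI[OF \<eta>(2) \<theta>(2)])
  fix T :: "'u topology" assume T: "T \<in> Obj TOP"
  show "\<eta> T = \<theta> T"
    by (rule F.pt_epi[OF T nat_transD(3)[OF \<eta>(1) T] nat_transD(3)[OF \<theta>(1) T]])
      (simp add: nat_pt[OF \<eta>(1) T] nat_pt[OF \<theta>(1) T] eq)
qed

text \<open>
  The component at \<open>T\<close> has to be the family \<open>t \<mapsto> G t \<circ> \<phi>\<close>. That this family extends over \<open>F T\<close> can be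
  tested on convergent nets in \<open>T\<close>, and there it is the compatibility of \<open>\<phi>\<close> with the cotopologies.
\<close>

lemma nat_trans_exists:
  assumes \<phi>: "\<phi> \<in> homset C F.X G.X"
    and c: "continuous_arr (opcat C) G.X G.ev_map \<phi> F.X F.ev_map"
  shows "\<exists>\<eta>. is_nat_trans TOP C F G \<eta> \<and> \<eta> \<in> extensional (Obj TOP) \<and> \<eta> point_space = \<phi>"
proof -
  have hom: "G.pt T t \<cdot> \<phi> \<in> homset C F.X (fobj G T)" if "T \<in> Obj TOP" "t \<in> topspace T" for T t
    using F.comp_hom[OF \<phi> G.pt_hom[OF that]] .
  have "F.extends T (fobj G T) (\<lambda>t. G.pt T t \<cdot> \<phi>)" if T: "T \<in> Obj TOP" for T
  proof (rule F.extends_final[OF F.final_net_maps[OF T] T hom[OF T] G.F_Obj[OF T]])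
    fix S :: "'u topology" and g :: "'u \<Rightarrow> 'u" assume "(S, g) \<in> net_maps T"
    then obtain P where P: "small_directed P" "S = net_space P" "continuous_map (net_space P) T g"
      unfolding net_maps_def by blast
    have S: "net_space P \<in> Obj TOP" by (rule F.net_space_Obj[OF P(1)])
    have "G.extends T (fobj G T) (G.pt T)"
      unfolding G.extends_def
      using F.id_hom[OF G.F_Obj[OF T]] F.id_left[OF G.pt_hom[OF T]] by blast
    from G.extends_comp[OF S T P(3) this]
    have "G.extends (net_space P) (fobj G T) (\<lambda>s. G.pt T (g s))" .
    moreover have "(\<lambda>s. G.pt T (g s)) = (\<lambda>s. G.pt T (g s))(infpt P := G.pt T (g (infpt P)))" by auto
    ultimately have "converges (opcat C) G.X G.ev_map (fobj G T) P (\<lambda>s. G.pt T (g s)) (G.pt T (g (infpt P)))"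
      unfolding G.ev_converges_iff[OF P(1)] by simp
    then have "converges (opcat C) F.X F.ev_map (fobj G T) P (\<lambda>s. G.pt T (g s) \<cdot> \<phi>) (G.pt T (g (infpt P)) \<cdot> \<phi>)"
      using c P(1) G.F_Obj[OF T] unfolding continuous_arr_def by simp
    moreover have "(\<lambda>s. G.pt T (g s) \<cdot> \<phi>)(infpt P := G.pt T (g (infpt P)) \<cdot> \<phi>) = (\<lambda>s. G.pt T (g s) \<cdot> \<phi>)" by auto
    ultimately show "F.extends S (fobj G T) (\<lambda>s. G.pt T (g s) \<cdot> \<phi>)"
      unfolding F.ev_converges_iff[OF P(1)] P(2) by simp
  qed
  then have "\<forall>T \<in> Obj TOP. \<exists>u. u \<in> homset C (fobj F T) (fobj G T) \<and>
      (\<forall>t \<in> topspace T. u \<cdot> F.pt T t = G.pt T t \<cdot> \<phi>)"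
    unfolding F.extends_def by blast
  from bchoice[OF this] obtain u where u: "\<forall>T \<in> Obj TOP. u T \<in> homset C (fobj F T) (fobj G T) \<and>
      (\<forall>t \<in> topspace T. u T \<cdot> F.pt T t = G.pt T t \<cdot> \<phi>)" ..
  define \<eta> where "\<eta> = restrict u (Obj TOP)"
  have \<eta>: "\<eta> T \<in> homset C (fobj F T) (fobj G T)" "\<And>t. t \<in> topspace T \<Longrightarrow> \<eta> T \<cdot> F.pt T t = G.pt T t \<cdot> \<phi>"
    if "T \<in> Obj TOP" for T using u that unfolding \<eta>_def by auto
  have "is_nat_trans TOP C F G \<eta>"
    unfolding is_nat_trans_def
  proof (intro conjI F.F G.F ballI allI)
    show "\<eta> T \<in> homset C (fobj F T) (fobj G T)" if "T \<in> Obj TOP" for T using \<eta>(1)[OF that] .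
    fix S T and a :: "'u topology \<times> ('u \<Rightarrow> 'u) \<times> 'u topology" assume a: "a \<in> homset TOP S T"
    then obtain f where f: "a = top_arr S T f" "continuous_map S T f" "S \<in> Obj TOP" "T \<in> Obj TOP"
      by (elim top_arrE)
    note Fa = functorD(4)[OF F.F a] and Ga = functorD(4)[OF G.F a]
    show "\<eta> T \<cdot> farr F a = farr G a \<cdot> \<eta> S"
    proof (rule F.pt_epi[OF f(3) F.comp_hom[OF Fa \<eta>(1)[OF f(4)]] F.comp_hom[OF \<eta>(1)[OF f(3)] Ga]])
      fix s assume s: "s \<in> topspace S"
      have fs: "f s \<in> topspace T" using continuous_map_in[OF f(2) s] .
      have "(\<eta> T \<cdot> farr F a) \<cdot> F.pt S s = G.pt T (f s) \<cdot> \<phi>"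
        using F.comp_assoc[OF F.pt_hom[OF f(3) s] Fa \<eta>(1)[OF f(4)]]
          F.arr_pt[OF f(3,4,2) s] \<eta>(2)[OF f(4) fs] f(1) by simp
      moreover have "(farr G a \<cdot> \<eta> S) \<cdot> F.pt S s = G.pt T (f s) \<cdot> \<phi>"
        using F.comp_assoc[OF F.pt_hom[OF f(3) s] \<eta>(1)[OF f(3)] Ga] \<eta>(2)[OF f(3) s]
          F.comp_assoc[OF \<phi> G.pt_hom[OF f(3) s] Ga] G.arr_pt[OF f(3,4,2) s] f(1) by simp
      ultimately show "(\<eta> T \<cdot> farr F a) \<cdot> F.pt S s = (farr G a \<cdot> \<eta> S) \<cdot> F.pt S s" by simp
    qed
  qed
  moreover have "\<eta> \<in> extensional (Obj TOP)" by (simp add: \<eta>_def)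
  moreover have "\<eta> point_space = \<phi>"
  proof -
    have "point_of point_space undefined = Id TOP (point_space :: 'u topology)"
      unfolding point_of_eq TOP_Id by (rule top_arr_cong) (simp add: topspace_point_space)
    then have "F.pt point_space undefined = Id C F.X" "G.pt point_space undefined = Id C G.X"
      unfolding F.pt_def G.pt_def
      using functorD(5)[OF F.F F.point_space_Obj] functorD(5)[OF G.F F.point_space_Obj] by simp_all
    then show ?thesis
      using \<eta>[OF F.point_space_Obj] F.id_right F.id_left[OF \<phi>] by (simp add: topspace_point_space)
  qed
  ultimately show ?thesis by blast
qed

end

context cocomplete_cat begin

abbreviation "HOM \<equiv> Hom_c TYPE('u) (TOP :: ('u topology, _) cat) C"

lemma cocontinuous_on_TOP:
  "F \<in> Obj (HOM) \<Longrightarrow> cocontinuous_on_TOP \<UU> C F"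
  by (intro cocontinuous_on_TOP.intro cocontinuous_on_TOP_axioms.intro cocomplete_cat_axioms)
    (rule cocontinuous_of_Hom_c)

abbreviation "ev \<equiv> evaluation (TOP :: ('u topology, _) cat) C universal_cospace"

lemma ev_arr: "farr ev (F, \<eta>, G) = (fobj ev G, \<eta> point_space, fobj ev F)"
  by (simp add: evaluation_def universal_cospace_def)

lemma ev_hom:
  assumes "a \<in> homset (HOM) F G"
  shows "farr ev a \<in> homset (CoTop C) (fobj ev F) (fobj ev G)"
proof -
  obtain \<eta> where a: "a = (F, \<eta>, G)" "is_nat_trans TOP C F G \<eta>"
    and FG: "F \<in> Obj (HOM)" "G \<in> Obj (HOM)"
    using assms unfolding Hom_c_homset by blast
  interpret F: cocontinuous_on_TOP \<UU> C F by (rule cocontinuous_on_TOP[OF FG(1)])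
  interpret G: cocontinuous_on_TOP \<UU> C G by (rule cocontinuous_on_TOP[OF FG(2)])
  interpret two_functors \<UU> C F G by unfold_locales
  have e: "fobj ev F = (F.X, F.ev_map)" "fobj ev G = (G.X, G.ev_map)"
    using F.ev_eq G.ev_eq by (simp_all add: evaluation_def)
  show ?thesis
    unfolding a(1) ev_arr CoTop_homset e
    using F.ev_topology G.ev_topology ev_arr_continuous[OF a(2)]
      nat_transD(3)[OF a(2) point_space_Obj] by simp
qed

lemma category_CoTop: "category (CoTop C :: ('o \<times> ('u rel \<Rightarrow> 'm), _) cat)"
  unfolding CoTop_def using category.opcat_category[OF op.category_Top_in] .

theorem ev_functor: "is_functor (HOM) (CoTop C) ev"
  unfolding is_functor_def
proof (intro conjI ballI allI)
  show "category (HOM)"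
    by (rule category_Hom_c[OF category_TOP category_axioms])
  show "category (CoTop C :: ('o \<times> ('u rel \<Rightarrow> 'm), _) cat)" by (rule category_CoTop)
next
  fix F assume "F \<in> Obj (HOM)"
  then interpret F: cocontinuous_on_TOP \<UU> C F by (rule cocontinuous_on_TOP)
  show "fobj ev F \<in> Obj (CoTop C)"
    using F.ev_topology by (simp add: evaluation_def CoTop_Obj F.ev_eq)
  show "farr ev (Id (HOM) F) = Id (CoTop C) (fobj ev F)"
    unfolding Hom_c_simps ev_arr CoTop_simps using point_space_Obj by (simp add: evaluation_def F.ev_eq)
next
  fix F G a assume "a \<in> homset (HOM) F G"
  then show "farr ev a \<in> homset (CoTop C) (fobj ev F) (fobj ev G)" by (rule ev_hom)
next
  fix F G H a b assume "a \<in> homset (HOM) F G" "b \<in> homset (HOM) G H"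
  then obtain \<eta> \<theta> where "a = (F, \<eta>, G)" "b = (G, \<theta>, H)" unfolding Hom_c_homset by blast
  then show "farr ev (b \<cdot>\<^bsub>HOM\<^esub> a) = farr ev b \<cdot>\<^bsub>CoTop C\<^esub> farr ev a"
    using point_space_Obj by (simp add: Hom_c_simps ev_arr CoTop_simps)
qed

theorem ev_fully_faithful:
  assumes "F \<in> Obj (HOM)" "G \<in> Obj (HOM)"
  shows "bij_betw (farr ev) (homset (HOM) F G) (homset (CoTop C) (fobj ev F) (fobj ev G))"
proof -
  interpret F: cocontinuous_on_TOP \<UU> C F by (rule cocontinuous_on_TOP[OF assms(1)])
  interpret G: cocontinuous_on_TOP \<UU> C G by (rule cocontinuous_on_TOP[OF assms(2)])
  interpret two_functors \<UU> C F G by unfold_locales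
  have e: "fobj ev F = (F.X, F.ev_map)" "fobj ev G = (G.X, G.ev_map)"
    using F.ev_eq G.ev_eq by (simp_all add: evaluation_def)
  show ?thesis
    unfolding bij_betw_def
  proof (intro conjI inj_onI equalityI subsetI)
    fix a b assume a: "a \<in> homset (HOM) F G" and b: "b \<in> homset (HOM) F G"
      and eq: "farr ev a = farr ev b"
    obtain \<eta> where \<eta>: "a = (F, \<eta>, G)" "is_nat_trans TOP C F G \<eta>" "\<eta> \<in> extensional (Obj TOP)"
      using a unfolding Hom_c_homset by blast
    obtain \<theta> where \<theta>: "b = (F, \<theta>, G)" "is_nat_trans TOP C F G \<theta>" "\<theta> \<in> extensional (Obj TOP)"
      using b unfolding Hom_c_homset by blast
    have "\<eta> point_space = \<theta> point_space" using eq unfolding \<eta>(1) \<theta>(1) ev_arr by simp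
    then show "a = b" using nat_trans_unique[OF \<eta>(2,3) \<theta>(2,3)] \<eta>(1) \<theta>(1) by simp
  next
    fix b assume "b \<in> farr ev ` homset (HOM) F G"
    then show "b \<in> homset (CoTop C) (fobj ev F) (fobj ev G)" using ev_hom by blast
  next
    fix b assume "b \<in> homset (CoTop C) (fobj ev F) (fobj ev G)"
    then obtain \<phi> where \<phi>: "b = (fobj ev G, \<phi>, fobj ev F)" "\<phi> \<in> homset C F.X G.X"
      "continuous_arr (opcat C) G.X G.ev_map \<phi> F.X F.ev_map"
      unfolding CoTop_homset e by auto
    obtain \<eta> where \<eta>: "is_nat_trans TOP C F G \<eta>" "\<eta> \<in> extensional (Obj TOP)" "\<eta> point_space = \<phi>"
      using nat_trans_exists[OF \<phi>(2,3)] by blast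
    have "(F, \<eta>, G) \<in> homset (HOM) F G"
      unfolding Hom_c_homset using assms \<eta> by blast
    moreover have "farr ev (F, \<eta>, G) = b" unfolding ev_arr \<phi>(1) \<eta>(3) ..
    ultimately show "b \<in> farr ev ` homset (HOM) F G" by blast
  qed
qed

end

section \<open>The functor classified by a cotopological space\<close>

locale cotopological_space = cocomplete_cat \<UU> C for \<UU> :: "'u itself" and C :: "('o, 'm) cat" (structure) +
  fixes X :: 'o and \<iota> :: "'u rel \<Rightarrow> 'm"
  assumes cotop: "is_topology (opcat C) X \<iota>"
begin

sublocale fam: net_family \<UU> "opcat C" X \<iota>
  by (rule topology_net_family[OF op.complete_cat_axioms cotop])

lemma X_Obj: "X \<in> Obj C"
  using fam.X by simp

lemma hom_topology_exists:
  assumes "y \<in> Obj C"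
  shows "\<exists>T. topspace T = homset C X y \<and>
    (\<forall>P f l. small_directed P \<longrightarrow> converges (opcat C) X \<iota> y P f l \<longleftrightarrow> net_limit T P f l)"
proof -
  have "\<iota> \<in> extensional {P. small_directed P}" using cotop by (simp add: is_topology_def)
  then have "net_convergence (homset (opcat C) y X) (converges (opcat C) X \<iota> y)"
    using fam.topology_iff_net_convergence cotop assms by simp
  then have "net_convergence (homset C X y) (converges (opcat C) X \<iota> y)" by simp
  from net_convergence_topology[OF this] show ?thesis by metis
qed

definition hom_top :: "'o \<Rightarrow> 'm topology" where
  "hom_top y = (SOME T. topspace T = homset C X y \<and>
    (\<forall>P f l. small_directed P \<longrightarrow> converges (opcat C) X \<iota> y P f l \<longleftrightarrow> net_limit T P f l))"

lemma hom_top: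
  assumes "y \<in> Obj C"
  shows "topspace (hom_top y) = homset C X y"
    "small_directed P \<Longrightarrow> converges (opcat C) X \<iota> y P f l \<longleftrightarrow> net_limit (hom_top y) P f l"
  using someI_ex[OF hom_topology_exists[OF assms], folded hom_top_def] by blast+

text \<open>
  \<open>z\<close> represents the functor that sends \<open>y\<close> to the set of continuous maps from \<open>S\<close> to \<open>hom X y\<close>, with
  \<open>e\<close> as universal element; such a \<open>z\<close> is the value at \<open>S\<close> of the functor to be constructed, the left
  adjoint of \<open>y \<mapsto> hom X y\<close>. Existence of \<open>u\<close> is stated as an equivalence, which includes the continuity
  of \<open>e\<close> and of its composites with morphisms \<open>z \<rightarrow> y\<close>; uniqueness is a separate clause.
\<close>

definition represents :: "'u topology \<Rightarrow> 'o \<Rightarrow> ('u \<Rightarrow> 'm) \<Rightarrow> bool" where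
  "represents S z e \<longleftrightarrow> z \<in> Obj C \<and> (\<forall>s \<in> topspace S. e s \<in> homset C X z) \<and>
     (\<forall>y \<in> Obj C. \<forall>\<phi>. continuous_map S (hom_top y) \<phi> \<longleftrightarrow>
        (\<exists>u \<in> homset C z y. \<forall>s \<in> topspace S. u \<cdot> e s = \<phi> s)) \<and>
     (\<forall>y. \<forall>u \<in> homset C z y. \<forall>v \<in> homset C z y.
        (\<forall>s \<in> topspace S. u \<cdot> e s = v \<cdot> e s) \<longrightarrow> u = v)"

lemma representsD:
  assumes "represents S z e"
  shows "z \<in> Obj C" "s \<in> topspace S \<Longrightarrow> e s \<in> homset C X z"
    "y \<in> Obj C \<Longrightarrow> continuous_map S (hom_top y) \<phi> \<Longrightarrow>
      \<exists>u \<in> homset C z y. \<forall>s \<in> topspace S. u \<cdot> e s = \<phi> s"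
    "u \<in> homset C z y \<Longrightarrow> continuous_map S (hom_top y) (\<lambda>s. u \<cdot> e s)"
    "u \<in> homset C z y \<Longrightarrow> v \<in> homset C z y \<Longrightarrow>
      (\<And>s. s \<in> topspace S \<Longrightarrow> u \<cdot> e s = v \<cdot> e s) \<Longrightarrow> u = v"
proof -
  note r = assms[unfolded represents_def]
  show "z \<in> Obj C" using r by blast
  show "s \<in> topspace S \<Longrightarrow> e s \<in> homset C X z" using r by blast
  show "y \<in> Obj C \<Longrightarrow> continuous_map S (hom_top y) \<phi> \<Longrightarrow>
      \<exists>u \<in> homset C z y. \<forall>s \<in> topspace S. u \<cdot> e s = \<phi> s" using r by blast
  show "continuous_map S (hom_top y) (\<lambda>s. u \<cdot> e s)" if u: "u \<in> homset C z y"
  proof -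
    have "\<exists>u' \<in> homset C z y. \<forall>s \<in> topspace S. u' \<cdot> e s = u \<cdot> e s" using u by blast
    moreover have "y \<in> Obj C" using hom_obj[OF u] by blast
    ultimately show ?thesis using r by blast
  qed
  show "u \<in> homset C z y \<Longrightarrow> v \<in> homset C z y \<Longrightarrow>
      (\<And>s. s \<in> topspace S \<Longrightarrow> u \<cdot> e s = v \<cdot> e s) \<Longrightarrow> u = v" using r by blast
qed

lemma represents_iso:
  assumes r: "represents S z e" and r': "represents S z' e'"
  obtains j k where "j \<in> homset C z z'" "k \<in> homset C z' z" "k \<cdot> j = Id C z" "j \<cdot> k = Id C z'"
    "\<And>s. s \<in> topspace S \<Longrightarrow> j \<cdot> e s = e' s"
proof -
  have *: "\<exists>j \<in> homset C z z'. \<forall>s \<in> topspace S. j \<cdot> e s = e' s"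
    if r: "represents S z e" and r': "represents S z' e'" for z z' e e'
  proof (rule representsD(3)[OF r representsD(1)[OF r']])
    have "continuous_map S (hom_top z') (\<lambda>s. Id C z' \<cdot> e' s)"
      by (rule representsD(4)[OF r' id_hom[OF representsD(1)[OF r']]])
    then show "continuous_map S (hom_top z') e'"
      by (rule continuous_map_eq) (rule id_left[OF representsD(2)[OF r']])
  qed
  obtain j where j: "j \<in> homset C z z'" "\<And>s. s \<in> topspace S \<Longrightarrow> j \<cdot> e s = e' s" using *[OF r r'] by blast
  obtain k where k: "k \<in> homset C z' z" "\<And>s. s \<in> topspace S \<Longrightarrow> k \<cdot> e' s = e s" using *[OF r' r] by blast
  have "k \<cdot> j = Id C z"
  proof (rule representsD(5)[OF r comp_hom[OF j(1) k(1)] id_hom[OF representsD(1)[OF r]]])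
    fix s assume s: "s \<in> topspace S"
    show "(k \<cdot> j) \<cdot> e s = Id C z \<cdot> e s"
      using comp_assoc[OF representsD(2)[OF r s] j(1) k(1)] j(2)[OF s] k(2)[OF s]
        id_left[OF representsD(2)[OF r s]] by simp
  qed
  moreover have "j \<cdot> k = Id C z'"
  proof (rule representsD(5)[OF r' comp_hom[OF k(1) j(1)] id_hom[OF representsD(1)[OF r']]])
    fix s assume s: "s \<in> topspace S"
    show "(j \<cdot> k) \<cdot> e' s = Id C z' \<cdot> e' s"
      using comp_assoc[OF representsD(2)[OF r' s] k(1) j(1)] j(2)[OF s] k(2)[OF s]
        id_left[OF representsD(2)[OF r' s]] by simp
  qed
  ultimately show ?thesis using that j k(1) by blast
qed

lemma point_represented: "represents point_space X (\<lambda>_. Id C X)"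
  unfolding represents_def
proof (intro conjI X_Obj ballI allI impI iffI)
  fix y \<phi> assume y: "y \<in> Obj C" and c: "continuous_map point_space (hom_top y) \<phi>"
  have "\<phi> undefined \<in> homset C X y"
    using continuous_map_in[OF c] hom_top(1)[OF y] by (simp add: topspace_point_space)
  then show "\<exists>u\<in>homset C X y. \<forall>s\<in>topspace point_space. u \<cdot> Id C X = \<phi> s"
    using id_right by (intro bexI[of _ "\<phi> undefined"]) (auto simp: topspace_point_space)
next
  fix y and \<phi> :: "'u \<Rightarrow> 'm"
  assume y: "y \<in> Obj C" and "\<exists>u\<in>homset C X y. \<forall>s\<in>topspace point_space. u \<cdot> Id C X = \<phi> s"
  then have "\<phi> undefined \<in> homset C X y" using id_right by (auto simp: topspace_point_space)
  then show "continuous_map point_space (hom_top y) \<phi>"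
    using hom_top(1)[OF y] by (simp add: point_space_def)
next
  fix y u v assume "u \<in> homset C X y" "v \<in> homset C X y"
    "\<forall>s\<in>topspace point_space. u \<cdot> Id C X = v \<cdot> Id C X"
  then show "u = v" using id_right by (simp add: topspace_point_space)
qed (use id_hom X_Obj in auto)

text \<open>
  Continuous maps from \<open>net_space P\<close> are convergent nets, and these are represented by \<open>C(P,X)\<close> by definition.
\<close>

lemma net_space_represented:
  assumes P: "small_directed P"
  shows "represents (net_space P) (Cod C (\<iota> P))
     ((leg (opcat C) X \<iota> P)(infpt P := limit_leg (opcat C) X \<iota> P))" (is "represents ?S ?z ?e")
proof -
  note n = infpt_notin[OF P] and top = topspace_net_space[OF P]
  have leg: "\<And>p. p \<in> Field P \<Longrightarrow> leg (opcat C) X \<iota> P p \<in> homset C X ?z"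
    "limit_leg (opcat C) X \<iota> P \<in> homset C X ?z"
    using fam.leg_hom[OF P] fam.limit_leg_hom[OF P] by simp_all
  have all: "(\<forall>s \<in> topspace ?S. R s) \<longleftrightarrow> (\<forall>p \<in> Field P. R p) \<and> R (infpt P)" for R
    unfolding top by auto
  have legs: "(\<forall>s \<in> topspace ?S. R (?e s) s) \<longleftrightarrow>
      (\<forall>p \<in> Field P. R (leg (opcat C) X \<iota> P p) p) \<and> R (limit_leg (opcat C) X \<iota> P) (infpt P)" for R
    using n unfolding all by auto
  show ?thesis
    unfolding represents_def
  proof (intro conjI ballI allI impI)
    show z: "?z \<in> Obj C" using hom_obj[OF leg(2)] by blast
    show "?e s \<in> homset C X ?z" if "s \<in> topspace ?S" for s
      using that leg unfolding top by auto
    show "continuous_map ?S (hom_top y) \<phi> \<longleftrightarrow> (\<exists>u\<in>homset C ?z y. \<forall>s\<in>topspace ?S. u \<cdot> ?e s = \<phi> s)"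
      if y: "y \<in> Obj C" for y \<phi>
      unfolding continuous_map_net_space[OF P] hom_top(2)[OF y P, symmetric] converges_def
        legs[of "\<lambda>l s. _ \<cdot> l = \<phi> s"] by simp
    fix y u v assume u: "u \<in> homset C ?z y" and v: "v \<in> homset C ?z y"
      and eq: "\<forall>s\<in>topspace ?S. u \<cdot> ?e s = v \<cdot> ?e s"
    have u': "u \<in> homset (opcat C) y (Dom (opcat C) (\<iota> P))" and v': "v \<in> homset (opcat C) y (Dom (opcat C) (\<iota> P))"
      using u v by simp_all
    have e: "\<forall>p\<in>Field P. leg (opcat C) X \<iota> P p \<cdot>\<^bsub>opcat C\<^esub> u = leg (opcat C) X \<iota> P p \<cdot>\<^bsub>opcat C\<^esub> v"
      "limit_leg (opcat C) X \<iota> P \<cdot>\<^bsub>opcat C\<^esub> u = limit_leg (opcat C) X \<iota> P \<cdot>\<^bsub>opcat C\<^esub> v"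
      using eq unfolding legs[of "\<lambda>l s. u \<cdot> l = v \<cdot> l"] by simp_all
    have "\<iota> P \<cdot>\<^bsub>opcat C\<^esub> u = \<iota> P \<cdot>\<^bsub>opcat C\<^esub> v"
    proof (rule op.nets_eqI[OF fam.X small_directedD(1)[OF P]
          op.comp_hom[OF u' fam.iota_hom[OF P]] op.comp_hom[OF v' fam.iota_hom[OF P]]])
      show "\<forall>p\<in>Field P. (pow_prj (opcat C) X P p \<cdot>\<^bsub>opcat C\<^esub> net_of (opcat C) X P) \<cdot>\<^bsub>opcat C\<^esub> (\<iota> P \<cdot>\<^bsub>opcat C\<^esub> u) =
          (pow_prj (opcat C) X P p \<cdot>\<^bsub>opcat C\<^esub> net_of (opcat C) X P) \<cdot>\<^bsub>opcat C\<^esub> (\<iota> P \<cdot>\<^bsub>opcat C\<^esub> v)"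
        using e(1) fam.leg_comp(1)[OF P u'] fam.leg_comp(1)[OF P v'] by metis
      show "limit_of (opcat C) X P \<cdot>\<^bsub>opcat C\<^esub> (\<iota> P \<cdot>\<^bsub>opcat C\<^esub> u) =
          limit_of (opcat C) X P \<cdot>\<^bsub>opcat C\<^esub> (\<iota> P \<cdot>\<^bsub>opcat C\<^esub> v)"
        using e(2) fam.leg_comp(2)[OF P u'] fam.leg_comp(2)[OF P v'] by metis
    qed
    then show "u = v" using fam.mon[OF P] u' v' unfolding monic_def by blast
  qed
qed

text \<open>
  As \<open>T\<close> is a colimit of its points and of the domains of a final family, the object in question is the
  colimit of copies of \<open>X\<close> and of the objects representing these domains; a small subfamily suffices.
\<close>

lemma final_represented:
  assumes K: "final_maps T K" and T: "T \<in> Obj TOP"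
    and rep: "\<And>S g. (S, g) \<in> K \<Longrightarrow> \<exists>z e. represents S z e"
  shows "\<exists>z e. represents T z e"
proof -
  obtain K' where K': "K' \<subseteq> K" "small TYPE('u) K'" "final_maps T K'" using final_maps_small[OF K T] .
  have "\<forall>k \<in> K'. \<exists>ze. represents (fst k) (fst ze) (snd ze)"
  proof
    fix k assume "k \<in> K'"
    then have "(fst k, snd k) \<in> K" using K'(1) by auto
    from rep[OF this] show "\<exists>ze. represents (fst k) (fst ze) (snd ze)" by auto
  qed
  from bchoice[OF this] obtain ze where ze: "\<forall>k \<in> K'. represents (fst k) (fst (ze k)) (snd (ze k))" ..
  define z where "z k = fst (ze k)" for k
  define e where "e k = snd (ze k)" for k
  have r: "represents (fst k) (z k) (e k)" if "k \<in> K'" for k using ze that by (simp add: z_def e_def)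
  have gT: "snd k s \<in> topspace T" if "k \<in> K'" "s \<in> topspace (fst k)" for k s
    using continuous_map_in[OF final_mapsD(2)[OF K'(3), of "fst k" "snd k"]] that by simp
  have sT: "small TYPE('u) (topspace T)" using T by (simp add: TOP_Obj)
  let ?E = "Sigma K' (\<lambda>k. topspace (fst k))"
  have "small TYPE('u) (topspace (fst k))" if "k \<in> K'" for k
    using final_mapsD(1)[OF K'(3), of "fst k" "snd k"] that by (simp add: TOP_Obj)
  then have sE: "small TYPE('u) ?E" by (rule small_Sigma[OF K'(2)])
  have d: "bip_diagram C (topspace T) K' ?E (\<lambda>(k, s). snd k s) fst (\<lambda>_. X) z (\<lambda>(k, s). e k s)"
    by (intro bip_diagram.intro category_axioms bip_diagram_axioms.intro)
      (use gT X_Obj representsD(1)[OF r] representsD(2)[OF r] in auto)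
  obtain x \<alpha> \<beta> where co: "bip_colimit C (topspace T) K' ?E (\<lambda>(k, s). snd k s) fst (\<lambda>_. X) z
      (\<lambda>(k, s). e k s) x \<alpha> \<beta>"
    using cocomplete_bip[OF d cocomplete sT K'(2) sE] .
  have x: "x \<in> Obj C" and \<alpha>: "\<And>t. t \<in> topspace T \<Longrightarrow> \<alpha> t \<in> homset C X x"
    and \<beta>: "\<And>k. k \<in> K' \<Longrightarrow> \<beta> k \<in> homset C (z k) x"
    using co unfolding bip_colimit_def bip_cocone_def by auto
  have "\<forall>c \<in> ?E. \<beta> (fst c) \<cdot> (case c of (k, s) \<Rightarrow> e k s) = \<alpha> (case c of (k, s) \<Rightarrow> snd k s)"
    using co unfolding bip_colimit_def bip_cocone_def by (elim conjE)
  then have \<beta>e: "\<beta> k \<cdot> e k s = \<alpha> (snd k s)" if "k \<in> K'" "s \<in> topspace (fst k)" for k s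
    using bspec[of ?E _ "(k, s)"] that by fastforce
  have univ: "\<exists>!u. u \<in> homset C x y \<and> (\<forall>a \<in> topspace T. u \<cdot> \<alpha> a = \<alpha>' a) \<and> (\<forall>b \<in> K'. u \<cdot> \<beta> b = \<beta>' b)"
    if "bip_cocone C (topspace T) K' ?E (\<lambda>(k, s). snd k s) fst (\<lambda>_. X) z (\<lambda>(k, s). e k s) y \<alpha>' \<beta>'" for y \<alpha>' \<beta>'
    using co that unfolding bip_colimit_def by blast
  have "represents T x \<alpha>"
    unfolding represents_def
  proof (intro conjI x ballI \<alpha> allI iffI impI)
    fix y \<phi> assume y: "y \<in> Obj C" and \<phi>: "continuous_map T (hom_top y) \<phi>"
    have "\<forall>k \<in> K'. \<exists>b. b \<in> homset C (z k) y \<and> (\<forall>s \<in> topspace (fst k). b \<cdot> e k s = \<phi> (snd k s))"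
    proof
      fix k assume k: "k \<in> K'"
      have "continuous_map (fst k) T (snd k)" using final_mapsD(2)[OF K'(3), of "fst k" "snd k"] k by simp
      from continuous_map_compose[OF this \<phi>]
      have "continuous_map (fst k) (hom_top y) (\<lambda>s. \<phi> (snd k s))" by (simp add: comp_def)
      from representsD(3)[OF r[OF k] y this]
      show "\<exists>b. b \<in> homset C (z k) y \<and> (\<forall>s \<in> topspace (fst k). b \<cdot> e k s = \<phi> (snd k s))" by blast
    qed
    from bchoice[OF this] obtain b where b: "\<forall>k \<in> K'. b k \<in> homset C (z k) y \<and>
        (\<forall>s \<in> topspace (fst k). b k \<cdot> e k s = \<phi> (snd k s))" ..
    have "bip_cocone C (topspace T) K' ?E (\<lambda>(k, s). snd k s) fst (\<lambda>_. X) z (\<lambda>(k, s). e k s) y \<phi> b"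
      unfolding bip_cocone_def
      using y b continuous_map_in[OF \<phi>] hom_top(1)[OF y] by auto
    from univ[OF this] show "\<exists>u\<in>homset C x y. \<forall>s\<in>topspace T. u \<cdot> \<alpha> s = \<phi> s" by blast
  next
    fix y \<phi> assume y: "y \<in> Obj C" and "\<exists>u\<in>homset C x y. \<forall>s\<in>topspace T. u \<cdot> \<alpha> s = \<phi> s"
    then obtain u where u: "u \<in> homset C x y" "\<And>t. t \<in> topspace T \<Longrightarrow> u \<cdot> \<alpha> t = \<phi> t" by blast
    show "continuous_map T (hom_top y) \<phi>"
    proof (rule final_maps_continuous[OF K'(3)])
      show "\<phi> ` topspace T \<subseteq> topspace (hom_top y)"
      proof (rule image_subsetI)
        fix t assume t: "t \<in> topspace T"
        show "\<phi> t \<in> topspace (hom_top y)"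
          using comp_hom[OF \<alpha>[OF t] u(1)] u(2)[OF t] hom_top(1)[OF y] by simp
      qed
      fix S g assume k: "(S, g) \<in> K'"
      have "continuous_map S (hom_top y) (\<lambda>s. (u \<cdot> \<beta> (S, g)) \<cdot> e (S, g) s)"
        using representsD(4)[OF r[OF k] comp_hom[OF \<beta>[OF k] u(1)]] by simp
      then show "continuous_map S (hom_top y) (\<lambda>s. \<phi> (g s))"
      proof (rule continuous_map_eq)
        fix s assume s: "s \<in> topspace S"
        have es: "e (S, g) s \<in> homset C X (z (S, g))" using representsD(2)[OF r[OF k], of s] s by simp
        show "(u \<cdot> \<beta> (S, g)) \<cdot> e (S, g) s = \<phi> (g s)"
          using comp_assoc[OF es \<beta>[OF k] u(1)] \<beta>e[OF k, of s] s u(2) gT[OF k, of s] by simp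
      qed
    qed
  next
    fix y u v assume u: "u \<in> homset C x y" and v: "v \<in> homset C x y"
      and eq: "\<forall>s\<in>topspace T. u \<cdot> \<alpha> s = v \<cdot> \<alpha> s"
    have y: "y \<in> Obj C" using hom_obj[OF u] by blast
    have \<beta>eq: "u \<cdot> \<beta> k = v \<cdot> \<beta> k" if k: "k \<in> K'" for k
    proof (rule representsD(5)[OF r[OF k] comp_hom[OF \<beta>[OF k] u] comp_hom[OF \<beta>[OF k] v]])
      fix s assume s: "s \<in> topspace (fst k)"
      show "(u \<cdot> \<beta> k) \<cdot> e k s = (v \<cdot> \<beta> k) \<cdot> e k s"
        using comp_assoc[OF representsD(2)[OF r[OF k] s] \<beta>[OF k] u]
          comp_assoc[OF representsD(2)[OF r[OF k] s] \<beta>[OF k] v] \<beta>e[OF k s] eq gT[OF k s] by simp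
    qed
    have ue: "(u \<cdot> \<beta> k) \<cdot> e k s = u \<cdot> \<alpha> (snd k s)" if "k \<in> K'" "s \<in> topspace (fst k)" for k s
      using comp_assoc[OF representsD(2)[OF r[OF that(1)] that(2)] \<beta>[OF that(1)] u] \<beta>e[OF that] by simp
    have "bip_cocone C (topspace T) K' ?E (\<lambda>(k, s). snd k s) fst (\<lambda>_. X) z (\<lambda>(k, s). e k s) y
        (\<lambda>t. u \<cdot> \<alpha> t) (\<lambda>k. u \<cdot> \<beta> k)"
      unfolding bip_cocone_def using y comp_hom[OF \<alpha> u] comp_hom[OF \<beta> u] ue by auto
    from univ[OF this] show "u = v" using u v eq \<beta>eq by (metis (no_types, lifting))
  qed
  then show ?thesis by blast
qed

lemma space_represented:
  assumes T: "T \<in> Obj TOP"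
  shows "\<exists>z e. represents T z e"
proof (rule final_represented[OF final_net_maps[OF T] T])
  fix S g assume "(S, g) \<in> net_maps T"
  then obtain P where P: "small_directed P" "S = net_space P" unfolding net_maps_def by blast
  show "\<exists>z e. represents S z e" unfolding P(2) using net_space_represented[OF P(1)] by blast
qed

definition rep :: "'u topology \<Rightarrow> 'o \<times> ('u \<Rightarrow> 'm)" where
  "rep T = (SOME ze. represents T (fst ze) (snd ze))"

definition rep_obj :: "'u topology \<Rightarrow> 'o" where "rep_obj T = fst (rep T)"

definition rep_pt :: "'u topology \<Rightarrow> 'u \<Rightarrow> 'm" where "rep_pt T = snd (rep T)"

lemma rep:
  assumes "T \<in> Obj TOP"
  shows "represents T (rep_obj T) (rep_pt T)"
proof -
  have "\<exists>ze. represents T (fst ze) (snd ze)" using space_represented[OF assms] by auto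
  from someI_ex[OF this] show ?thesis unfolding rep_obj_def rep_pt_def rep_def .
qed

definition rep_arr :: "'u topology \<times> ('u \<Rightarrow> 'u) \<times> 'u topology \<Rightarrow> 'm" where
  "rep_arr = (\<lambda>(S, f, T). THE u. u \<in> homset C (rep_obj S) (rep_obj T) \<and>
     (\<forall>s \<in> topspace S. u \<cdot> rep_pt S s = rep_pt T (f s)))"

definition classified :: "('u topology, 'u topology \<times> ('u \<Rightarrow> 'u) \<times> 'u topology, 'o, 'm) ftr" where
  "classified = \<lparr>fobj = restrict rep_obj (Obj TOP), farr = restrict rep_arr (Arr TOP)\<rparr>"

lemma rep_pt_hom: "T \<in> Obj TOP \<Longrightarrow> t \<in> topspace T \<Longrightarrow> rep_pt T t \<in> homset C X (rep_obj T)"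
  using representsD(2)[OF rep] .

lemma rep_pt_continuous:
  assumes T: "T \<in> Obj TOP"
  shows "continuous_map T (hom_top (rep_obj T)) (rep_pt T)"
proof (rule continuous_map_eq)
  show "continuous_map T (hom_top (rep_obj T)) (\<lambda>t. Id C (rep_obj T) \<cdot> rep_pt T t)"
    by (rule representsD(4)[OF rep[OF T] id_hom[OF representsD(1)[OF rep[OF T]]]])
  show "Id C (rep_obj T) \<cdot> rep_pt T t = rep_pt T t" if "t \<in> topspace T" for t
    by (rule id_left[OF rep_pt_hom[OF T that]])
qed

lemma classified_obj: "T \<in> Obj TOP \<Longrightarrow> fobj classified T = rep_obj T"
  by (simp add: classified_def)

lemma classified_arr:
  assumes S: "S \<in> Obj TOP" and T: "T \<in> Obj TOP" and f: "continuous_map S T f"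
  shows "farr classified (top_arr S T f) \<in> homset C (rep_obj S) (rep_obj T)"
    "s \<in> topspace S \<Longrightarrow> farr classified (top_arr S T f) \<cdot> rep_pt S s = rep_pt T (f s)"
proof -
  have "continuous_map S (hom_top (rep_obj T)) (\<lambda>s. rep_pt T (f s))"
    using continuous_map_compose[OF f rep_pt_continuous[OF T]] by (simp add: comp_def)
  from representsD(3)[OF rep[OF S] representsD(1)[OF rep[OF T]] this]
  obtain u where u: "u \<in> homset C (rep_obj S) (rep_obj T)"
    "\<forall>s \<in> topspace S. u \<cdot> rep_pt S s = rep_pt T (f s)" by blast
  have "rep_arr (top_arr S T f) = u"
    unfolding rep_arr_def top_arr_def prod.case
  proof (rule the_equality)
    show "u \<in> homset C (rep_obj S) (rep_obj T) \<and>
        (\<forall>s\<in>topspace S. u \<cdot> rep_pt S s = rep_pt T (restrict f (topspace S) s))" using u by simp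
    fix v assume v: "v \<in> homset C (rep_obj S) (rep_obj T) \<and>
        (\<forall>s\<in>topspace S. v \<cdot> rep_pt S s = rep_pt T (restrict f (topspace S) s))"
    show "v = u" by (rule representsD(5)[OF rep[OF S]]) (use u v in auto)
  qed
  moreover have "top_arr S T f \<in> Arr TOP" using homsetD[OF top_arr_hom[OF S T f]] by blast
  ultimately have "farr classified (top_arr S T f) = u" by (simp add: classified_def)
  then show "farr classified (top_arr S T f) \<in> homset C (rep_obj S) (rep_obj T)"
    "s \<in> topspace S \<Longrightarrow> farr classified (top_arr S T f) \<cdot> rep_pt S s = rep_pt T (f s)" using u by auto
qed

lemma classified_functor: "is_functor TOP C classified"
  unfolding is_functor_def
proof (intro conjI category_TOP category_axioms ballI allI)
  fix T :: "'u topology" assume T: "T \<in> Obj TOP"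
  show "fobj classified T \<in> Obj C" using representsD(1)[OF rep[OF T]] classified_obj[OF T] by simp
  have c: "continuous_map T T (\<lambda>x. x)" by (simp add: continuous_map_id[unfolded id_def])
  note a = classified_arr[OF T T c]
  have "farr classified (top_arr T T (\<lambda>x. x)) = Id C (rep_obj T)"
    by (rule representsD(5)[OF rep[OF T] a(1) id_hom[OF representsD(1)[OF rep[OF T]]]])
      (simp add: a(2) id_left[OF rep_pt_hom[OF T]])
  then show "farr classified (Id TOP T) = Id C (fobj classified T)"
    by (simp add: TOP_Id classified_obj[OF T])
next
  fix S T and a :: "'u topology \<times> ('u \<Rightarrow> 'u) \<times> 'u topology" assume "a \<in> homset TOP S T"
  then obtain f where f: "a = top_arr S T f" "continuous_map S T f" "S \<in> Obj TOP" "T \<in> Obj TOP"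
    by (elim top_arrE)
  show "farr classified a \<in> homset C (fobj classified S) (fobj classified T)"
    unfolding f(1) classified_obj[OF f(3)] classified_obj[OF f(4)] by (rule classified_arr(1)[OF f(3,4,2)])
next
  fix S T W and a b :: "'u topology \<times> ('u \<Rightarrow> 'u) \<times> 'u topology"
  assume a: "a \<in> homset TOP S T" and b: "b \<in> homset TOP T W"
  obtain f where f: "a = top_arr S T f" "continuous_map S T f" "S \<in> Obj TOP" "T \<in> Obj TOP"
    using a by (elim top_arrE)
  obtain g where g: "b = top_arr T W g" "continuous_map T W g" "W \<in> Obj TOP"
    using b by (elim top_arrE)
  have gf: "continuous_map S W (\<lambda>x. g (f x))" using continuous_map_compose[OF f(2) g(2)] by (simp add: comp_def)
  note cf = classified_arr[OF f(3,4,2)] and cg = classified_arr[OF f(4) g(3,2)]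
    and cgf = classified_arr[OF f(3) g(3) gf]
  show "farr classified (b \<cdot>\<^bsub>TOP\<^esub> a) = farr classified b \<cdot> farr classified a"
    unfolding f(1) g(1) top_arr_comp[OF f(2)]
  proof (rule representsD(5)[OF rep[OF f(3)] cgf(1) comp_hom[OF cf(1) cg(1)]])
    fix s assume s: "s \<in> topspace S"
    show "farr classified (top_arr S W (\<lambda>x. g (f x))) \<cdot> rep_pt S s =
        (farr classified (top_arr T W g) \<cdot> farr classified (top_arr S T f)) \<cdot> rep_pt S s"
      using cgf(2)[OF s] cf(2)[OF s] cg(2)[OF continuous_map_in[OF f(2) s]]
        comp_assoc[OF rep_pt_hom[OF f(3) s] cf(1) cg(1)] by simp
  qed
qed

text \<open>
  The functor is a left adjoint: cocones with vertex \<open>y\<close> under the image of a diagram correspond to cocones with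
  vertex \<open>hom X y\<close> under the diagram itself. For the latter, \<open>hom X y\<close> is replaced by a homeomorphic
  object \<open>R\<close> of \<open>TOP\<close>.
\<close>

lemma classified_cocontinuous: "cocontinuous TYPE('u) TOP C classified"
  unfolding cocontinuous_def
proof (intro conjI classified_functor allI impI, elim conjE)
  fix J :: "('u, 'u) cat" and G :: "('u, 'u, 'u topology, _) ftr" and x \<kappa>
  assume "small_category J" and G: "is_functor J TOP G" and co: "is_colimit J TOP G x \<kappa>"
  let ?F = classified
  have GO: "fobj G i \<in> Obj TOP" if "i \<in> Obj J" for i using functorD(3)[OF G that] .
  have cocone: "is_cocone J TOP G x \<kappa>" using co unfolding is_colimit_def by blast
  have x: "x \<in> Obj TOP" using cocone unfolding is_cocone_def by blast
  have "\<forall>i \<in> Obj J. \<exists>k. \<kappa> i = top_arr (fobj G i) x k \<and> continuous_map (fobj G i) x k"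
  proof
    fix i assume "i \<in> Obj J"
    then have "\<kappa> i \<in> homset TOP (fobj G i) x" using cocone unfolding is_cocone_def by blast
    then show "\<exists>k. \<kappa> i = top_arr (fobj G i) x k \<and> continuous_map (fobj G i) x k" by (elim top_arrE) blast
  qed
  from bchoice[OF this] obtain k where
    k: "\<forall>i \<in> Obj J. \<kappa> i = top_arr (fobj G i) x (k i) \<and> continuous_map (fobj G i) x (k i)" ..
  have F\<kappa>: "farr ?F (\<kappa> i) \<in> homset C (rep_obj (fobj G i)) (rep_obj x)"
    "\<And>s. s \<in> topspace (fobj G i) \<Longrightarrow> farr ?F (\<kappa> i) \<cdot> rep_pt (fobj G i) s = rep_pt x (k i s)"
    if "i \<in> Obj J" for i
    using classified_arr[OF GO[OF that] x] k that by auto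
  have FG: "fobj (comp_ftr ?F G) i = rep_obj (fobj G i)" if "i \<in> Obj J" for i
    using classified_obj[OF GO[OF that]] by (simp add: comp_ftr_def)
  show "is_colimit J C (comp_ftr ?F G) (fobj ?F x) (\<lambda>i. farr ?F (\<kappa> i))"
    unfolding is_colimit_def
  proof (intro conjI allI impI)
    show "is_cocone J C (comp_ftr ?F G) (fobj ?F x) (\<lambda>i. farr ?F (\<kappa> i))"
      unfolding is_cocone_def
    proof (intro conjI ballI allI)
      show "fobj ?F x \<in> Obj C" using functorD(3)[OF classified_functor x] .
      show "farr ?F (\<kappa> i) \<in> homset C (fobj (comp_ftr ?F G) i) (fobj ?F x)" if "i \<in> Obj J" for i
        using F\<kappa>(1)[OF that] FG[OF that] classified_obj[OF x] by simp
      fix i j a assume a: "a \<in> homset J i j"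
      have j: "j \<in> Obj J" using category.hom_obj[OF functorD(1)[OF G] a] by blast
      have \<kappa>j: "\<kappa> j \<in> homset TOP (fobj G j) x" using cocone j unfolding is_cocone_def by blast
      have "\<kappa> j \<cdot>\<^bsub>TOP\<^esub> farr G a = \<kappa> i" using cocone a unfolding is_cocone_def by blast
      then show "farr ?F (\<kappa> j) \<cdot> farr (comp_ftr ?F G) a = farr ?F (\<kappa> i)"
        using functorD(6)[OF classified_functor functorD(4)[OF G a] \<kappa>j] by (simp add: comp_ftr_def)
    qed
    fix y \<mu> assume \<mu>: "is_cocone J C (comp_ftr ?F G) y \<mu>"
    have y: "y \<in> Obj C" using \<mu> unfolding is_cocone_def by blast
    have \<mu>h: "\<mu> i \<in> homset C (rep_obj (fobj G i)) y" if "i \<in> Obj J" for i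
    proof -
      have "\<mu> i \<in> homset C (fobj (comp_ftr ?F G) i) y" using \<mu> that unfolding is_cocone_def by blast
      then show ?thesis by (simp only: FG[OF that])
    qed
    have "small TYPE('u) (topspace (hom_top y))"
      using locally_small X_Obj y hom_top(1)[OF y] unfolding locally_small_def by simp
    then obtain R e d where R: "(R :: 'u topology) \<in> Obj TOP" and ed: "homeomorphic_maps (hom_top y) R e d"
      by (rule small_copy)
    have e_cont: "continuous_map (hom_top y) R e" and d_cont: "continuous_map R (hom_top y) d"
      and de: "\<And>h. h \<in> homset C X y \<Longrightarrow> d (e h) = h"
      using ed hom_top(1)[OF y] unfolding homeomorphic_maps_def by auto
    define m where "m i s = \<mu> i \<cdot> rep_pt (fobj G i) s" for i s
    have m: "continuous_map (fobj G i) (hom_top y) (m i)" if "i \<in> Obj J" for i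
      unfolding m_def using representsD(4)[OF rep[OF GO[OF that]] \<mu>h[OF that]] .
    have em: "continuous_map (fobj G i) R (\<lambda>s. e (m i s))" if "i \<in> Obj J" for i
      using continuous_map_compose[OF m[OF that] e_cont] by (simp add: comp_def)
    let ?\<nu> = "\<lambda>i. top_arr (fobj G i) R (\<lambda>s. e (m i s))"
    have "is_cocone J TOP G R ?\<nu>"
      unfolding is_cocone_def
    proof (intro conjI R ballI allI)
      show "?\<nu> i \<in> homset TOP (fobj G i) R" if "i \<in> Obj J" for i
        using top_arr_hom[OF GO[OF that] R em[OF that]] .
      fix i j a assume a: "a \<in> homset J i j"
      have o: "i \<in> Obj J" "j \<in> Obj J" using category.hom_obj[OF functorD(1)[OF G] a] by auto
      obtain g where g: "farr G a = top_arr (fobj G i) (fobj G j) g" "continuous_map (fobj G i) (fobj G j) g"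
        using functorD(4)[OF G a] by (elim top_arrE)
      show "?\<nu> j \<cdot>\<^bsub>TOP\<^esub> farr G a = ?\<nu> i"
        unfolding g(1) top_arr_comp[OF g(2)]
      proof (rule top_arr_cong)
        fix s assume s: "s \<in> topspace (fobj G i)"
        note Fg = classified_arr[OF GO[OF o(1)] GO[OF o(2)] g(2)]
        have "\<mu> j \<cdot> farr ?F (farr G a) = \<mu> i" using \<mu> a unfolding is_cocone_def by (simp add: comp_ftr_def)
        then have "m i s = m j (g s)"
          using comp_assoc[OF rep_pt_hom[OF GO[OF o(1)] s] Fg(1) \<mu>h[OF o(2)]] Fg(2)[OF s]
          unfolding m_def g(1) by simp
        then show "e (m j (g s)) = e (m i s)" by simp
      qed
    qed
    then have "\<exists>!v. v \<in> homset TOP x R \<and> (\<forall>i\<in>Obj J. v \<cdot>\<^bsub>TOP\<^esub> \<kappa> i = ?\<nu> i)"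
      using co unfolding is_colimit_def by blast
    then obtain v where v: "v \<in> homset TOP x R" "\<forall>i\<in>Obj J. v \<cdot>\<^bsub>TOP\<^esub> \<kappa> i = ?\<nu> i"
      and v_unique: "\<And>v'. v' \<in> homset TOP x R \<Longrightarrow> \<forall>i\<in>Obj J. v' \<cdot>\<^bsub>TOP\<^esub> \<kappa> i = ?\<nu> i \<Longrightarrow> v' = v" by blast
    obtain w where w: "v = top_arr x R w" "continuous_map x R w" using v(1) by (elim top_arrE)
    have wk: "w (k i s) = e (m i s)" if i: "i \<in> Obj J" and s: "s \<in> topspace (fobj G i)" for i s
    proof -
      have "top_arr (fobj G i) R (\<lambda>s. w (k i s)) = ?\<nu> i"
        using v(2) i k top_arr_comp[of "fobj G i" x "k i" R w] unfolding w(1) by auto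
      from top_arr_eqD[OF this s] show ?thesis .
    qed
    have mH: "m i s \<in> homset C X y" if "i \<in> Obj J" "s \<in> topspace (fobj G i)" for i s
      using continuous_map_in[OF m[OF that(1)] that(2)] hom_top(1)[OF y] by simp
    have "continuous_map x (hom_top y) (\<lambda>t. d (w t))"
      using continuous_map_compose[OF w(2) d_cont] by (simp add: comp_def)
    from representsD(3)[OF rep[OF x] y this] obtain u where
      u: "u \<in> homset C (rep_obj x) y" "\<And>t. t \<in> topspace x \<Longrightarrow> u \<cdot> rep_pt x t = d (w t)" by blast
    have k_in: "k i s \<in> topspace x" if "i \<in> Obj J" "s \<in> topspace (fobj G i)" for i s
      using k that continuous_map_in by fast
    have comp_pt: "(u' \<cdot> farr ?F (\<kappa> i)) \<cdot> rep_pt (fobj G i) s = u' \<cdot> rep_pt x (k i s)"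
      if "i \<in> Obj J" "s \<in> topspace (fobj G i)" "u' \<in> homset C (rep_obj x) y" for u' i s
      using comp_assoc[OF rep_pt_hom[OF GO[OF that(1)] that(2)] F\<kappa>(1)[OF that(1)] that(3)]
        F\<kappa>(2)[OF that(1,2)] by simp
    show "\<exists>!u. u \<in> homset C (fobj ?F x) y \<and> (\<forall>i\<in>Obj J. u \<cdot> farr ?F (\<kappa> i) = \<mu> i)"
      unfolding classified_obj[OF x]
    proof (rule ex1I[of _ u], intro conjI u(1) ballI)
      fix i assume i: "i \<in> Obj J"
      show "u \<cdot> farr ?F (\<kappa> i) = \<mu> i"
      proof (rule representsD(5)[OF rep[OF GO[OF i]] comp_hom[OF F\<kappa>(1)[OF i] u(1)] \<mu>h[OF i]])
        fix s assume s: "s \<in> topspace (fobj G i)"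
        show "(u \<cdot> farr ?F (\<kappa> i)) \<cdot> rep_pt (fobj G i) s = \<mu> i \<cdot> rep_pt (fobj G i) s"
          using comp_pt[OF i s u(1)] u(2)[OF k_in[OF i s]] wk[OF i s] de[OF mH[OF i s]] by (simp add: m_def)
      qed
    next
      fix u' assume "u' \<in> homset C (rep_obj x) y \<and> (\<forall>i\<in>Obj J. u' \<cdot> farr ?F (\<kappa> i) = \<mu> i)"
      then have u': "u' \<in> homset C (rep_obj x) y" "\<And>i. i \<in> Obj J \<Longrightarrow> u' \<cdot> farr ?F (\<kappa> i) = \<mu> i" by auto
      have c: "continuous_map x (hom_top y) (\<lambda>t. u' \<cdot> rep_pt x t)" by (rule representsD(4)[OF rep[OF x] u'(1)])
      have c': "continuous_map x R (\<lambda>t. e (u' \<cdot> rep_pt x t))"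
        using continuous_map_compose[OF c e_cont] by (simp add: comp_def)
      have "top_arr x R (\<lambda>t. e (u' \<cdot> rep_pt x t)) = v"
      proof (rule v_unique[OF top_arr_hom[OF x R c']], rule ballI)
        fix i assume i: "i \<in> Obj J"
        have ki: "\<kappa> i = top_arr (fobj G i) x (k i)" "continuous_map (fobj G i) x (k i)" using k i by auto
        show "top_arr x R (\<lambda>t. e (u' \<cdot> rep_pt x t)) \<cdot>\<^bsub>TOP\<^esub> \<kappa> i = ?\<nu> i"
          unfolding ki(1) top_arr_comp[OF ki(2)]
        proof (rule top_arr_cong)
          fix s assume s: "s \<in> topspace (fobj G i)"
          show "e (u' \<cdot> rep_pt x (k i s)) = e (m i s)"
            using comp_pt[OF i s u'(1)] u'(2)[OF i] by (simp add: m_def)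
        qed
      qed
      then have ew: "e (u' \<cdot> rep_pt x t) = w t" if "t \<in> topspace x" for t
        using top_arr_eqD[of x R _ w t] that unfolding w(1) by blast
      show "u' = u"
      proof (rule representsD(5)[OF rep[OF x] u'(1) u(1)])
        fix t assume t: "t \<in> topspace x"
        have "u' \<cdot> rep_pt x t \<in> homset C X y" using comp_hom[OF rep_pt_hom[OF x t] u'(1)] .
        from de[OF this] show "u' \<cdot> rep_pt x t = u \<cdot> rep_pt x t" using ew[OF t] u(2)[OF t] by simp
      qed
    qed
  qed
qed

lemma classified_Hom_c: "classified \<in> Obj HOM"
  unfolding Hom_c_Obj using classified_cocontinuous by (simp add: classified_def)

sublocale cl: cocontinuous_on_TOP \<UU> C classified
  by (rule cocontinuous_on_TOP[OF classified_Hom_c])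

text \<open>
  Both \<open>X\<close> and the value of \<open>classified\<close> at the point represent the functor \<open>y \<mapsto> hom X y\<close>, so there is an
  isomorphism \<open>j\<close> between them. Composition with \<open>j\<close> identifies the two notions of convergence at every
  stage (\<open>conv_iff\<close>), since both are continuity of maps from \<open>net_space P\<close> into \<open>hom X y\<close>.
\<close>

theorem classified_evaluation: "\<exists>f \<in> homset (CoTop C) (fobj ev classified) (X, \<iota>). is_iso (CoTop C) f"
proof -
  have e: "fobj ev classified = (cl.X, cl.ev_map)" using cl.ev_eq by (simp add: evaluation_def)
  have X': "cl.X = rep_obj point_space" by (rule classified_obj[OF point_space_Obj])
  obtain j k where j: "j \<in> homset C X cl.X" and k: "k \<in> homset C cl.X X"
    and kj: "k \<cdot> j = Id C X" and jk: "j \<cdot> k = Id C cl.X"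
    and je: "\<And>s. s \<in> topspace point_space \<Longrightarrow> j \<cdot> Id C X = rep_pt point_space s"
    using represents_iso[OF point_represented rep[OF point_space_Obj]] unfolding X' by metis
  have j_eq: "j = rep_pt point_space undefined" using je id_right[OF j] by (simp add: topspace_point_space)
  have pt_j: "cl.pt T t \<cdot> j = rep_pt T t" if T: "T \<in> Obj TOP" and t: "t \<in> topspace T" for T t
  proof -
    have c: "continuous_map point_space T (\<lambda>_. t)" using t by (simp add: point_space_def)
    show ?thesis
      unfolding cl.pt_def j_eq point_of_eq
      by (rule classified_arr(2)[OF point_space_Obj T c]) (simp add: topspace_point_space)
  qed
  have ext_iff: "cl.extends T y \<phi> \<longleftrightarrow> (\<forall>t \<in> topspace T. \<phi> t \<in> homset C cl.X y) \<and>
      continuous_map T (hom_top y) (\<lambda>t. \<phi> t \<cdot> j)"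
    if T: "T \<in> Obj TOP" and y: "y \<in> Obj C" for T y \<phi>
  proof
    assume ext: "cl.extends T y \<phi>"
    then obtain u where u: "u \<in> homset C (rep_obj T) y" "\<And>t. t \<in> topspace T \<Longrightarrow> u \<cdot> cl.pt T t = \<phi> t"
      unfolding cl.extends_def classified_obj[OF T] by blast
    have pth: "cl.pt T t \<in> homset C cl.X (rep_obj T)" if "t \<in> topspace T" for t
      using cl.pt_hom[OF T that] classified_obj[OF T] by simp
    have "continuous_map T (hom_top y) (\<lambda>t. u \<cdot> rep_pt T t)" by (rule representsD(4)[OF rep[OF T] u(1)])
    then have "continuous_map T (hom_top y) (\<lambda>t. \<phi> t \<cdot> j)"
    proof (rule continuous_map_eq)
      fix t assume t: "t \<in> topspace T"
      show "u \<cdot> rep_pt T t = \<phi> t \<cdot> j"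
        using comp_assoc[OF j pth[OF t] u(1)] u(2)[OF t] pt_j[OF T t] by simp
    qed
    then show "(\<forall>t \<in> topspace T. \<phi> t \<in> homset C cl.X y) \<and> continuous_map T (hom_top y) (\<lambda>t. \<phi> t \<cdot> j)"
      using cl.extends_hom[OF T ext] by blast
  next
    assume R: "(\<forall>t \<in> topspace T. \<phi> t \<in> homset C cl.X y) \<and> continuous_map T (hom_top y) (\<lambda>t. \<phi> t \<cdot> j)"
    then obtain u where u: "u \<in> homset C (rep_obj T) y" "\<And>t. t \<in> topspace T \<Longrightarrow> u \<cdot> rep_pt T t = \<phi> t \<cdot> j"
      using representsD(3)[OF rep[OF T] y] by blast
    have "u \<cdot> cl.pt T t = \<phi> t" if t: "t \<in> topspace T" for t
    proof -
      have pth: "cl.pt T t \<in> homset C cl.X (rep_obj T)" using cl.pt_hom[OF T t] classified_obj[OF T] by simp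
      have \<phi>t: "\<phi> t \<in> homset C cl.X y" using R t by blast
      have "u \<cdot> cl.pt T t = (u \<cdot> cl.pt T t) \<cdot> (j \<cdot> k)" using id_right[OF comp_hom[OF pth u(1)]] jk by simp
      also have "\<dots> = (u \<cdot> (cl.pt T t \<cdot> j)) \<cdot> k"
        using comp_assoc[OF k j comp_hom[OF pth u(1)]] comp_assoc[OF j pth u(1)] by simp
      also have "\<dots> = (\<phi> t \<cdot> j) \<cdot> k" using pt_j[OF T t] u(2)[OF t] by simp
      also have "\<dots> = \<phi> t" using comp_assoc[OF k j \<phi>t] id_right[OF \<phi>t] jk by simp
      finally show ?thesis .
    qed
    then show "cl.extends T y \<phi>" unfolding cl.extends_def classified_obj[OF T] using u(1) by blast
  qed
  have upd: "(\<lambda>t. (g(a := l)) t \<cdot> h) = (\<lambda>t. g t \<cdot> h)(a := l \<cdot> h)" for g :: "'u \<Rightarrow> 'm" and a l h by auto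
  have conv_iff: "converges (opcat C) cl.X cl.ev_map y P g l \<longleftrightarrow>
      (\<forall>p \<in> Field P. g p \<in> homset C cl.X y) \<and> l \<in> homset C cl.X y \<and>
      converges (opcat C) X \<iota> y P (\<lambda>p. g p \<cdot> j) (l \<cdot> j)"
    if P: "small_directed P" and y: "y \<in> Obj C" for P y g l
  proof -
    have "(\<forall>t \<in> topspace (net_space P). (g(infpt P := l)) t \<in> homset C cl.X y) \<longleftrightarrow>
        (\<forall>p \<in> Field P. g p \<in> homset C cl.X y) \<and> l \<in> homset C cl.X y"
      using infpt_notin[OF P] by (auto simp: topspace_net_space[OF P])
    then show ?thesis
      unfolding cl.ev_converges_iff[OF P] ext_iff[OF net_space_Obj[OF P] y] upd
        continuous_map_net_space'[OF P] hom_top(2)[OF y P] by simp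
  qed
  have cj: "continuous_arr (opcat C) cl.X cl.ev_map j X \<iota>"
    unfolding continuous_arr_def using conv_iff by simp
  have ck: "continuous_arr (opcat C) X \<iota> k cl.X cl.ev_map"
    unfolding continuous_arr_def
  proof (intro ballI allI impI)
    fix y P g l assume y: "y \<in> Obj (opcat C)" and P: "small_directed P" and c: "converges (opcat C) X \<iota> y P g l"
    have h: "\<And>p. p \<in> Field P \<Longrightarrow> g p \<in> homset C X y" "l \<in> homset C X y"
      using fam.converges_hom[OF P c] by simp_all
    have "(g p \<cdot> k) \<cdot> j = g p" if "p \<in> Field P" for p
      using comp_assoc[OF j k h(1)[OF that]] id_right[OF h(1)[OF that]] kj by simp
    moreover have "(l \<cdot> k) \<cdot> j = l" using comp_assoc[OF j k h(2)] id_right[OF h(2)] kj by simp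
    ultimately have "converges (opcat C) X \<iota> y P (\<lambda>p. (g p \<cdot> k) \<cdot> j) ((l \<cdot> k) \<cdot> j)"
      using c fam.converges_cong[of P "\<lambda>p. (g p \<cdot> k) \<cdot> j" g "(l \<cdot> k) \<cdot> j" l y] by simp
    then show "converges (opcat C) cl.X cl.ev_map y P (\<lambda>p. k \<cdot>\<^bsub>opcat C\<^esub> g p) (k \<cdot>\<^bsub>opcat C\<^esub> l)"
      using conv_iff[OF P, of y "\<lambda>p. g p \<cdot> k" "l \<cdot> k"] comp_hom[OF k h(1)] comp_hom[OF k h(2)] y by simp
  qed
  let ?f = "((X, \<iota>), k, (cl.X, cl.ev_map))" and ?g = "((cl.X, cl.ev_map), j, (X, \<iota>))"
  have f: "?f \<in> homset (CoTop C) (cl.X, cl.ev_map) (X, \<iota>)"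
    unfolding CoTop_homset using cl.ev_topology cotop k ck by simp
  have g: "?g \<in> homset (CoTop C) (X, \<iota>) (cl.X, cl.ev_map)"
    unfolding CoTop_homset using cl.ev_topology cotop j cj by simp
  have "is_iso (CoTop C) ?f"
    by (rule category.is_isoI[OF category_CoTop f g]) (simp_all add: CoTop_simps jk kj)
  then show ?thesis unfolding e using f by blast
qed

end

context cocomplete_cat begin

theorem ev_equivalence: "is_equivalence HOM (CoTop C) ev"
proof (rule equivalence_if_ff_es[OF ev_functor ev_fully_faithful])
  fix A assume "A \<in> Obj (CoTop C :: ('o \<times> ('u rel \<Rightarrow> 'm), _) cat)"
  then obtain X \<iota> where A: "A = (X, \<iota>)" and t: "is_topology (opcat C) X (\<iota> :: 'u rel \<Rightarrow> 'm)"
    by (cases A) (simp add: CoTop_Obj)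
  interpret cotopological_space \<UU> C X \<iota>
    by (intro cotopological_space.intro cocomplete_cat_axioms cotopological_space_axioms.intro t)
  show "\<exists>F\<in>Obj HOM. \<exists>f\<in>homset (CoTop C) (fobj ev F) A. is_iso (CoTop C) f"
    unfolding A using classified_Hom_c classified_evaluation by blast
qed

end

theorem theorem1p6:
  assumes "inaccessible TYPE('u)"
  shows "category (TOP :: ('u topology, _) cat) \<and>
    locally_small TYPE('u) (TOP :: ('u topology, _) cat) \<and>
    cocomplete TYPE('u) (TOP :: ('u topology, _) cat) \<and>
    (universal_cospace :: 'u topology \<times> _) \<in> Obj (CoTop TOP) \<and>
    (\<forall>C :: ('o, 'm) cat. category C \<and> locally_small TYPE('u) C \<and> cocomplete TYPE('u) C \<longrightarrow>
       is_equivalence (Hom_c TYPE('u) (TOP :: ('u topology, _) cat) C) (CoTop C)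
         (evaluation TOP C universal_cospace))"
proof -
  interpret universe "TYPE('u)" by (rule universe.intro[OF assms])
  have "is_equivalence (Hom_c TYPE('u) (TOP :: ('u topology, _) cat) C) (CoTop C)
      (evaluation TOP C universal_cospace)"
    if "category C" "locally_small TYPE('u) C" "cocomplete TYPE('u) C" for C :: "('o, 'm) cat"
  proof -
    interpret cocomplete_cat "TYPE('u)" C
      by (intro cocomplete_cat.intro universe_axioms cocomplete_cat_axioms.intro that)
    show ?thesis by (rule ev_equivalence)
  qed
  then show ?thesis
    using category_TOP locally_small_TOP cocomplete_TOP universal_cospace_CoTop by blast
qed

end
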